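(* Let $G$ be a planar graph with $\mathrm{dist}^{\Delta}(G) \geq 2$ and without cycles of length $5$, $6$, $7$. Then $G$ is $(\mathcal{I}, \mathcal{F})$-partitionable.
   Context: Graphs are finite and simple. A triangle is a $3$-cycle. For a graph $G$, $\mathrm{dist}^{\Delta}(G) = \min\{d_G(v_1,v_2) : v_1 \in V(T_1),\ v_2 \in V(T_2),\ T_1, T_2 \text{ distinct triangles of } G\}$, where $d_G$ is the graph distance; if $G$ has at most one triangle, $\mathrm{dist}^{\Delta}(G) = +\infty$. "Without cycles of length $k$" means no subgraph (not necessarily induced) isomorphic to a $k$-cycle. A graph $G$ is $(\mathcal{I}, \mathcal{F})$-partitionable if $V(G)$ can be partitioned into two (possibly empty) sets $\mathcal{I}$ and $\mathcal{F}$ such that the induced subgraph $G[\mathcal{I}]$ has no edges and the induced subgraph $G[\mathcal{F}]$ is a forest. *)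

theory Defs
  imports
    "Graph_Theory.Digraph_Component"
    "Graph_Theory.Shortest_Path"
    "HOL-Analysis.Analysis"
begin

text \<open>
  Finite simple graphs are the symmetric digraphs of the locale \<^locale>\<open>graph\<close>: every
  undirected edge is represented by a pair of opposite arcs.

  The library's \<^const>\<open>pre_digraph.cycle\<close> traverses pairwise distinct vertices, but it also
  accepts the closed walk of length 2 along an edge and back. In a graph, the cycles of the
  underlying undirected graph are therefore exactly those of length at least 3. For the same
  reason the library's \<^const>\<open>Digraph_Component.forest\<close> does not describe undirected forests.
\<close>

definition has_cycle_of_length :: "('a, 'b) pre_digraph \<Rightarrow> nat \<Rightarrow> bool" where
  "has_cycle_of_length G k \<longleftrightarrow> 3 \<le> k \<and> (\<exists>p. pre_digraph.cycle G p \<and> length p = k)"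

definition undirected_forest :: "('a, 'b) pre_digraph \<Rightarrow> bool" where
  "undirected_forest G \<longleftrightarrow> (\<nexists>k. has_cycle_of_length G k)"

text \<open>
  In a graph without parallel edges a triangle is determined by its vertex set, so triangles
  are represented by their vertex sets.
\<close>

definition triangles :: "('a, 'b) pre_digraph \<Rightarrow> 'a set set" where
  "triangles G = {tail G ` set p | p. pre_digraph.cycle G p \<and> length p = 3}"

definition graph_dist :: "('a, 'b) pre_digraph \<Rightarrow> 'a \<Rightarrow> 'a \<Rightarrow> ereal" where
  "graph_dist G = wf_digraph.\<mu> G (\<lambda>_. 1)"

text \<open>The infimum of the empty set in \<^typ>\<open>ereal\<close> is \<open>\<infinity>\<close>.\<close>

definition triangle_dist :: "('a, 'b) pre_digraph \<Rightarrow> ereal" where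
  "triangle_dist G =
     Inf {graph_dist G u v | u v S T.
            S \<in> triangles G \<and> T \<in> triangles G \<and> S \<noteq> T \<and> u \<in> S \<and> v \<in> T}"

definition undirected_edges :: "('a, 'b) pre_digraph \<Rightarrow> 'a set set" where
  "undirected_edges G = {{tail G e, head G e} | e. e \<in> arcs G}"

definition arc_interior :: "(real \<Rightarrow> complex) \<Rightarrow> complex set" where
  "arc_interior c = path_image c - {pathstart c, pathfinish c}"

text \<open>
  A drawing in the plane (represented by \<^typ>\<open>complex\<close>) without crossings: vertices are
  distinct points, edges are simple arcs between their end vertices, and the interior of an
  edge contains no vertex and no point of any other edge.
\<close>

definition plane_embedding ::
  "('a, 'b) pre_digraph \<Rightarrow> ('a \<Rightarrow> complex) \<Rightarrow> ('a set \<Rightarrow> real \<Rightarrow> complex) \<Rightarrow> bool" where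
  "plane_embedding G \<phi> \<gamma> \<longleftrightarrow>
     inj_on \<phi> (verts G) \<and>
     (\<forall>e\<in>undirected_edges G.
        arc (\<gamma> e) \<and>
        {pathstart (\<gamma> e), pathfinish (\<gamma> e)} = \<phi> ` e \<and>
        arc_interior (\<gamma> e) \<inter> \<phi> ` verts G = {} \<and>
        (\<forall>f\<in>undirected_edges G. f \<noteq> e \<longrightarrow> arc_interior (\<gamma> e) \<inter> path_image (\<gamma> f) = {}))"

definition planar :: "('a, 'b) pre_digraph \<Rightarrow> bool" where
  "planar G \<longleftrightarrow> (\<exists>\<phi> \<gamma>. plane_embedding G \<phi> \<gamma>)"

definition IF_partitionable :: "('a, 'b) pre_digraph \<Rightarrow> bool" where
  "IF_partitionable G \<longleftrightarrow>
     (\<exists>I F. I \<union> F = verts G \<and> I \<inter> F = {} \<and>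
            arcs (G \<restriction> I) = {} \<and> undirected_forest (G \<restriction> F))"

end

(*
  The theorem is strengthened so that the side of one vertex v0 is prescribed.  In a minimal
  counterexample the graph is 2-connected (otherwise partitions are glued along a cut vertex) and
  every vertex other than v0 has degree at least 3 (a vertex of degree at most 2 can always be
  added).  Call a vertex light if it has degree 3.  The light vertices of a cycle
  can be coloured greedily along it, and a triangle on the cycle leaves enough freedom to close up
  the colouring.  This makes three configurations reducible: an all-light cycle with an all-light
  triangle on one of its edges; an 8-cycle that is light except for one 4-vertex, with a triangle
  at the 4-vertex and another all-light triangle; and two such 8-cycles meeting at a 4-vertex.

  Without cycles of length 5, 6 or 7 every face has length 3, 4 or at least 8, and faces of length
  at most 4 are pairwise nonadjacent.  Give each vertex v the charge deg v - 4 and each face f the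
  charge |f| - 4; by Euler's formula the total is -8.  Faces of length at least 8 send charge to
  their light vertices and across their edges to the adjacent triangles, and receive charge from
  vertices of degree at least 5; reducibility ensures that no such face is overdrawn.  Only v0, its
  neighbours and a triangle at v0 can remain negative, and together they owe at most 41/6 < 8.

  Faces and Euler's formula come from an ear decomposition: a 2-connected plane graph arises from a
  cycle by adding ears, and by the theta-curve theorem each ear splits exactly one face region.
*)
theory Submission
  imports Defs
begin

section \<open>Paths and cycles as vertex lists\<close>

text \<open>The two sides of a partition are not interchangeable, so partitions of two blocks can be
  matched at a cut vertex only if its side can be prescribed; hence the induction ranges over all
  vertices and both sides. The price is that \<open>v0\<close> may have degree 2 and must stay out
  of every reduction. Acyclicity is not a local condition. Partial partitions are therefore extended
  under the invariant that old forest components are never merged: a vertex started as a component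
  of its own is still apart from the old ones when the last vertex joins it to one of them. The
  constants come from this balance. A light vertex lacks 1 and takes 1/3 from each of three big
  faces or 1/2 from each of two; a triangle lacks 1 and, if all-light, takes 1/3 across each edge.
  Triangle edges on a face are separated by at least two other edges, so a face of length
  \<open>k\<close> with \<open>t\<close> all-light triangle edges gives at most
  \<open>k/2 + t/3\<close> with \<open>3 t \<le> k\<close>, which is within \<open>k - 4\<close> as
  soon as \<open>k \<ge> 10\<close>. Only the lengths 8 and 9 need finer counting, and only 8 the
  reductions of 8-cycles.\<close>

fun pedges :: "'a list \<Rightarrow> 'a set set" where
  "pedges (x # y # xs) = insert {x, y} (pedges (y # xs))"
| "pedges _ = {}"

definition cedges :: "'a list \<Rightarrow> 'a set set" where
  "cedges c = insert {last c, hd c} (pedges c)"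

text \<open>A cycle has many such lists, one for each starting point and direction. Whatever must
  not depend on that choice, faces in particular, is stored as the edge set
  \<open>cedges c\<close>.\<close>

definition cyc :: "'a set set \<Rightarrow> 'a list \<Rightarrow> bool" where
  "cyc E c \<longleftrightarrow> distinct c \<and> 3 \<le> length c \<and> cedges c \<subseteq> E"

definition nbrs :: "'a set set \<Rightarrow> 'a \<Rightarrow> 'a set" where
  "nbrs E v = {u. {v, u} \<in> E}"

definition two_sets :: "'a set set \<Rightarrow> bool" where
  "two_sets E \<longleftrightarrow> (\<forall>e\<in>E. card e = 2)"

lemma two_sets_irrefl: "two_sets E \<Longrightarrow> {u, v} \<in> E \<Longrightarrow> u \<noteq> v"
  unfolding two_sets_def by fastforce

lemma two_setsE:
  assumes "two_sets E" "e \<in> E" obtains u v where "e = {u, v}" "u \<noteq> v"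
  using assms unfolding two_sets_def by (metis card_2_iff)

lemma pedges_snoc2: "pedges (xs @ [x, y]) = insert {x, y} (pedges (xs @ [x]))"
  by (induction xs rule: pedges.induct) auto

lemma pedges_Cons: "xs \<noteq> [] \<Longrightarrow> pedges (x # xs) = insert {x, hd xs} (pedges xs)"
  by (cases xs) auto

lemma pedges_snoc: "xs \<noteq> [] \<Longrightarrow> pedges (xs @ [y]) = insert {last xs, y} (pedges xs)"
  by (cases xs rule: rev_cases) (auto simp: pedges_snoc2)

lemma pedges_append: "pedges (xs @ y # ys) = pedges (xs @ [y]) \<union> pedges (y # ys)"
  by (induction xs rule: pedges.induct) auto

lemma pedges_rev [simp]: "pedges (rev xs) = pedges xs"
  by (induction xs rule: pedges.induct) (auto simp: pedges_snoc2 insert_commute)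

lemma pedges_vertices: "\<Union> (pedges p) \<subseteq> set p"
  by (induction p rule: pedges.induct) auto

lemma pedges_Union: "2 \<le> length p \<Longrightarrow> \<Union> (pedges p) = set p"
proof (induction p rule: pedges.induct)
  case (1 x y xs) then show ?case by (cases xs) auto
qed auto

lemma pedges_mono_append1: "pedges xs \<subseteq> pedges (xs @ ys)"
  by (induction xs rule: pedges.induct) auto

lemma finite_pedges [simp]: "finite (pedges p)"
  by (induction p rule: pedges.induct) auto

lemma finite_cedges [simp]: "finite (cedges c)"
  by (simp add: cedges_def)

lemma pedges_card2: "distinct p \<Longrightarrow> e \<in> pedges p \<Longrightarrow> card e = 2"
  by (induction p rule: pedges.induct) auto

lemma cedges_Union: "c \<noteq> [] \<Longrightarrow> \<Union> (cedges c) = set c"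
proof (cases "2 \<le> length c")
  case True
  moreover have "c \<noteq> []" using True by auto
  ultimately show ?thesis using pedges_Union[of c] by (auto simp: cedges_def)
next
  case False
  assume "c \<noteq> []"
  then show ?thesis using False by (cases c; cases "tl c") (auto simp: cedges_def)
qed

lemma cedges_Cons: "p \<noteq> [] \<Longrightarrow> cedges (v # p) = insert {last p, v} (insert {v, hd p} (pedges p))"
  by (auto simp: cedges_def pedges_Cons)

lemma cedges_rotate1: "cedges (rotate1 c) = cedges c"
proof (cases c)
  case (Cons x xs)
  then show ?thesis by (cases "xs = []") (auto simp: cedges_def pedges_snoc pedges_Cons hd_append insert_commute)
qed simp

lemma cedges_rotate [simp]: "cedges (rotate n c) = cedges c"
  by (induction n) (auto simp: cedges_rotate1)

lemma cedges_rev [simp]: "cedges (rev c) = cedges c"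
  by (auto simp: cedges_def hd_rev last_rev insert_commute)

lemma cyc_rotate [simp]: "cyc E (rotate n c) \<longleftrightarrow> cyc E c"
  by (simp add: cyc_def)

lemma cyc_rev [simp]: "cyc E (rev c) \<longleftrightarrow> cyc E c"
  by (simp add: cyc_def)

lemma cedges_append:
  "cedges (a # xs @ b # ys) = pedges (a # xs @ [b]) \<union> pedges (b # ys @ [a])"
proof -
  have "pedges (a # xs @ b # ys) = pedges (a # xs @ [b]) \<union> pedges (b # ys)"
    using pedges_append[of "a # xs" b ys] by simp
  moreover have "pedges (b # ys @ [a]) = insert {last (b # ys), a} (pedges (b # ys))"
    using pedges_snoc[of "b # ys" a] by simp
  ultimately show ?thesis by (auto simp: cedges_def)
qed

lemma rotate_to_front:
  assumes "v \<in> set c" obtains n p where "rotate n c = v # p"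
proof -
  obtain xs ys where "c = xs @ v # ys" using assms by (meson split_list)
  then have "rotate (length xs) c = v # ys @ xs" by (simp add: rotate_append)
  then show ?thesis using that by blast
qed

lemma pedges_nth: "pedges p = {{p ! i, p ! Suc i} | i. Suc i < length p}"
proof (induction p rule: pedges.induct)
  case (1 x y xs)
  let ?p = "x # y # xs"
  have "{{?p ! i, ?p ! Suc i} | i. Suc i < length ?p} =
      insert {?p ! 0, ?p ! Suc 0} {{?p ! Suc i, ?p ! Suc (Suc i)} | i. Suc (Suc i) < length ?p}"
  proof -
    have "{i. Suc i < length ?p} = insert 0 (Suc ` {i. Suc (Suc i) < length ?p})"
      by (auto simp: image_iff) (metis Suc_less_SucD not0_implies_Suc)
    then have "(\<lambda>i. {?p ! i, ?p ! Suc i}) ` {i. Suc i < length ?p} =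
        (\<lambda>i. {?p ! i, ?p ! Suc i}) ` insert 0 (Suc ` {i. Suc (Suc i) < length ?p})" by simp
    then show ?thesis by (simp add: setcompr_eq_image image_image)
  qed
  then show ?case using 1 by simp
qed auto

lemma cedges_nth:
  assumes "c \<noteq> []"
  shows "cedges c = (\<lambda>i. {c ! i, c ! (Suc i mod length c)}) ` {..<length c}"
proof -
  have l: "{last c, hd c} = {c ! (length c - 1), c ! (Suc (length c - 1) mod length c)}"
    using assms by (simp add: last_conv_nth hd_conv_nth)
  show ?thesis
  proof (rule set_eqI, rule iffI)
    fix e assume "e \<in> cedges c"
    then consider "e = {last c, hd c}" | "e \<in> pedges c" by (auto simp: cedges_def)
    then show "e \<in> (\<lambda>i. {c ! i, c ! (Suc i mod length c)}) ` {..<length c}"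
    proof cases
      case 1 then show ?thesis unfolding l using assms by (intro image_eqI[of _ _ "length c - 1"]) auto
    next
      case 2
      then obtain i where "Suc i < length c" "e = {c ! i, c ! Suc i}" by (auto simp: pedges_nth)
      then show ?thesis by (intro image_eqI[of _ _ i]) auto
    qed
  next
    fix e assume "e \<in> (\<lambda>i. {c ! i, c ! (Suc i mod length c)}) ` {..<length c}"
    then obtain i where i: "i < length c" "e = {c ! i, c ! (Suc i mod length c)}" by auto
    show "e \<in> cedges c"
    proof (cases "Suc i < length c")
      case True then show ?thesis using i by (auto simp: cedges_def pedges_nth)
    next
      case False then have "i = length c - 1" using i by auto
      then show ?thesis using i l by (auto simp: cedges_def)
    qed
  qed
qed

text \<open>Two different indices with the same edge would each be the cyclic successor of the
  other, which happens only at length 2.\<close>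

lemma inj_on_cyc_edges:
  assumes "distinct c" "3 \<le> length c"
  shows "inj_on (\<lambda>i. {c ! i, c ! (Suc i mod length c)}) {..<length c}"
proof (rule inj_onI)
  fix i j assume ij: "i \<in> {..<length c}" "j \<in> {..<length c}"
    and e: "{c ! i, c ! (Suc i mod length c)} = {c ! j, c ! (Suc j mod length c)}"
  let ?k = "length c"
  have m: "Suc i mod ?k < ?k" "Suc j mod ?k < ?k" using assms by (auto intro!: mod_less_divisor)
  have nq: "\<And>a b. a < ?k \<Longrightarrow> b < ?k \<Longrightarrow> (c ! a = c ! b) = (a = b)"
    using assms by (simp add: nth_eq_iff_index_eq)
  show "i = j"
  proof (rule ccontr)
    assume "i \<noteq> j"
    then have "i = Suc j mod ?k" "j = Suc i mod ?k"
      using e ij m by (auto simp: doubleton_eq_iff nq)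
    moreover have "(Suc i = ?k \<and> Suc i mod ?k = 0) \<or> (Suc i \<noteq> ?k \<and> Suc i mod ?k = Suc i)"
      "(Suc j = ?k \<and> Suc j mod ?k = 0) \<or> (Suc j \<noteq> ?k \<and> Suc j mod ?k = Suc j)"
      using ij by (cases "Suc i = ?k"; cases "Suc j = ?k"; simp)+
    ultimately show False using assms(2) by linarith
  qed
qed

lemma card_cedges:
  assumes "distinct c" "3 \<le> length c" shows "card (cedges c) = length c"
  using card_image[OF inj_on_cyc_edges[OF assms]] cedges_nth[of c] assms by (cases c) auto

lemma cedges_at_hd:
  assumes "distinct (v # p)" "2 \<le> length p"
  shows "{e \<in> cedges (v # p). v \<in> e} = {{v, hd p}, {v, last p}}" "hd p \<noteq> last p"
proof -
  have "p \<noteq> []" using assms by auto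
  moreover have "\<And>e. e \<in> pedges p \<Longrightarrow> v \<notin> e" using pedges_vertices[of p] assms by auto
  ultimately show "{e \<in> cedges (v # p). v \<in> e} = {{v, hd p}, {v, last p}}"
    by (auto simp: cedges_Cons insert_commute)
  show "hd p \<noteq> last p" using assms by (cases p) auto
qed

lemma card_cedges_at:
  assumes "distinct c" "3 \<le> length c" "v \<in> set c"
  shows "card {e \<in> cedges c. v \<in> e} = 2"
proof -
  obtain n p where np: "rotate n c = v # p" using rotate_to_front assms by metis
  have d: "distinct (v # p)" "2 \<le> length p"
    using assms np by (metis distinct_rotate, metis length_rotate length_Cons Suc_le_mono numeral_3_eq_3 numeral_2_eq_2)
  have "{e \<in> cedges c. v \<in> e} = {{v, hd p}, {v, last p}}"
    using cedges_at_hd[OF d] np by (metis cedges_rotate)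
  moreover have "{v, hd p} \<noteq> {v, last p}" using cedges_at_hd(2)[OF d]
    by (auto simp: doubleton_eq_iff)
  ultimately show ?thesis by simp
qed

lemma card_edges_at:
  assumes "two_sets E" shows "card {e \<in> E. v \<in> e} = card (nbrs E v)"
proof -
  have "{e \<in> E. v \<in> e} = (\<lambda>u. {v, u}) ` nbrs E v"
  proof
    show "{e \<in> E. v \<in> e} \<subseteq> (\<lambda>u. {v, u}) ` nbrs E v"
    proof
      fix e assume e: "e \<in> {e \<in> E. v \<in> e}"
      then obtain a b where "e = {a, b}" using two_setsE[OF assms] by blast
      then show "e \<in> (\<lambda>u. {v, u}) ` nbrs E v" using e by (auto simp: nbrs_def insert_commute)
    qed
  qed (auto simp: nbrs_def)
  moreover have "inj_on (\<lambda>u. {v, u}) (nbrs E v)" by (auto simp: inj_on_def doubleton_eq_iff)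
  ultimately show ?thesis by (simp add: card_image)
qed

section \<open>Connectivity inside a vertex set\<close>

definition conn :: "'a set set \<Rightarrow> 'a set \<Rightarrow> 'a \<Rightarrow> 'a \<Rightarrow> bool" where
  "conn E F a b \<longleftrightarrow> (a, b) \<in> {(x, y). x \<in> F \<and> y \<in> F \<and> {x, y} \<in> E}\<^sup>*"

lemma conn_refl [simp]: "conn E F a a"
  by (simp add: conn_def)

lemma conn_trans: "conn E F a b \<Longrightarrow> conn E F b c \<Longrightarrow> conn E F a c"
  unfolding conn_def by (rule rtrancl_trans)

lemma conn_sym: "conn E F a b \<Longrightarrow> conn E F b a"
proof -
  have "sym {(x, y). x \<in> F \<and> y \<in> F \<and> {x, y} \<in> E}" by (auto simp: sym_def insert_commute)
  then show "conn E F a b \<Longrightarrow> conn E F b a" unfolding conn_def by (meson sym_rtrancl symD)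
qed

lemma conn_edge: "x \<in> F \<Longrightarrow> y \<in> F \<Longrightarrow> {x, y} \<in> E \<Longrightarrow> conn E F x y"
  unfolding conn_def by auto

lemma conn_path_list: "p \<noteq> [] \<Longrightarrow> set p \<subseteq> F \<Longrightarrow> pedges p \<subseteq> E \<Longrightarrow> conn E F (hd p) (last p)"
proof (induction p rule: pedges.induct)
  case (1 x y xs)
  then show ?case using conn_edge[of x F y E] conn_trans[of E F x y] by auto
qed auto

lemma conn_obtain_path:
  assumes "conn E F a b" "a \<in> F"
  obtains p where "p \<noteq> []" "distinct p" "hd p = a" "last p = b" "set p \<subseteq> F" "pedges p \<subseteq> E"
proof -
  have "\<exists>p. p \<noteq> [] \<and> distinct p \<and> hd p = a \<and> last p = b \<and> set p \<subseteq> F \<and> pedges p \<subseteq> E"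
    using assms(1) unfolding conn_def
  proof (induction rule: rtrancl_induct)
    case base then show ?case using assms(2) by (intro exI[of _ "[a]"]) auto
  next
    case (step y z)
    then obtain p where p: "p \<noteq> []" "distinct p" "hd p = a" "last p = y" "set p \<subseteq> F" "pedges p \<subseteq> E" by auto
    show ?case
    proof (cases "z \<in> set p")
      case True
      then obtain xs ys where xy: "p = xs @ z # ys" by (meson split_list)
      then have "pedges (xs @ [z]) \<subseteq> E" using p pedges_append[of xs z ys] by auto
      then show ?thesis using p xy by (intro exI[of _ "xs @ [z]"]) (cases xs; auto)
    next
      case False
      then show ?thesis using p step by (intro exI[of _ "p @ [z]"]) (auto simp: pedges_snoc)
    qed
  qed
  then show ?thesis using that by blast
qed

text \<open>Connectivity is stated through cuts because its negation then hands over a separation,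
  which is what the gluing of partitions consumes.\<close>

definition connected_on :: "'a set set \<Rightarrow> 'a set \<Rightarrow> bool" where
  "connected_on E S \<longleftrightarrow> (\<forall>A \<subseteq> S. A \<noteq> {} \<longrightarrow> A \<noteq> S \<longrightarrow> (\<exists>a\<in>A. \<exists>b\<in>S - A. {a, b} \<in> E))"

section \<open>Extending partial partitions\<close>

definition acyclic_on :: "'a set set \<Rightarrow> 'a set \<Rightarrow> bool" where
  "acyclic_on E F \<longleftrightarrow> (\<nexists>c. cyc E c \<and> set c \<subseteq> F)"

text \<open>A partition of \<open>B\<close> is given by its forest part \<open>F\<close>; the independent part is \<open>B - F\<close>.\<close>

definition IF_part :: "'a set set \<Rightarrow> 'a set \<Rightarrow> 'a set \<Rightarrow> bool" where
  "IF_part E B F \<longleftrightarrow> F \<subseteq> B \<and> (\<forall>x\<in>B - F. \<forall>y\<in>B - F. {x, y} \<notin> E) \<and> acyclic_on E F"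

text \<open>The last condition says that new forest vertices never join two old components.
  Extensions therefore compose, and a closing step can rely on two forest vertices that were apart
  at the start being still apart.\<close>

definition extends :: "'a set set \<Rightarrow> 'a set \<Rightarrow> 'a set \<Rightarrow> 'a set \<Rightarrow> 'a set \<Rightarrow> bool" where
  "extends E B F B' F' \<longleftrightarrow> IF_part E B' F' \<and> B \<subseteq> B' \<and> F' \<inter> B = F \<and>
     (\<forall>a\<in>F. \<forall>b\<in>F. conn E F' a b \<longrightarrow> conn E F a b)"

lemma extends_refl: "IF_part E B F \<Longrightarrow> extends E B F B F"
  by (auto simp: extends_def IF_part_def)

lemma extends_trans: "extends E B F B' F' \<Longrightarrow> extends E B' F' B'' F'' \<Longrightarrow> extends E B F B'' F''"
  unfolding extends_def by blast

text \<open>A cycle through \<open>v\<close> consists of \<open>v\<close> and a path inside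
  \<open>F\<close> between two different neighbours of \<open>v\<close>, which \<open>sep\<close>
  forbids.\<close>

lemma acyclic_insert:
  assumes "acyclic_on E F" "v \<notin> F"
    and sep: "\<And>a b. a \<in> nbrs E v \<inter> F \<Longrightarrow> b \<in> nbrs E v \<inter> F \<Longrightarrow> a \<noteq> b \<Longrightarrow> \<not> conn E F a b"
  shows "acyclic_on E (insert v F)"
  unfolding acyclic_on_def
proof safe
  fix c assume c: "cyc E c" "set c \<subseteq> insert v F"
  show False
  proof (cases "v \<in> set c")
    case False
    then show False using c assms(1) by (auto simp: acyclic_on_def)
  next
    case True
    then obtain n p where np: "rotate n c = v # p" by (rule rotate_to_front)
    then have cp: "cyc E (v # p)" using c(1) cyc_rotate[of E n c] by simp
    have sp: "set p \<subseteq> F"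
      using np c(2) cp by (metis cyc_def distinct.simps(2) insert_subset list.simps(15) set_rotate subset_insert)
    have d: "distinct (v # p)" "2 \<le> length p" using cp by (auto simp: cyc_def)
    then have pn: "p \<noteq> []" by auto
    have E: "{last p, v} \<in> E" "{v, hd p} \<in> E" "pedges p \<subseteq> E"
      using cp pn by (auto simp: cyc_def cedges_Cons)
    have "conn E F (hd p) (last p)" using conn_path_list[OF pn sp E(3)] .
    moreover have "hd p \<noteq> last p" using cedges_at_hd(2)[OF d] .
    moreover have "hd p \<in> F" "last p \<in> F" using sp pn by auto
    ultimately show False using sep[of "hd p" "last p"] E by (auto simp: nbrs_def insert_commute)
  qed
qed

lemma conn_insert:
  assumes "conn E (insert v F) a b" "a \<in> F" "b \<in> F" "v \<notin> F"
  shows "conn E F a b \<or> (\<exists>n\<in>nbrs E v \<inter> F. \<exists>m\<in>nbrs E v \<inter> F. conn E F a n \<and> conn E F m b)"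
proof -
  \<comment> \<open>The induction follows a walk that may stop at \<open>v\<close>; for this end
    point it only records a neighbour of \<open>v\<close> that is reachable inside
    \<open>F\<close>.\<close>
  have "(b \<in> F \<longrightarrow> conn E F a b \<or> (\<exists>n\<in>nbrs E v \<inter> F. \<exists>m\<in>nbrs E v \<inter> F. conn E F a n \<and> conn E F m b)) \<and>
        (b = v \<longrightarrow> (\<exists>n\<in>nbrs E v \<inter> F. conn E F a n))"
    using assms(1) unfolding conn_def[of E "insert v F"]
  proof (induction rule: rtrancl_induct)
    case base then show ?case using assms by auto
  next
    case (step y z)
    then have e: "{y, z} \<in> E" "y \<in> insert v F" "z \<in> insert v F" by auto
    show ?case
    proof (cases "y = v")
      case y: True
      show ?thesis
      proof (cases "z = v")
        case True then show ?thesis using step.IH y assms(4) by auto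
      next
        case False
        then have "z \<in> nbrs E v \<inter> F" using e y by (auto simp: nbrs_def)
        moreover obtain n where "n \<in> nbrs E v \<inter> F" "conn E F a n" using step.IH y by auto
        ultimately have "\<exists>n\<in>nbrs E v \<inter> F. \<exists>m\<in>nbrs E v \<inter> F. conn E F a n \<and> conn E F m z"
          by (intro bexI[of _ n] bexI[of _ z]) auto
        then show ?thesis using False by simp
      qed
    next
      case False
      then have yF: "y \<in> F" using e by auto
      show ?thesis
      proof (cases "z = v")
        case True
        then have "y \<in> nbrs E v \<inter> F" using e yF by (auto simp: nbrs_def insert_commute)
        then show ?thesis using step.IH yF True assms(4) by auto
      next
        case z: False
        then have yz: "conn E F y z" using e yF by (intro conn_edge) auto
        from step.IH yF consider "conn E F a y"
          | n m where "n \<in> nbrs E v \<inter> F" "m \<in> nbrs E v \<inter> F" "conn E F a n" "conn E F m y" by auto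
        then show ?thesis
        proof cases
          case 1 then show ?thesis using conn_trans[OF _ yz] z by simp
        next
          case 2
          then have "conn E F m z" using conn_trans[OF _ yz] by simp
          then have "\<exists>n\<in>nbrs E v \<inter> F. \<exists>m\<in>nbrs E v \<inter> F. conn E F a n \<and> conn E F m z"
            using 2 by (intro bexI[of _ n] bexI[of _ m]) auto
          then show ?thesis using z by simp
        qed
      qed
    qed
  qed
  then show ?thesis using assms(3) by blast
qed

lemma extend_I:
  assumes "two_sets E" "IF_part E B F" "v \<notin> B" "nbrs E v \<inter> B \<subseteq> F"
  shows "extends E B F (insert v B) F"
proof -
  have "{v, v} \<notin> E" using two_sets_irrefl[OF assms(1)] by blast
  moreover have "\<And>x. x \<in> B - F \<Longrightarrow> {v, x} \<notin> E \<and> {x, v} \<notin> E"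
    using assms(4) by (auto simp: nbrs_def insert_commute)
  ultimately show ?thesis using assms unfolding extends_def IF_part_def by blast
qed

lemma IF_part_insert_F:
  assumes "IF_part E B F" "v \<notin> B"
    and "\<And>a b. a \<in> nbrs E v \<inter> F \<Longrightarrow> b \<in> nbrs E v \<inter> F \<Longrightarrow> a \<noteq> b \<Longrightarrow> \<not> conn E F a b"
  shows "IF_part E (insert v B) (insert v F)"
proof -
  have "v \<notin> F" using assms by (auto simp: IF_part_def)
  then have "acyclic_on E (insert v F)" using acyclic_insert assms by (metis IF_part_def)
  then show ?thesis using assms by (auto simp: IF_part_def)
qed

text \<open>With at most one forest neighbour, \<open>v\<close> becomes a leaf or an isolated vertex
  of the forest, so it neither closes a cycle nor joins components.\<close>

lemma extend_F:
  assumes "IF_part E B F" "v \<notin> B" "finite (nbrs E v)" "card (nbrs E v \<inter> F) \<le> 1"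
  shows "extends E B F (insert v B) (insert v F)"
proof -
  have eq: "a = b" if "a \<in> nbrs E v \<inter> F" "b \<in> nbrs E v \<inter> F" for a b
    using that assms(3,4) card_le_Suc0_iff_eq[of "nbrs E v \<inter> F"] by auto
  have vF: "v \<notin> F" "F \<subseteq> B" using assms by (auto simp: IF_part_def)
  have "IF_part E (insert v B) (insert v F)" using IF_part_insert_F[OF assms(1,2)] eq by blast
  moreover have "conn E F a b" if "a \<in> F" "b \<in> F" "conn E (insert v F) a b" for a b
    using conn_insert[OF that(3,1,2) vF(1)] eq conn_trans by metis
  ultimately show ?thesis using vF assms(2) by (auto simp: extends_def)
qed

text \<open>If some coloured neighbour is independent, at most one other is left in the forest and
  \<open>v\<close> can join it; otherwise \<open>v\<close> can be made independent.\<close>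

lemma greedy_step:
  assumes "two_sets E" "IF_part E B F" "v \<notin> B" "finite (nbrs E v)" "card (nbrs E v \<inter> B) \<le> 2"
  shows "\<exists>F'. extends E B F (insert v B) F'"
proof (cases "nbrs E v \<inter> B \<subseteq> F")
  case True
  then show ?thesis using extend_I[OF assms(1-3)] by blast
next
  case False
  then obtain x where x: "x \<in> nbrs E v \<inter> B" "x \<notin> F" by blast
  have "F \<subseteq> B" using assms by (auto simp: IF_part_def)
  then have "nbrs E v \<inter> F \<subset> nbrs E v \<inter> B" using x by auto
  then have "card (nbrs E v \<inter> F) < card (nbrs E v \<inter> B)" using assms(4) by (intro psubset_card_mono) auto
  then have "card (nbrs E v \<inter> F) \<le> 1" using assms(5) by linarith
  then show ?thesis using extend_F[OF assms(2-4)] by blast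
qed

text \<open>When a vertex of the list is coloured, its successor is still uncoloured, so at most two
  of its neighbours are coloured; \<open>e\<close> plays this role for the last one. The list may
  repeat vertices, and a vertex is then coloured at its last occurrence. Two overlapping cycles can
  thus be traversed as one walk.\<close>

lemma greedy_walk:
  assumes "two_sets E" "\<And>v. finite (nbrs E v)"
  shows "IF_part E B F \<Longrightarrow> pedges (us @ [e]) \<subseteq> E \<Longrightarrow> set us \<inter> B = {} \<Longrightarrow> e \<notin> set us \<Longrightarrow> e \<notin> B \<Longrightarrow>
    (\<And>u. u \<in> set us \<Longrightarrow> card (nbrs E u) \<le> 3) \<Longrightarrow> \<exists>F'. extends E B F (B \<union> set us) F'"
proof (induction us arbitrary: B F)
  case Nil
  then show ?case using extends_refl by fastforce
next
  case (Cons u us)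
  have sub: "pedges (us @ [e]) \<subseteq> E" using Cons.prems(2) by (cases us) auto
  show ?case
  proof (cases "u \<in> set us")
    case True
    then have "set (u # us) = set us" by auto
    moreover have "\<exists>F'. extends E B F (B \<union> set us) F'"
      by (rule Cons.IH) (use Cons.prems sub in auto)
    ultimately show ?thesis by simp
  next
    case False
    let ?h = "hd (us @ [e])"
    have "?h \<in> nbrs E u" using Cons.prems(2) by (cases us) (auto simp: nbrs_def)
    moreover have "?h \<notin> B" using Cons.prems by (cases us) auto
    ultimately have "nbrs E u \<inter> B \<subset> nbrs E u" by auto
    then have "card (nbrs E u \<inter> B) < card (nbrs E u)" using assms(2) by (intro psubset_card_mono) auto
    then have "card (nbrs E u \<inter> B) \<le> 2" using Cons.prems(6)[of u] by simp
    moreover have "u \<notin> B" using Cons.prems by auto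
    ultimately obtain F1 where F1: "extends E B F (insert u B) F1"
      using greedy_step[OF assms(1) Cons.prems(1) _ assms(2)] by blast
    have "\<exists>F'. extends E (insert u B) F1 (insert u B \<union> set us) F'"
    proof (rule Cons.IH)
      show "IF_part E (insert u B) F1" using F1 by (auto simp: extends_def)
    qed (use Cons.prems sub False in auto)
    then show ?thesis using F1 extends_trans by fastforce
  qed
qed

lemma not_conn_isolated:
  assumes "conn E (insert c F) s c" "nbrs E c \<inter> F = {}" "{c, c} \<notin> E"
  shows "s = c"
proof (rule ccontr)
  assume "s \<noteq> c"
  with assms(1) obtain y where "{y, c} \<in> E" "y \<in> insert c F"
    unfolding conn_def by (auto elim: rtranclE)
  then show False using assms(2,3) by (auto simp: nbrs_def insert_commute)
qed

text \<open>The vertex \<open>c\<close> is coloured first, so that it suits the colour of the neighbour \<open>s\<close> of the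
  last vertex \<open>e\<close>: either both are independent, or both belong to the forest, but to different
  components, since the greedy steps never merge components.\<close>

lemma walk_extension:
  assumes E: "two_sets E" "\<And>v. finite (nbrs E v)"
    and "IF_part E B F" "c \<notin> B" "nbrs E c \<inter> B = {}"
    and us: "pedges (us @ [e]) \<subseteq> E" "set us \<inter> B = {}" "c \<notin> set us" "e \<notin> set us" "e \<notin> B" "c \<noteq> e"
    and deg: "\<And>u. u \<in> set us \<Longrightarrow> card (nbrs E u) \<le> 3" "card (nbrs E e) \<le> 3"
    and "{c, e} \<in> E" "s \<in> nbrs E e" "s \<in> B"
  shows "\<exists>F'. extends E B F (insert e (insert c B \<union> set us)) F'"
proof -
  have FB: "F \<subseteq> B" using assms(3) by (auto simp: IF_part_def)
  have cn: "c \<in> nbrs E e" using assms by (auto simp: nbrs_def insert_commute)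
  have sc: "s \<noteq> c" using assms by auto
  have irr: "{c, c} \<notin> E" using two_sets_irrefl[OF E(1)] by blast
  define B2 where "B2 = insert c B \<union> set us"
  have eB2: "e \<notin> B2" using us unfolding B2_def by auto
  show ?thesis
  proof (cases "s \<in> F")
    case False
    have F1: "extends E B F (insert c B) F" using extend_I[OF E(1) assms(3,4)] assms(5) by auto
    have "\<exists>F'. extends E (insert c B) F B2 F'" unfolding B2_def
      by (rule greedy_walk[OF E _ us(1)]) (use F1 us deg in \<open>auto simp: extends_def\<close>)
    then obtain F2 where F2: "extends E (insert c B) F B2 F2" by blast
    have "s \<notin> F2" "c \<notin> F2" using F2 False assms FB by (auto simp: extends_def)
    then have "nbrs E e \<inter> F2 \<subseteq> nbrs E e - {s, c}" by auto
    then have "card (nbrs E e \<inter> F2) \<le> card (nbrs E e - {s, c})" using E(2) by (intro card_mono) auto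
    also have "\<dots> = card (nbrs E e) - 2" using sc cn assms(15) E(2) by (subst card_Diff_subset) auto
    also have "\<dots> \<le> 1" using deg by simp
    finally have "extends E B2 F2 (insert e B2) (insert e F2)"
      using extend_F[of E B2 F2 e] F2 eB2 E(2) by (auto simp: extends_def)
    then show ?thesis using F1 F2 extends_trans B2_def by metis
  next
    case sF: True
    have "card (nbrs E c \<inter> F) \<le> 1" using assms(5) FB by (metis Int_empty_right card.empty inf.absorb_iff2 inf_assoc inf_commute le0)
    then have F1: "extends E B F (insert c B) (insert c F)" using extend_F[OF assms(3,4) E(2)] by auto
    have "\<exists>F'. extends E (insert c B) (insert c F) B2 F'" unfolding B2_def
      by (rule greedy_walk[OF E _ us(1)]) (use F1 us deg in \<open>auto simp: extends_def\<close>)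
    then obtain F2 where F2: "extends E (insert c B) (insert c F) B2 F2" by blast
    have ok2: "IF_part E B2 F2" using F2 by (auto simp: extends_def)
    have sF2: "s \<in> F2" "c \<in> F2" "F \<subseteq> F2" using F2 sF by (auto simp: extends_def)
    have iso: "\<not> conn E F2 a c" if "a \<in> F" for a
    proof
      assume "conn E F2 a c"
      then have "conn E (insert c F) a c" using F2 that by (auto simp: extends_def)
      then have "a = c" using not_conn_isolated irr assms(5) FB by (metis Int_empty_right inf.absorb_iff2 inf_assoc inf_commute)
      then show False using that FB assms(4) by auto
    qed
    show ?thesis
    proof (cases "nbrs E e \<inter> B2 \<subseteq> F2")
      case True
      then have "extends E B2 F2 (insert e B2) F2" using extend_I[OF E(1) ok2 eB2] by auto
      then show ?thesis using F1 F2 extends_trans B2_def by metis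
    next
      \<comment> \<open>The third neighbour \<open>t\<close> of \<open>e\<close> is independent, so
        \<open>e\<close> must join the forest, where it links the components of \<open>s\<close> and
        \<open>c\<close>.\<close>
      case False
      then obtain t where t: "t \<in> nbrs E e" "t \<notin> F2" by auto
      have "t \<noteq> s" "t \<noteq> c" using t sF2 by auto
      then have three: "card {s, c, t} = 3" using sc by auto
      have "{s, c, t} = nbrs E e"
        by (rule card_seteq[OF E(2)]) (use t cn assms deg three in auto)
      then have N: "nbrs E e \<inter> F2 = {s, c}" using t sF2 by auto
      have "IF_part E (insert e B2) (insert e F2)"
      proof (rule IF_part_insert_F[OF ok2 eB2])
        have "\<not> conn E F2 s c" "\<not> conn E F2 c s" using iso[OF sF] conn_sym[of E F2 c s] by auto
        then show "\<not> conn E F2 a b" if "a \<in> nbrs E e \<inter> F2" "b \<in> nbrs E e \<inter> F2" "a \<noteq> b" for a b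
          using that N by auto
      qed
      \<comment> \<open>The vertex \<open>e\<close> does merge two components of \<open>F2\<close>,
        but that of \<open>c\<close> contains no vertex of \<open>F\<close>, so no two components of
        the original \<open>F\<close> are joined.\<close>
      moreover have "conn E F a b" if ab: "a \<in> F" "b \<in> F" "conn E (insert e F2) a b" for a b
      proof -
        have "e \<notin> F2" using ok2 eB2 by (auto simp: IF_part_def)
        then have "conn E F2 a b \<or> (\<exists>n\<in>{s, c}. \<exists>m\<in>{s, c}. conn E F2 a n \<and> conn E F2 m b)"
          using conn_insert[OF ab(3)] ab sF2 N by auto
        moreover have "\<not> conn E F2 a c" "\<not> conn E F2 c b"
          using iso[OF ab(1)] iso[OF ab(2)] conn_sym[of E F2 c b] by auto
        ultimately have "conn E F2 a b" using conn_trans[of E F2 a s b] by auto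
        then have "conn E (insert c F) a b" using F2 ab by (auto simp: extends_def)
        then show ?thesis using F1 ab by (auto simp: extends_def)
      qed
      moreover have "insert e F2 \<inter> B = F" using F1 F2 us(5) by (auto simp: extends_def)
      ultimately show ?thesis unfolding extends_def B2_def[symmetric] by (auto simp: B2_def)
    qed
  qed
qed

text \<open>Going round from a vertex with all neighbours on the cycle, one meets consecutive
  vertices \<open>d\<close>, \<open>e\<close> such that \<open>d\<close> is still of this kind and
  \<open>e\<close> has a coloured neighbour. Colouring starts at \<open>d\<close>, runs around the
  cycle away from \<open>e\<close>, and closes up at \<open>e\<close>.\<close>

lemma cycle_extension:
  assumes E: "two_sets E" "\<And>v. finite (nbrs E v)"
    and "IF_part E B F" and c: "cyc E c" "set c \<inter> B = {}"
    and N: "\<And>v. v \<in> set c \<Longrightarrow> nbrs E v \<subseteq> B \<union> set c \<and> card (nbrs E v) \<le> 3"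
    and full: "v \<in> set c" "nbrs E v \<subseteq> set c"
    and nonfull: "w \<in> set c" "\<not> nbrs E w \<subseteq> set c"
  shows "\<exists>F'. extends E B F (B \<union> set c) F'"
proof -
  let ?full = "\<lambda>v. nbrs E v \<subseteq> set c"
  obtain n p where np: "rotate n c = v # p" using rotate_to_front full(1) by metis
  have sc: "set c = set (v # p)" using np by (metis set_rotate)
  then have "\<exists>x\<in>set p. \<not> ?full x" using full nonfull by auto
  then obtain xs e ys where p: "p = xs @ e # ys" "\<not> ?full e" "\<forall>x\<in>set xs. ?full x"
    using split_list_first_prop[of p "\<lambda>x. \<not> ?full x"] by metis
  obtain zs d where zd: "v # xs = zs @ [d]" by (metis list.distinct(1) rev_exhaust)
  have dfull: "?full d" using zd full p(3) by (metis in_set_conv_decomp set_ConsD)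
  define m where "m = ys @ zs"
  have "rotate (Suc (length xs)) (v # p) = e # m @ [d]"
  proof -
    have "rotate (length (v # xs)) ((v # xs) @ e # ys) = (e # ys) @ zs @ [d]"
      unfolding rotate_append zd[symmetric] by simp
    then show ?thesis unfolding p(1) m_def by (simp del: rotate_Suc)
  qed
  then have cy: "cyc E (e # m @ [d])" and sc2: "set c = set (e # m @ [d])"
    using c(1) sc cyc_rotate np by (metis, metis set_rotate)
  have mn: "m \<noteq> []" using cy by (auto simp: cyc_def)
  have ed: "pedges (rev m @ [e]) \<subseteq> E" "{d, e} \<in> E"
  proof -
    have "pedges (rev m @ [e]) = pedges (e # m)" using pedges_rev[of "e # m"] by simp
    also have "\<dots> \<subseteq> pedges (e # m @ [d])" using pedges_mono_append1[of "e # m" "[d]"] by simp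
    finally show "pedges (rev m @ [e]) \<subseteq> E" using cy by (auto simp: cyc_def cedges_def)
    show "{d, e} \<in> E" using cy by (auto simp: cyc_def cedges_def)
  qed
  obtain s where s: "s \<in> nbrs E e" "s \<in> B" using p(2) N[of e] sc2 by auto
  have "\<exists>F'. extends E B F (insert e (insert d B \<union> set (rev m))) F'"
  proof (rule walk_extension[OF E assms(3) _ _ ed(1) _ _ _ _ _ _ _ ed(2) s])
    show "nbrs E d \<inter> B = {}" using dfull c(2) by auto
  qed (use cy c(2) sc2 N in \<open>auto simp: cyc_def\<close>)
  moreover have "insert e (insert d B \<union> set (rev m)) = B \<union> set c" using sc2 by auto
  ultimately show ?thesis by simp
qed

text \<open>A cycle that uses the restored edge leaves, without it, a path from \<open>a\<close> to
  \<open>b\<close> in the smaller graph. This serves the reductions that delete an edge to lower the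
  degree of a 4-vertex.\<close>

lemma acyclic_add_edge:
  assumes ac: "acyclic_on (E - {{a, b}}) F" and "a \<noteq> b"
    and sep: "a \<in> F \<Longrightarrow> b \<in> F \<Longrightarrow> \<not> conn (E - {{a, b}}) F a b"
  shows "acyclic_on E F"
  unfolding acyclic_on_def
proof safe
  fix c assume c: "cyc E c" "set c \<subseteq> F"
  show False
  proof (cases "{a, b} \<in> cedges c")
    case False
    then have "cyc (E - {{a, b}}) c" using c(1) by (auto simp: cyc_def)
    then show False using ac c by (auto simp: acyclic_on_def)
  next
    case True
    moreover have "c \<noteq> []" using c(1) by (auto simp: cyc_def)
    ultimately have "a \<in> set c" using cedges_Union[of c] by blast
    then obtain n p where np: "rotate n c = a # p" by (rule rotate_to_front)
    then have cp: "cyc E (a # p)" and sp: "set (a # p) \<subseteq> F" and ab: "{a, b} \<in> cedges (a # p)"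
      using c cyc_rotate[of E n c] \<open>{a, b} \<in> cedges c\<close> by (metis, metis set_rotate, metis cedges_rotate)
    have d: "distinct (a # p)" "2 \<le> length p" using cp by (auto simp: cyc_def)
    have "{a, b} \<in> {e \<in> cedges (a # p). a \<in> e}" using ab by simp
    then have "{a, b} \<in> {{a, hd p}, {a, last p}}" unfolding cedges_at_hd(1)[OF d] .
    then have "b = hd p \<or> b = last p" by (auto simp: doubleton_eq_iff)
    then obtain q where q: "cyc E (a # q)" "set (a # q) \<subseteq> F" "b = last q"
    proof
      assume "b = hd p"
      moreover have "cyc E (a # rev p)"
      proof -
        have "rotate (length p) (rev (a # p)) = a # rev p" using rotate_append[of "rev p" "[a]"] by simp
        then show ?thesis using cp cyc_rotate cyc_rev by metis
      qed
      moreover have "last (rev p) = hd p" using d(2) by (auto simp: last_rev)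
      ultimately show ?thesis using that[of "rev p"] sp by auto
    qed (use that[of p] cp sp in auto)
    have dq: "distinct (a # q)" "2 \<le> length q" and qn: "q \<noteq> []" using q(1) by (auto simp: cyc_def)
    have "{a, b} \<notin> pedges (a # q)"
      using pedges_vertices[of q] dq(1) qn cedges_at_hd(2)[OF dq] q(3) by (auto simp: pedges_Cons doubleton_eq_iff)
    then have "pedges (a # q) \<subseteq> E - {{a, b}}" using q(1) by (auto simp: cyc_def cedges_def)
    then have "conn (E - {{a, b}}) F a b"
      using conn_path_list[of "a # q" F "E - {{a, b}}"] q qn by auto
    then show False using sep q qn by (metis last_in_set list.set_intros subsetD)
  qed
qed

section \<open>Arcs in the plane\<close>

lemma inside_not_mem: "x \<in> inside S \<Longrightarrow> x \<notin> S"
  by (auto simp: inside_def)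

lemma arcs_form_closed_curve:
  fixes c1 c2 :: "real \<Rightarrow> complex"
  assumes "arc c1" "pathstart c1 = a" "pathfinish c1 = b" "arc c2" "pathstart c2 = a" "pathfinish c2 = b"
    and "path_image c1 \<inter> path_image c2 = {a, b}"
  obtains d where "simple_path d" "pathfinish d = pathstart d" "path_image d = path_image c1 \<union> path_image c2"
proof
  show "simple_path (c1 +++ reversepath c2)"
    by (rule simple_path_join_loop) (use assms arc_reversepath in auto)
qed (use assms in \<open>auto simp: path_image_join\<close>)

lemma Jordan_arcs:
  fixes c1 c2 :: "real \<Rightarrow> complex"
  assumes "arc c1" "pathstart c1 = a" "pathfinish c1 = b" "arc c2" "pathstart c2 = a" "pathfinish c2 = b"
    and "path_image c1 \<inter> path_image c2 = {a, b}"
    and "S = path_image c1 \<union> path_image c2"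
  shows "topological_space_class.connected (inside S)" "topological_space_class.connected (outside S)" "inside S \<noteq> {}" "\<not> bounded (outside S)"
    "frontier (inside S) = S" "frontier (outside S) = S" "compact S"
proof -
  obtain d where d: "simple_path d" "pathfinish d = pathstart d" "path_image d = S"
    using arcs_form_closed_curve[OF assms(1-7)] assms(8) by metis
  show "topological_space_class.connected (inside S)" "topological_space_class.connected (outside S)" "inside S \<noteq> {}" "\<not> bounded (outside S)"
    "frontier (inside S) = S" "frontier (outside S) = S"
    using Jordan_inside_outside[OF d(1,2)] d(3) by auto
  show "compact S" using d by (metis compact_simple_path_image)
qed

text \<open>Otherwise the inside of \<open>c1 \<union> c2\<close> lies outside the other two closed curves, and by
  Janiszewski's theorem it could be joined to infinity without meeting any of the three arcs.\<close>

lemma theta_curve_nested: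
  fixes c1 c2 c :: "real \<Rightarrow> complex"
  assumes c1: "arc c1" "pathstart c1 = a" "pathfinish c1 = b"
    and c2: "arc c2" "pathstart c2 = a" "pathfinish c2 = b"
    and c: "arc c" "pathstart c = a" "pathfinish c = b"
    and i12: "path_image c1 \<inter> path_image c2 = {a, b}"
    and i1: "path_image c1 \<inter> path_image c = {a, b}"
    and i2: "path_image c2 \<inter> path_image c = {a, b}"
    and out: "path_image c - {a, b} \<subseteq> outside (path_image c1 \<union> path_image c2)"
  shows "path_image c2 \<inter> inside (path_image c1 \<union> path_image c) \<noteq> {} \<or>
         path_image c1 \<inter> inside (path_image c2 \<union> path_image c) \<noteq> {}"
proof (rule ccontr)
  let ?c1 = "path_image c1" and ?c2 = "path_image c2" and ?c = "path_image c"
  note J12 = Jordan_arcs[OF c1 c2 i12 refl]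
  note J1 = Jordan_arcs[OF c1 c i1 refl]
  note J2 = Jordan_arcs[OF c2 c i2 refl]
  assume "\<not> ?thesis"
  then have no: "?c2 \<inter> inside (?c1 \<union> ?c) = {}" "?c1 \<inter> inside (?c2 \<union> ?c) = {}" by auto
  have avoid: "inside (?c1 \<union> ?c2) \<inter> ?c = {}"
  proof -
    have "?c \<subseteq> outside (?c1 \<union> ?c2) \<union> {a, b}" using out by auto
    moreover have "{a, b} \<subseteq> ?c1" using i12 by auto
    ultimately show ?thesis using inside_no_overlap[of "?c1 \<union> ?c2"] inside_Int_outside[of "?c1 \<union> ?c2"] by blast
  qed
  have step: "inside (?c1 \<union> ?c2) \<subseteq> outside (D \<union> ?c)"
    if d: "D = ?c1 \<and> D' = ?c2 \<or> D = ?c2 \<and> D' = ?c1" and ne: "D' \<inter> inside (D \<union> ?c) = {}"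
      "D' \<inter> (D \<union> ?c) = {a, b}" "\<not> D' \<subseteq> {a, b}" for D D' :: "complex set"
  proof -
    have disj: "inside (?c1 \<union> ?c2) \<inter> (D \<union> ?c) = {}"
      using avoid inside_no_overlap[of "?c1 \<union> ?c2"] d by blast
    have "inside (?c1 \<union> ?c2) \<inter> inside (D \<union> ?c) = {}"
    proof (rule ccontr)
      assume "inside (?c1 \<union> ?c2) \<inter> inside (D \<union> ?c) \<noteq> {}"
      then have "outside (D \<union> ?c) \<inter> inside (?c1 \<union> ?c2) = {}"
        using inside_outside_intersect_connected[OF J12(1), of "D \<union> ?c"] disj by blast
      then have "inside (?c1 \<union> ?c2) \<subseteq> inside (D \<union> ?c)"
        using disj union_with_outside[of "D \<union> ?c"] inside_outside[of "D \<union> ?c"] by blast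
      \<comment> \<open>Passing to closures, the remaining arc \<open>D'\<close> would lie in
        \<open>inside (D \<union> ?c)\<close> apart from its end points.\<close>
      then have "closure (inside (?c1 \<union> ?c2)) \<subseteq> closure (inside (D \<union> ?c))" by (rule closure_mono)
      moreover have "D' \<subseteq> closure (inside (?c1 \<union> ?c2))"
        using J12(5) d by (auto simp: closure_Un_frontier)
      moreover have "closure (inside (D \<union> ?c)) = inside (D \<union> ?c) \<union> (D \<union> ?c)"
        using J1(5) J2(5) d by (auto simp: closure_Un_frontier)
      ultimately show False using ne by blast
    qed
    then show ?thesis using disj inside_outside[of "D \<union> ?c"] by blast
  qed
  have n1: "\<not> ?c1 \<subseteq> {a, b}" and n2: "\<not> ?c2 \<subseteq> {a, b}"
    using nonempty_simple_path_endless[OF arc_imp_simple_path[OF c1(1)]]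
      nonempty_simple_path_endless[OF arc_imp_simple_path[OF c2(1)]] c1 c2 by auto
  have "?c2 \<inter> (?c1 \<union> ?c) = {a, b}" "?c1 \<inter> (?c2 \<union> ?c) = {a, b}"
    unfolding Int_Un_distrib i1 i2 i12 using i12 by auto
  then have o1: "inside (?c1 \<union> ?c2) \<subseteq> outside (?c1 \<union> ?c)"
    and o2: "inside (?c1 \<union> ?c2) \<subseteq> outside (?c2 \<union> ?c)"
    using step[of ?c1 ?c2, OF _ no(1) _ n2] step[of ?c2 ?c1, OF _ no(2) _ n1] by simp_all
  obtain p where p: "p \<in> inside (?c1 \<union> ?c2)" using J12(3) by auto
  have "bounded (?c1 \<union> ?c2 \<union> ?c)" using J1(7) J2(7) compact_imp_bounded by (auto intro: bounded_subset)
  \<comment> \<open>A bounded set does not cover the plane, so some \<open>q\<close> lies outside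
    all three closed curves.\<close>
  moreover have "- (inside (?c1 \<union> ?c2) \<union> inside (?c1 \<union> ?c) \<union> inside (?c2 \<union> ?c) \<union> (?c1 \<union> ?c2 \<union> ?c)) \<noteq> {}"
  proof -
    have "bounded (inside (?c1 \<union> ?c2) \<union> inside (?c1 \<union> ?c) \<union> inside (?c2 \<union> ?c) \<union> (?c1 \<union> ?c2 \<union> ?c))"
      using J1(7) J2(7) J12(7) calculation compact_imp_bounded bounded_inside by (metis bounded_Un)
    then show ?thesis using not_bounded_UNIV by (metis Compl_empty_eq double_complement)
  qed
  then obtain q where q: "q \<in> outside (?c1 \<union> ?c2)" "q \<in> outside (?c1 \<union> ?c)" "q \<in> outside (?c2 \<union> ?c)"
    unfolding outside_inside by blast
  \<comment> \<open>The two closed curves through \<open>?c\<close> meet exactly in the connected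
    set \<open>?c\<close>, so \<open>p\<close> and \<open>q\<close>, separated by neither, are not
    separated by their union. But \<open>p\<close> is inside and \<open>q\<close> outside
    \<open>?c1 \<union> ?c2\<close>.\<close>
  have "connected_component (- ((?c1 \<union> ?c) \<union> (?c2 \<union> ?c))) p q"
  proof (rule Janiszewski)
    have "(?c1 \<union> ?c) \<inter> (?c2 \<union> ?c) = ?c" using i12 i1 by auto
    then show "topological_space_class.connected ((?c1 \<union> ?c) \<inter> (?c2 \<union> ?c))" using c(1) by (simp add: connected_arc_image)
    show "connected_component (- (?c1 \<union> ?c)) p q"
      unfolding connected_component_def
      by (rule exI[of _ "outside (?c1 \<union> ?c)"]) (use J1 o1 p q outside_no_overlap[of "?c1 \<union> ?c"] in blast)
    show "connected_component (- (?c2 \<union> ?c)) p q"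
      unfolding connected_component_def
      by (rule exI[of _ "outside (?c2 \<union> ?c)"]) (use J2 o2 p q outside_no_overlap[of "?c2 \<union> ?c"] in blast)
    show "compact (?c1 \<union> ?c)" "closed (?c2 \<union> ?c)" using J1(7) compact_imp_closed[OF J2(7)] by auto
  qed
  then have "connected_component (- (?c1 \<union> ?c2)) p q"
    by (rule connected_component_of_subset) auto
  then obtain T where "topological_space_class.connected T" "T \<subseteq> - (?c1 \<union> ?c2)" "p \<in> T" "q \<in> T"
    unfolding connected_component_def by blast
  then show False using inside_outside_intersect_connected[of T "?c1 \<union> ?c2"] p q by blast
qed

text \<open>If \<open>c\<close> runs inside the closed curve, this is the known splitting of the
  inside. If it runs outside, one of the two arcs runs inside the closed curve formed by
  \<open>c\<close> and the other arc; splitting that inside instead and taking complements gives the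
  two parts of the outer region.\<close>

lemma theta_curve_split:
  fixes c1 c2 c :: "real \<Rightarrow> complex"
  assumes c1: "arc c1" "pathstart c1 = a" "pathfinish c1 = b"
    and c2: "arc c2" "pathstart c2 = a" "pathfinish c2 = b"
    and c: "arc c" "pathstart c = a" "pathfinish c = b"
    and i12: "path_image c1 \<inter> path_image c2 = {a, b}"
    and i1: "path_image c1 \<inter> path_image c = {a, b}"
    and i2: "path_image c2 \<inter> path_image c = {a, b}"
    and R: "R = inside (path_image c1 \<union> path_image c2) \<or> R = outside (path_image c1 \<union> path_image c2)"
    and cR: "path_image c - {a, b} \<subseteq> R"
  obtains R1 R2 where
    "R1 = inside (path_image c1 \<union> path_image c) \<or> R1 = outside (path_image c1 \<union> path_image c)"
    "R2 = inside (path_image c2 \<union> path_image c) \<or> R2 = outside (path_image c2 \<union> path_image c)"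
    "R1 \<inter> R2 = {}" "R1 \<union> R2 \<union> (path_image c - {a, b}) = R"
proof -
  note sp = c1(1)[THEN arc_imp_simple_path] c2(1)[THEN arc_imp_simple_path] c(1)[THEN arc_imp_simple_path]
  have ab: "a \<noteq> b" using arc_distinct_ends[OF c1(1)] c1 by auto
  let ?c1 = "path_image c1" and ?c2 = "path_image c2" and ?c = "path_image c"
  have abc: "{a, b} \<subseteq> ?c1" "{a, b} \<subseteq> ?c2" "{a, b} \<subseteq> ?c" using i12 i1 by auto
  from R show ?thesis
  proof
    assume R: "R = inside (?c1 \<union> ?c2)"
    have "?c - {a, b} \<noteq> {}" using nonempty_simple_path_endless[OF sp(3)] c by auto
    then have ne: "?c \<inter> inside (?c1 \<union> ?c2) \<noteq> {}" using cR R by blast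
    show ?thesis
      by (rule split_inside_simple_closed_curve[OF sp(1) c1(2,3) sp(2) c2(2,3) sp(3) c(2,3) ab i12 i1 i2 ne])
         (use that R in blast)
  next
    assume R: "R = outside (?c1 \<union> ?c2)"
    from theta_curve_nested[OF assms(1-12)] cR R
    consider "?c2 \<inter> inside (?c1 \<union> ?c) \<noteq> {}" | "?c1 \<inter> inside (?c2 \<union> ?c) \<noteq> {}" by blast
    then show ?thesis
    proof cases
      case 1
      have i2': "?c \<inter> ?c2 = {a, b}" using i2 by auto
      from split_inside_simple_closed_curve[OF sp(1) c1(2,3) sp(3) c(2,3) sp(2) c2(2,3) ab i1 i12 i2' 1]
      have d: "inside (?c1 \<union> ?c2) \<inter> inside (?c \<union> ?c2) = {}"
        "inside (?c1 \<union> ?c2) \<union> inside (?c \<union> ?c2) \<union> (?c2 - {a, b}) = inside (?c1 \<union> ?c)" by metis+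
      have cc: "?c \<union> ?c2 = ?c2 \<union> ?c" by auto
      show ?thesis
      proof (rule that[of "outside (?c1 \<union> ?c)" "inside (?c2 \<union> ?c)"])
        show "outside (?c1 \<union> ?c) \<inter> inside (?c2 \<union> ?c) = {}"
          unfolding outside_inside d(2)[unfolded cc, symmetric] by auto
        show "outside (?c1 \<union> ?c) \<union> inside (?c2 \<union> ?c) \<union> (?c - {a, b}) = R"
        proof (rule set_eqI)
          fix x
          have "x \<in> inside (?c2 \<union> ?c) \<Longrightarrow> x \<notin> ?c2 \<union> ?c" "x \<in> inside (?c1 \<union> ?c) \<Longrightarrow> x \<notin> ?c1 \<union> ?c"
            using inside_not_mem[of x "?c2 \<union> ?c"] inside_not_mem[of x "?c1 \<union> ?c"] by auto
          moreover have "x \<in> ?c - {a, b} \<Longrightarrow> x \<in> R" using cR by (rule subsetD)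
          moreover have "x \<in> inside (?c1 \<union> ?c) \<longleftrightarrow> x \<in> inside (?c1 \<union> ?c2) \<or> x \<in> inside (?c2 \<union> ?c) \<or> x \<in> ?c2 \<and> x \<noteq> a \<and> x \<noteq> b"
            unfolding d(2)[unfolded cc, symmetric] by simp
          moreover have "\<not> (x \<in> inside (?c1 \<union> ?c2) \<and> x \<in> inside (?c2 \<union> ?c))"
            using d(1)[unfolded cc] by (simp add: disjoint_iff)
          moreover have "x = a \<or> x = b \<Longrightarrow> x \<in> ?c1 \<and> x \<in> ?c2 \<and> x \<in> ?c" using abc by auto
          ultimately show "x \<in> outside (?c1 \<union> ?c) \<union> inside (?c2 \<union> ?c) \<union> (?c - {a, b}) \<longleftrightarrow> x \<in> R"
            unfolding R outside_inside Un_iff Diff_iff Compl_iff insert_iff empty_iff by argo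
        qed
      qed auto
    next
      case 2
      have i1': "?c \<inter> ?c1 = {a, b}" and i12': "?c2 \<inter> ?c1 = {a, b}" using i1 i12 by auto
      from split_inside_simple_closed_curve[OF sp(2) c2(2,3) sp(3) c(2,3) sp(1) c1(2,3) ab i2 i12' i1' 2]
      have d: "inside (?c2 \<union> ?c1) \<inter> inside (?c \<union> ?c1) = {}"
        "inside (?c2 \<union> ?c1) \<union> inside (?c \<union> ?c1) \<union> (?c1 - {a, b}) = inside (?c2 \<union> ?c)" by metis+
      have cc: "?c \<union> ?c1 = ?c1 \<union> ?c" "?c2 \<union> ?c1 = ?c1 \<union> ?c2" by auto
      show ?thesis
      proof (rule that[of "inside (?c1 \<union> ?c)" "outside (?c2 \<union> ?c)"])
        show "inside (?c1 \<union> ?c) \<inter> outside (?c2 \<union> ?c) = {}"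
          unfolding outside_inside d(2)[unfolded cc, symmetric] by auto
        show "inside (?c1 \<union> ?c) \<union> outside (?c2 \<union> ?c) \<union> (?c - {a, b}) = R"
        proof (rule set_eqI)
          fix x
          have "x \<in> inside (?c2 \<union> ?c) \<Longrightarrow> x \<notin> ?c2 \<union> ?c" "x \<in> inside (?c1 \<union> ?c) \<Longrightarrow> x \<notin> ?c1 \<union> ?c"
            using inside_not_mem[of x "?c2 \<union> ?c"] inside_not_mem[of x "?c1 \<union> ?c"] by auto
          moreover have "x \<in> ?c - {a, b} \<Longrightarrow> x \<in> R" using cR by (rule subsetD)
          moreover have "x \<in> inside (?c2 \<union> ?c) \<longleftrightarrow> x \<in> inside (?c1 \<union> ?c2) \<or> x \<in> inside (?c1 \<union> ?c) \<or> x \<in> ?c1 \<and> x \<noteq> a \<and> x \<noteq> b"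
            unfolding d(2)[unfolded cc, symmetric] by simp
          moreover have "\<not> (x \<in> inside (?c1 \<union> ?c2) \<and> x \<in> inside (?c1 \<union> ?c))"
            using d(1)[unfolded cc] by (simp add: disjoint_iff)
          moreover have "x = a \<or> x = b \<Longrightarrow> x \<in> ?c1 \<and> x \<in> ?c2 \<and> x \<in> ?c" using abc by auto
          ultimately show "x \<in> inside (?c1 \<union> ?c) \<union> outside (?c2 \<union> ?c) \<union> (?c - {a, b}) \<longleftrightarrow> x \<in> R"
            unfolding R outside_inside Un_iff Diff_iff Compl_iff insert_iff empty_iff by argo
        qed
      qed auto
    qed
  qed
qed

section \<open>Face systems of plane graphs\<close>

lemma card_pedges: "distinct p \<Longrightarrow> card (pedges p) = length p - 1"
proof (induction p rule: pedges.induct)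
  case (1 x y xs)
  have "{x, y} \<notin> pedges (y # xs)" using pedges_vertices[of "y # xs"] 1(2) by auto
  then show ?case using 1 by simp
qed auto

text \<open>A common edge can only be \<open>{a, b}\<close>, and a simple path from \<open>a\<close>
  to \<open>b\<close> with an interior vertex does not contain that edge.\<close>

lemma pedges_disjoint:
  assumes "distinct (a # xs @ b # ys)" "xs \<noteq> [] \<or> ys \<noteq> []"
  shows "pedges (a # xs @ [b]) \<inter> pedges (b # ys @ [a]) = {}"
proof -
  have no: "{u, v} \<notin> pedges (u # zs @ [v])" if "distinct (u # zs @ [v])" "zs \<noteq> []" for u v :: 'a and zs
  proof
    assume e: "{u, v} \<in> pedges (u # zs @ [v])"
    have "pedges (u # zs @ [v]) = insert {u, hd zs} (pedges (zs @ [v]))" using that by (simp add: pedges_Cons)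
    moreover have "{u, v} \<notin> pedges (zs @ [v])" using pedges_vertices[of "zs @ [v]"] that by auto
    moreover have "{u, v} \<noteq> {u, hd zs}" using that by (cases zs) (auto simp: doubleton_eq_iff)
    ultimately show False using e by auto
  qed
  show ?thesis
  proof (rule ccontr)
    assume "\<not> ?thesis"
    then obtain e where e: "e \<in> pedges (a # xs @ [b])" "e \<in> pedges (b # ys @ [a])" by blast
    then have "e \<subseteq> set (a # xs @ [b]) \<inter> set (b # ys @ [a])"
      using pedges_vertices[of "a # xs @ [b]"] pedges_vertices[of "b # ys @ [a]"] by blast
    also have "\<dots> \<subseteq> {a, b}" using assms by auto
    finally have "e = {a, b}"
      using pedges_card2[OF _ e(1)] assms card_subset_eq[of "{a, b}" e] by auto
    then show False using no[of a xs b] no[of b ys a] e assms by (auto simp: insert_commute)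
  qed
qed

locale plane_drawing =
  fixes V :: "'a set" and E :: "'a set set" and \<phi> :: "'a \<Rightarrow> complex" and \<gamma> :: "'a set \<Rightarrow> real \<Rightarrow> complex"
  assumes finite_V: "finite V" and two_sets_E: "two_sets E" and E_sub: "\<Union> E \<subseteq> V"
    and inj: "inj_on \<phi> V"
    and arc_edge: "e \<in> E \<Longrightarrow> arc (\<gamma> e)"
    and ends: "e \<in> E \<Longrightarrow> {pathstart (\<gamma> e), pathfinish (\<gamma> e)} = \<phi> ` e"
    and no_vertex: "e \<in> E \<Longrightarrow> (path_image (\<gamma> e) - {pathstart (\<gamma> e), pathfinish (\<gamma> e)}) \<inter> \<phi> ` V = {}"
    and no_crossing: "e \<in> E \<Longrightarrow> f \<in> E \<Longrightarrow> f \<noteq> e \<Longrightarrow>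
      (path_image (\<gamma> e) - {pathstart (\<gamma> e), pathfinish (\<gamma> e)}) \<inter> path_image (\<gamma> f) = {}"
begin

definition draw :: "'a set set \<Rightarrow> complex set" where
  "draw H = (\<Union>e\<in>H. path_image (\<gamma> e))"

lemma finite_E: "finite E"
  using E_sub finite_V by (meson Sup_le_iff finite_Pow_iff finite_subset Pow_iff subsetI)

lemma edge_ends_image: "e \<in> E \<Longrightarrow> \<phi> ` e \<subseteq> path_image (\<gamma> e)"
  using ends[of e] by (metis insert_subset empty_subsetI pathstart_in_path_image pathfinish_in_path_image)

lemma vertex_on_edge: "e \<in> E \<Longrightarrow> v \<in> V \<Longrightarrow> \<phi> v \<in> path_image (\<gamma> e) \<longleftrightarrow> v \<in> e"
proof
  assume a: "e \<in> E" "v \<in> V" "\<phi> v \<in> path_image (\<gamma> e)"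
  then have "\<phi> v \<in> \<phi> ` e" using no_vertex[OF a(1)] ends[OF a(1)] by blast
  moreover have "e \<subseteq> V" using a E_sub by auto
  ultimately show "v \<in> e" using inj a by (auto simp: inj_on_def)
qed (use edge_ends_image in auto)

lemma edges_meet: "e \<in> E \<Longrightarrow> f \<in> E \<Longrightarrow> e \<noteq> f \<Longrightarrow> path_image (\<gamma> e) \<inter> path_image (\<gamma> f) = \<phi> ` (e \<inter> f)"
proof
  assume a: "e \<in> E" "f \<in> E" "e \<noteq> f"
  show "path_image (\<gamma> e) \<inter> path_image (\<gamma> f) \<subseteq> \<phi> ` (e \<inter> f)"
  proof
    fix x assume x: "x \<in> path_image (\<gamma> e) \<inter> path_image (\<gamma> f)"
    then have "x \<in> \<phi> ` e" "x \<in> \<phi> ` f"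
      using no_crossing[OF a(1,2)] no_crossing[OF a(2,1)] a ends[OF a(1)] ends[OF a(2)] by blast+
    moreover have "e \<subseteq> V" "f \<subseteq> V" using a E_sub by auto
    ultimately show "x \<in> \<phi> ` (e \<inter> f)"
      using inj inj_on_image_Int[of \<phi> V e f] by blast
  qed
qed (use edge_ends_image in blast)

lemma vertex_on_draw: "H \<subseteq> E \<Longrightarrow> v \<in> V \<Longrightarrow> \<phi> v \<in> draw H \<longleftrightarrow> v \<in> \<Union> H"
  unfolding draw_def using vertex_on_edge by blast

lemma draw_Int:
  assumes "H1 \<subseteq> E" "H2 \<subseteq> E" "H1 \<inter> H2 = {}"
  shows "draw H1 \<inter> draw H2 = \<phi> ` (\<Union> H1 \<inter> \<Union> H2)"
proof
  show "draw H1 \<inter> draw H2 \<subseteq> \<phi> ` (\<Union> H1 \<inter> \<Union> H2)"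
  proof
    fix x assume "x \<in> draw H1 \<inter> draw H2"
    then obtain e f where "e \<in> H1" "f \<in> H2" "x \<in> path_image (\<gamma> e) \<inter> path_image (\<gamma> f)"
      unfolding draw_def by blast
    then have "x \<in> \<phi> ` (e \<inter> f)" using edges_meet[of e f] assms by blast
    then show "x \<in> \<phi> ` (\<Union> H1 \<inter> \<Union> H2)" using \<open>e \<in> H1\<close> \<open>f \<in> H2\<close> by blast
  qed
  show "\<phi> ` (\<Union> H1 \<inter> \<Union> H2) \<subseteq> draw H1 \<inter> draw H2"
    using vertex_on_draw[OF assms(1)] vertex_on_draw[OF assms(2)] E_sub assms by blast
qed

lemma draw_Un [simp]: "draw (H1 \<union> H2) = draw H1 \<union> draw H2"
  by (auto simp: draw_def)

lemma path_arc:
  "distinct p \<Longrightarrow> 2 \<le> length p \<Longrightarrow> pedges p \<subseteq> E \<Longrightarrow>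
    \<exists>g. arc g \<and> pathstart g = \<phi> (hd p) \<and> pathfinish g = \<phi> (last p) \<and> path_image g = draw (pedges p)"
proof (induction p rule: pedges.induct)
  case (1 x y xs)
  have e: "{x, y} \<in> E" using 1 by simp
  have g: "\<exists>g. arc g \<and> pathstart g = \<phi> x \<and> pathfinish g = \<phi> y \<and> path_image g = path_image (\<gamma> {x, y})"
  proof (cases "pathstart (\<gamma> {x, y}) = \<phi> x \<and> pathfinish (\<gamma> {x, y}) = \<phi> y")
    case True then show ?thesis using arc_edge[OF e] by blast
  next
    case False
    then have "pathstart (\<gamma> {x, y}) = \<phi> y \<and> pathfinish (\<gamma> {x, y}) = \<phi> x"
      using ends[OF e] by (auto simp: doubleton_eq_iff)
    then show ?thesis using arc_reversepath[OF arc_edge[OF e]]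
      by (intro exI[of _ "reversepath (\<gamma> {x, y})"]) auto
  qed
  then obtain g where g: "arc g" "pathstart g = \<phi> x" "pathfinish g = \<phi> y" "path_image g = path_image (\<gamma> {x, y})" by blast
  show ?case
  proof (cases xs)
    case Nil then show ?thesis using g by (intro exI[of _ g]) (auto simp: draw_def)
  next
    case (Cons z zs)
    then obtain h where h: "arc h" "pathstart h = \<phi> y" "pathfinish h = \<phi> (last (y # xs))" "path_image h = draw (pedges (y # xs))"
      using 1 by auto
    have "{x, y} \<notin> pedges (y # xs)" using pedges_vertices[of "y # xs"] 1(2) by auto
    then have "draw {{x, y}} \<inter> draw (pedges (y # xs)) = \<phi> ` (\<Union> {{x, y}} \<inter> \<Union> (pedges (y # xs)))"
      using 1 by (intro draw_Int) auto
    also have "\<dots> \<subseteq> {\<phi> y}" using pedges_vertices[of "y # xs"] 1(2) by auto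
    finally have sub: "path_image g \<inter> path_image h \<subseteq> {pathstart h}" using g h by (simp add: draw_def)
    have "arc (g +++ h)" by (rule arc_join) (use g h sub in auto)
    then show ?thesis using g h Cons by (intro exI[of _ "g +++ h"]) (auto simp: path_image_join draw_def)
  qed
qed auto

text \<open>A face is a pair of the edge set of its boundary cycle and the region itself.  The last
  condition says that the cyclic arrangement of edges and faces around a vertex is connected.\<close>

definition face_system :: "'a set set \<Rightarrow> ('a set set \<times> complex set) set \<Rightarrow> bool" where
  "face_system H \<Sigma> \<longleftrightarrow> finite \<Sigma> \<and>
     (\<forall>(C, R)\<in>\<Sigma>. (\<exists>c. cyc H c \<and> C = cedges c) \<and> (R = inside (draw C) \<or> R = outside (draw C)) \<and> R \<inter> draw H = {}) \<and>
     (\<forall>x\<in>\<Sigma>. \<forall>y\<in>\<Sigma>. x \<noteq> y \<longrightarrow> snd x \<inter> snd y = {}) \<and>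
     - draw H \<subseteq> \<Union> (snd ` \<Sigma>) \<and>
     (\<forall>e\<in>H. card {x \<in> \<Sigma>. e \<in> fst x} = 2) \<and>
     card \<Sigma> + card (\<Union> H) = card H + 2 \<and>
     (\<forall>v T. T \<subseteq> {e \<in> H. v \<in> e} \<longrightarrow> T \<noteq> {} \<longrightarrow> T \<noteq> {e \<in> H. v \<in> e} \<longrightarrow>
        (\<exists>x\<in>\<Sigma>. fst x \<inter> T \<noteq> {} \<and> fst x \<inter> ({e \<in> H. v \<in> e} - T) \<noteq> {}))"

lemma cycle_arcs:
  assumes "cyc E (a # xs @ b # ys)"
  obtains c1 c2 where
    "arc c1" "pathstart c1 = \<phi> a" "pathfinish c1 = \<phi> b" "path_image c1 = draw (pedges (a # xs @ [b]))"
    "arc c2" "pathstart c2 = \<phi> a" "pathfinish c2 = \<phi> b" "path_image c2 = draw (pedges (b # ys @ [a]))"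
    "path_image c1 \<inter> path_image c2 = {\<phi> a, \<phi> b}"
    "draw (cedges (a # xs @ b # ys)) = path_image c1 \<union> path_image c2"
proof -
  let ?P1 = "pedges (a # xs @ [b])" and ?P2 = "pedges (b # ys @ [a])"
  have d: "distinct (a # xs @ b # ys)" and sub: "?P1 \<union> ?P2 \<subseteq> E" and l: "xs \<noteq> [] \<or> ys \<noteq> []"
    using assms unfolding cyc_def cedges_append by auto
  obtain c1 where c1: "arc c1" "pathstart c1 = \<phi> a" "pathfinish c1 = \<phi> b" "path_image c1 = draw ?P1"
    using path_arc[of "a # xs @ [b]"] d sub by auto
  obtain c2 where c2: "arc c2" "pathstart c2 = \<phi> b" "pathfinish c2 = \<phi> a" "path_image c2 = draw ?P2"
    using path_arc[of "b # ys @ [a]"] d sub by auto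
  have "\<Union> ?P1 \<inter> \<Union> ?P2 = {a, b}"
  proof -
    have "\<Union> ?P1 = set (a # xs @ [b])" "\<Union> ?P2 = set (b # ys @ [a])" by (rule pedges_Union; simp)+
    then show ?thesis using d by auto
  qed
  moreover have "draw ?P1 \<inter> draw ?P2 = \<phi> ` (\<Union> ?P1 \<inter> \<Union> ?P2)"
    by (rule draw_Int) (use sub pedges_disjoint[OF d l] in auto)
  ultimately have "path_image c1 \<inter> path_image c2 = {\<phi> a, \<phi> b}" using c1 c2 by auto
  then show ?thesis
    using that[of c1 "reversepath c2"] c1 c2 arc_reversepath[OF c2(1)] by (auto simp: cedges_append)
qed

lemma cycle_curve:
  assumes "cyc E c"
  obtains a b c1 c2 where "arc c1" "pathstart c1 = a" "pathfinish c1 = b"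
    "arc c2" "pathstart c2 = a" "pathfinish c2 = b" "path_image c1 \<inter> path_image c2 = {a, b}"
    "draw (cedges c) = path_image c1 \<union> path_image c2"
proof -
  obtain a b ys where "c = a # [] @ b # ys" using assms by (cases c; cases "tl c") (auto simp: cyc_def)
  then show ?thesis using cycle_arcs[of a "[]" b ys] assms that by metis
qed

lemma cycle_Jordan:
  assumes "cyc E c" "S = draw (cedges c)"
  shows "topological_space_class.connected (inside S)" "topological_space_class.connected (outside S)" "inside S \<noteq> {}" "\<not> bounded (outside S)"
    "frontier (inside S) = S" "frontier (outside S) = S" "compact S"
  using cycle_curve[OF assms(1)] Jordan_arcs assms(2) by metis+

text \<open>The two faces of a single cycle have the same boundary edges, which is why a face
  carries its region as well.\<close>

lemma face_system_cycle:
  assumes c: "cyc E c"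
  shows "face_system (cedges c) {(cedges c, inside (draw (cedges c))), (cedges c, outside (draw (cedges c)))}"
    (is "face_system ?C ?S")
proof -
  note J = cycle_Jordan[OF c refl]
  have d: "distinct c" "3 \<le> length c" "c \<noteq> []" using c by (auto simp: cyc_def)
  have io: "inside (draw ?C) \<inter> outside (draw ?C) = {}" by (rule inside_Int_outside)
  then have ne: "inside (draw ?C) \<noteq> outside (draw ?C)" using J(3) by (metis Int_absorb)
  then have card_S: "card ?S = 2" by simp
  show ?thesis
    unfolding face_system_def
  proof (intro conjI)
    have "cyc ?C c" using c by (auto simp: cyc_def)
    then show "\<forall>(C, R)\<in>?S. (\<exists>c. cyc ?C c \<and> C = cedges c) \<and>
        (R = inside (draw C) \<or> R = outside (draw C)) \<and> R \<inter> draw ?C = {}"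
      by (auto simp: inside_no_overlap outside_no_overlap)
    show "\<forall>x\<in>?S. \<forall>y\<in>?S. x \<noteq> y \<longrightarrow> snd x \<inter> snd y = {}"
      using io by (simp add: Int_commute)
    show "- draw ?C \<subseteq> \<Union> (snd ` ?S)" unfolding outside_inside by auto
    show "\<forall>e\<in>?C. card {x \<in> ?S. e \<in> fst x} = 2"
    proof
      fix e assume "e \<in> ?C"
      then have "{x \<in> ?S. e \<in> fst x} = ?S" by auto
      then show "card {x \<in> ?S. e \<in> fst x} = 2" using card_S by simp
    qed
    have "card (\<Union> ?C) = card ?C"
      using card_cedges[OF d(1,2)] cedges_Union[OF d(3)] distinct_card[OF d(1)] by simp
    then show "card ?S + card (\<Union> ?C) = card ?C + 2" using card_S by simp
    show "\<forall>v T. T \<subseteq> {e \<in> ?C. v \<in> e} \<longrightarrow> T \<noteq> {} \<longrightarrow> T \<noteq> {e \<in> ?C. v \<in> e} \<longrightarrow>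
        (\<exists>x\<in>?S. fst x \<inter> T \<noteq> {} \<and> fst x \<inter> ({e \<in> ?C. v \<in> e} - T) \<noteq> {})"
    proof (intro allI impI)
      fix v T assume T: "T \<subseteq> {e \<in> ?C. v \<in> e}" "T \<noteq> {}" "T \<noteq> {e \<in> ?C. v \<in> e}"
      then have "?C \<inter> T \<noteq> {}" "?C \<inter> ({e \<in> ?C. v \<in> e} - T) \<noteq> {}" by auto
      then show "\<exists>x\<in>?S. fst x \<inter> T \<noteq> {} \<and> fst x \<inter> ({e \<in> ?C. v \<in> e} - T) \<noteq> {}"
        by (intro bexI[of _ "(?C, inside (draw ?C))"]) simp_all
    qed
  qed simp
qed

end

section \<open>Adding an ear to a face system\<close>

context plane_drawing
begin

text \<open>The open arc is connected and misses the frontier of \<open>R\<close>, so it cannot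
  leave \<open>R\<close>; its end points are limits of interior points.\<close>

lemma arc_in_region:
  assumes g: "arc g" and R: "frontier R = D" and D: "(path_image g - {pathstart g, pathfinish g}) \<inter> D = {}"
    and x: "x \<in> path_image g - {pathstart g, pathfinish g}" "x \<in> R"
  shows "path_image g - {pathstart g, pathfinish g} \<subseteq> R" "path_image g \<subseteq> closure R"
proof -
  note sp = arc_imp_simple_path[OF g]
  have con: "topological_space_class.connected (path_image g - {pathstart g, pathfinish g})"
    using connected_simple_path_endless[OF sp] .
  show sub: "path_image g - {pathstart g, pathfinish g} \<subseteq> R"
    using connected_Int_frontier[OF con, of R] x R D by blast
  have "g ` {0<..<1} \<subseteq> R" using sub simple_path_endless[OF sp] by simp
  moreover have "continuous_on (closure {0<..<1}) g" using g by (simp add: arc_def path_def)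
  ultimately have "g ` closure {0<..<1} \<subseteq> closure R"
    using closure_subset by (intro image_closure_subset) auto
  then show "path_image g \<subseteq> closure R" by (simp add: path_image_def)
qed

text \<open>The open ear misses \<open>draw H\<close>, hence lies in a single region
  \<open>R\<close>, and its ends lie on the boundary cycle of \<open>R\<close>. They cut that cycle
  into two paths, and each path together with the ear bounds one of the two regions into which
  \<open>R\<close> splits. One face is gained, and one more edge than vertices, so Euler's relation
  is preserved.\<close>

lemma face_system_ear:
  assumes fs: "face_system H \<Sigma>" and HE: "H \<subseteq> E"
    and p: "p = a # qs @ [b]" "distinct p" "pedges p \<subseteq> E" "pedges p \<inter> H = {}"
    and ab: "a \<in> \<Union> H" "b \<in> \<Union> H" and qs: "set qs \<inter> \<Union> H = {}"
  shows "\<exists>\<Sigma>'. face_system (H \<union> pedges p) \<Sigma>'"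
proof -
  let ?P = "pedges p"
  note q1 = fs[unfolded face_system_def]
  note q2 = q1[THEN conjunct2] note q3 = q2[THEN conjunct2] note q4 = q3[THEN conjunct2]
  note q5 = q4[THEN conjunct2] note q6 = q5[THEN conjunct2] note q7 = q6[THEN conjunct2]
  note fin = q1[THEN conjunct1]
  have faces: "(\<exists>c. cyc H c \<and> C = cedges c) \<and> (R = inside (draw C) \<or> R = outside (draw C)) \<and> R \<inter> draw H = {}"
    if "(C, R) \<in> \<Sigma>" for C R
    using q2[THEN conjunct1, THEN bspec, OF that] by simp
  have disj: "snd x \<inter> snd y = {}" if "x \<in> \<Sigma>" "y \<in> \<Sigma>" "x \<noteq> y" for x y
    using q3[THEN conjunct1, THEN bspec, OF that(1), THEN bspec, OF that(2)] that(3) by simp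
  have cover: "\<exists>C R. (C, R) \<in> \<Sigma> \<and> z \<in> R" if "z \<notin> draw H" for z
  proof -
    have "z \<in> \<Union> (snd ` \<Sigma>)" using q4[THEN conjunct1] that by (meson ComplI subsetD)
    then obtain y where "y \<in> \<Sigma>" "z \<in> snd y" by (rule UN_E)
    then show ?thesis by (metis prod.collapse)
  qed
  note two = q5[THEN conjunct1, THEN bspec]
  note euler = q6[THEN conjunct1]
  note link = q7[rule_format]
  have fstH: "C \<subseteq> H" if "(C, R) \<in> \<Sigma>" for C R using faces[OF that] by (auto simp: cyc_def)
  have abV: "a \<in> V" "b \<in> V" "a \<noteq> b" using ab HE E_sub p by auto
  have Pv: "\<Union> ?P = insert a (insert b (set qs))" using pedges_Union[of p] p(1) by auto
  have meet: "draw ?P \<inter> draw H = {\<phi> a, \<phi> b}"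
    using draw_Int[OF p(3) HE p(4)] Pv ab qs by auto
  obtain g where g: "arc g" "pathstart g = \<phi> a" "pathfinish g = \<phi> b" "path_image g = draw ?P"
    using path_arc[of p] p by auto
  let ?S = "path_image g - {\<phi> a, \<phi> b}"
  have SH: "?S \<inter> draw H = {}" using meet g(4) by auto
  have "?S \<noteq> {}" using nonempty_simple_path_endless[OF arc_imp_simple_path[OF g(1)]] g by simp
  then obtain x where x: "x \<in> ?S" by blast
  then have "x \<notin> draw H" using SH by (simp add: disjoint_iff)
  then obtain C R where CR: "(C, R) \<in> \<Sigma>" "x \<in> R" using cover by metis
  obtain c where c: "cyc H c" "C = cedges c" using faces[OF CR(1)] by blast
  have cE: "cyc E c" using c(1) HE by (auto simp: cyc_def)
  have Rio: "R = inside (draw C) \<or> R = outside (draw C)" and RH: "R \<inter> draw H = {}" using faces[OF CR(1)] by auto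
  have fr: "frontier R = draw C" using Rio cycle_Jordan(5,6)[OF cE refl] c(2) by auto
  have CH: "C \<subseteq> H" using fstH[OF CR(1)] .
  have drawCH: "draw C \<subseteq> draw H" using CH by (auto simp: draw_def)
  have SR: "?S \<subseteq> R" and gR: "path_image g \<subseteq> closure R"
  proof -
    have "?S \<inter> draw C = {}" using SH drawCH by blast
    then show "?S \<subseteq> R" "path_image g \<subseteq> closure R"
      using arc_in_region[OF g(1) fr, unfolded g(2,3)] x CR(2) by blast+
  qed
  \<comment> \<open>The ends lie in the closure of \<open>R\<close> but, being on
    \<open>draw H\<close>, not in \<open>R\<close>; so they lie on its frontier, which is
    \<open>draw C\<close>.\<close>
  have abC: "a \<in> \<Union> C" "b \<in> \<Union> C"
  proof -
    have on: "v \<in> \<Union> C" if "v \<in> \<Union> H" "\<phi> v \<in> path_image g" for v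
    proof -
      have vV: "v \<in> V" using that HE E_sub by auto
      have "\<phi> v \<in> draw H" using vertex_on_draw[OF HE vV] that by simp
      then have "\<phi> v \<in> frontier R" using gR that(2) RH by (auto simp: closure_Un_frontier)
      then show ?thesis using vertex_on_draw[of C v] fr CH HE vV by auto
    qed
    show "a \<in> \<Union> C" "b \<in> \<Union> C" using on ab g(2,3) by (metis pathstart_in_path_image, metis on ab(2) g(3) pathfinish_in_path_image)
  qed
  have cn: "c \<noteq> []" using c by (auto simp: cyc_def)
  have "a \<in> set c" "b \<in> set c" using abC cedges_Union[OF cn] c(2) by auto
  then obtain n r where r: "rotate n c = a # r" using rotate_to_front by metis
  then have "b \<in> set r" using \<open>b \<in> set c\<close> abV(3) by (metis set_ConsD set_rotate)
  then obtain xs ys where "r = xs @ b # ys" by (meson split_list)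
  then have rc: "rotate n c = a # xs @ b # ys" using r by simp
  have cy: "cyc H (a # xs @ b # ys)" and Cr: "C = cedges (a # xs @ b # ys)"
    using c rc by (metis cyc_rotate, metis cedges_rotate)
  have cyE: "cyc E (a # xs @ b # ys)" using cy HE by (auto simp: cyc_def)
  let ?P1 = "pedges (a # xs @ [b])" and ?P2 = "pedges (b # ys @ [a])"
  have C12: "C = ?P1 \<union> ?P2" using Cr cedges_append by simp
  have d: "distinct (a # xs @ b # ys)" and l: "xs \<noteq> [] \<or> ys \<noteq> []" using cy by (auto simp: cyc_def)
  have P12: "?P1 \<inter> ?P2 = {}" using pedges_disjoint[OF d l] .
  have nonempty: "?P1 \<noteq> {}" "?P2 \<noteq> {}" "?P \<noteq> {}" using p(1) by (auto simp: pedges_Cons)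
  obtain c1 c2 where c1: "arc c1" "pathstart c1 = \<phi> a" "pathfinish c1 = \<phi> b" "path_image c1 = draw ?P1"
    and c2: "arc c2" "pathstart c2 = \<phi> a" "pathfinish c2 = \<phi> b" "path_image c2 = draw ?P2"
    and i12: "path_image c1 \<inter> path_image c2 = {\<phi> a, \<phi> b}"
    and d12: "draw (cedges (a # xs @ b # ys)) = path_image c1 \<union> path_image c2"
    by (rule cycle_arcs[OF cyE])
  have i1: "path_image c1 \<inter> path_image g = {\<phi> a, \<phi> b}" and i2: "path_image c2 \<inter> path_image g = {\<phi> a, \<phi> b}"
  proof -
    have "draw ?P1 \<subseteq> draw H" "draw ?P2 \<subseteq> draw H" using C12 CH by (auto simp: draw_def)
    moreover have "{\<phi> a, \<phi> b} \<subseteq> draw ?P1" "{\<phi> a, \<phi> b} \<subseteq> draw ?P2" "{\<phi> a, \<phi> b} \<subseteq> draw ?P"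
      using i12 c1 c2 meet by auto
    ultimately show "path_image c1 \<inter> path_image g = {\<phi> a, \<phi> b}" "path_image c2 \<inter> path_image g = {\<phi> a, \<phi> b}"
      using c1(4) c2(4) g(4) meet by auto
  qed
  have Rio': "R = inside (path_image c1 \<union> path_image c2) \<or> R = outside (path_image c1 \<union> path_image c2)"
    using Rio d12 Cr by simp
  obtain R1 R2 where
    R1: "R1 = inside (path_image c1 \<union> path_image g) \<or> R1 = outside (path_image c1 \<union> path_image g)" and
    R2: "R2 = inside (path_image c2 \<union> path_image g) \<or> R2 = outside (path_image c2 \<union> path_image g)" and
    R12: "R1 \<inter> R2 = {}" "R1 \<union> R2 \<union> (path_image g - {\<phi> a, \<phi> b}) = R"
    by (rule theta_curve_split[OF c1(1-3) c2(1-3) g(1-3) i12 i1 i2 Rio' SR])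
  let ?n1 = "(?P1 \<union> ?P, R1)" and ?n2 = "(?P2 \<union> ?P, R2)"
  define \<Sigma>' where "\<Sigma>' = insert ?n1 (insert ?n2 (\<Sigma> - {(C, R)}))"
  let ?H' = "H \<union> ?P"
  have PH: "?P \<inter> H = {}" using p(4) .
  have P1H: "?P1 \<subseteq> H" "?P2 \<subseteq> H" using C12 CH by auto
  obtain e1 where "e1 \<in> ?P1" using nonempty by auto
  then have "e1 \<notin> ?P2 \<union> ?P" using P12 P1H PH by blast
  then have n12: "?n1 \<noteq> ?n2" using \<open>e1 \<in> ?P1\<close> by auto
  have new: "?n1 \<notin> \<Sigma>" "?n2 \<notin> \<Sigma>" using fstH nonempty(3) PH by blast+
  have sets: "set (a # xs @ b # ys) \<subseteq> \<Union> H" using cedges_Union[of "a # xs @ b # ys"] Cr CH by auto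
  have cyc1: "cyc ?H' (a # xs @ b # rev qs)" "cedges (a # xs @ b # rev qs) = ?P1 \<union> ?P"
  proof -
    have "pedges (b # rev qs @ [a]) = ?P" using pedges_rev[of p] p(1) by simp
    then show e: "cedges (a # xs @ b # rev qs) = ?P1 \<union> ?P" using cedges_append[of a xs b "rev qs"] by simp
    \<comment> \<open>Otherwise the path and the ear would both be the single edge
      \<open>{a, b}\<close>, but the ear is disjoint from \<open>H\<close>.\<close>
    have "xs \<noteq> [] \<or> qs \<noteq> []"
    proof (rule ccontr)
      assume "\<not> ?thesis" then have "?P1 = ?P" using p(1) by simp
      then show False using P1H PH nonempty by auto
    qed
    then have "3 \<le> length (a # xs @ b # rev qs)" by (cases xs; cases qs) auto
    moreover have "distinct (a # xs @ b # rev qs)" using d p(1,2) sets qs by auto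
    ultimately show "cyc ?H' (a # xs @ b # rev qs)" using e P1H by (auto simp: cyc_def)
  qed
  have cyc2: "cyc ?H' (a # qs @ b # ys)" "cedges (a # qs @ b # ys) = ?P2 \<union> ?P"
  proof -
    show e: "cedges (a # qs @ b # ys) = ?P2 \<union> ?P" using cedges_append[of a qs b ys] p(1) by auto
    have "ys \<noteq> [] \<or> qs \<noteq> []"
    proof (rule ccontr)
      assume "\<not> ?thesis" then have "?P2 = ?P" using p(1) by (simp add: insert_commute)
      then show False using P1H PH nonempty by auto
    qed
    then have "3 \<le> length (a # qs @ b # ys)" by (cases ys; cases qs) auto
    moreover have "distinct (a # qs @ b # ys)" using d p(1,2) sets qs by auto
    ultimately show "cyc ?H' (a # qs @ b # ys)" using e P1H by (auto simp: cyc_def)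
  qed
  have R12H: "R1 \<inter> draw ?H' = {}" "R2 \<inter> draw ?H' = {}"
  proof -
    have "R1 \<subseteq> R" "R2 \<subseteq> R" using R12 by auto
    moreover have "R1 \<inter> path_image g = {}" "R2 \<inter> path_image g = {}"
      using R1 R2 inside_no_overlap outside_no_overlap by blast+
    ultimately show "R1 \<inter> draw ?H' = {}" "R2 \<inter> draw ?H' = {}" using RH g(4) by auto
  qed
  have old: "R' \<inter> R = {}" "R' \<inter> draw ?P = {}" if "(C', R') \<in> \<Sigma>" "(C', R') \<noteq> (C, R)" for C' R'
  proof -
    show RR: "R' \<inter> R = {}" using disj[OF that(1) CR(1) that(2)] by simp
    have "R' \<inter> draw H = {}" using faces[OF that(1)] by simp
    moreover have "draw ?P \<subseteq> R \<union> draw H" using SR g(4) meet by blast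
    ultimately show "R' \<inter> draw ?P = {}" using RR by blast
  qed
  have "face_system ?H' \<Sigma>'"
    unfolding face_system_def
  proof (intro conjI)
    show "finite \<Sigma>'" using fin by (simp add: \<Sigma>'_def)
    have f1: "(\<exists>c. cyc ?H' c \<and> C' = cedges c) \<and> (R' = inside (draw C') \<or> R' = outside (draw C')) \<and> R' \<inter> draw ?H' = {}"
      if CR': "(C', R') \<in> \<Sigma>'" for C' R'
    proof -
      consider "(C', R') = ?n1" | "(C', R') = ?n2" | "(C', R') \<in> \<Sigma>" "(C', R') \<noteq> (C, R)"
        using CR' unfolding \<Sigma>'_def by blast
      then show ?thesis
      proof cases
        case 1
        then have e: "C' = ?P1 \<union> ?P" "R' = R1" by auto
        show ?thesis unfolding e using cyc1 R1 R12H(1) c1(4) g(4) by (auto intro!: exI[of _ "a # xs @ b # rev qs"])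
      next
        case 2
        then have e: "C' = ?P2 \<union> ?P" "R' = R2" by auto
        show ?thesis unfolding e using cyc2 R2 R12H(2) c2(4) g(4) by (auto intro!: exI[of _ "a # qs @ b # ys"])
      next
        case 3
        then obtain c' where "cyc H c'" "C' = cedges c'" using faces by blast
        then have "cyc ?H' c' \<and> C' = cedges c'" by (auto simp: cyc_def)
        moreover have "R' \<inter> draw ?H' = {}" using faces[OF 3(1)] old(2)[OF 3] by auto
        ultimately show ?thesis using faces[OF 3(1)] by blast
      qed
    qed
    then show "\<forall>(C, R)\<in>\<Sigma>'. (\<exists>c. cyc ?H' c \<and> C = cedges c) \<and>
        (R = inside (draw C) \<or> R = outside (draw C)) \<and> R \<inter> draw ?H' = {}" by blast
    show "\<forall>x\<in>\<Sigma>'. \<forall>y\<in>\<Sigma>'. x \<noteq> y \<longrightarrow> snd x \<inter> snd y = {}"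
    proof (intro ballI impI)
      fix x y assume xy: "x \<in> \<Sigma>'" "y \<in> \<Sigma>'" "x \<noteq> y"
      have sub: "R1 \<subseteq> R" "R2 \<subseteq> R" using R12 by auto
      have o: "z \<in> \<Sigma> - {(C, R)} \<Longrightarrow> snd z \<inter> R1 = {} \<and> snd z \<inter> R2 = {}" for z
        using old(1)[of "fst z" "snd z"] sub by auto
      show "snd x \<inter> snd y = {}"
        using xy R12(1) o[of x] o[of y] disj[of x y] unfolding \<Sigma>'_def by (auto simp: Int_commute)
    qed
    show "- draw ?H' \<subseteq> \<Union> (snd ` \<Sigma>')"
    proof
      fix z assume z: "z \<in> - draw ?H'"
      then have "z \<notin> draw H" by simp
      then obtain C' R' where z': "(C', R') \<in> \<Sigma>" "z \<in> R'" using cover by metis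
      show "z \<in> \<Union> (snd ` \<Sigma>')"
      proof (cases "(C', R') = (C, R)")
        case True
        then have "z \<in> R1 \<union> R2" using z' R12(2) z g(4) by auto
        then show ?thesis unfolding \<Sigma>'_def by auto
      next
        case False then show ?thesis using z' unfolding \<Sigma>'_def by force
      qed
    qed
    show "\<forall>e\<in>?H'. card {x \<in> \<Sigma>'. e \<in> fst x} = 2"
    proof
      fix e assume e: "e \<in> ?H'"
      show "card {x \<in> \<Sigma>'. e \<in> fst x} = 2"
      proof (cases "e \<in> ?P")
        case True
        then have "e \<notin> H" using PH by auto
        then have "\<And>x. x \<in> \<Sigma> \<Longrightarrow> e \<notin> fst x" using fstH by force
        then have "{x \<in> \<Sigma>'. e \<in> fst x} = {?n1, ?n2}" using True unfolding \<Sigma>'_def by auto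
        then show ?thesis using n12 by simp
      next
        case False
        then have eH: "e \<in> H" using e by auto
        let ?A = "{x \<in> \<Sigma>. e \<in> fst x}"
        have fA: "finite ?A" using fin by simp
        consider "e \<notin> C" | "e \<in> ?P1" "e \<notin> ?P2" | "e \<in> ?P2" "e \<notin> ?P1" using C12 P12 by blast
        then show ?thesis
        proof cases
          case 1
          then have "{x \<in> \<Sigma>'. e \<in> fst x} = ?A" using False C12 unfolding \<Sigma>'_def by auto
          then show ?thesis using two[OF eH] by simp
        next
          case 2
          have CA: "(C, R) \<in> ?A" using CR(1) 2 C12 by auto
          have "{x \<in> \<Sigma>'. e \<in> fst x} = insert ?n1 (?A - {(C, R)})" using False 2 unfolding \<Sigma>'_def by auto
          then show ?thesis using two[OF eH] new(1) fA CA by (simp add: card_insert_if)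
        next
          case 3
          have CA: "(C, R) \<in> ?A" using CR(1) 3 C12 by auto
          have "{x \<in> \<Sigma>'. e \<in> fst x} = insert ?n2 (?A - {(C, R)})" using False 3 unfolding \<Sigma>'_def by auto
          then show ?thesis using two[OF eH] new(2) fA CA by (simp add: card_insert_if)
        qed
      qed
    qed
    have "card \<Sigma>' = card \<Sigma> + 1"
    proof -
      have "card \<Sigma> > 0" using CR(1) fin card_gt_0_iff by blast
      then show ?thesis using new n12 fin CR(1) unfolding \<Sigma>'_def by (simp add: card_insert_if)
    qed
    moreover have fH: "finite H" using HE finite_E finite_subset by blast
    moreover have "card ?H' = card H + (length qs + 1)"
      using card_Un_disjoint[OF fH finite_pedges] PH card_pedges[OF p(2)] p(1) by (simp add: Int_commute)
    moreover have "card (\<Union> ?H') = card (\<Union> H) + length qs"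
    proof -
      have "\<Union> ?H' = \<Union> H \<union> set qs" using Pv ab by auto
      moreover have "finite (\<Union> H)" using HE E_sub finite_V by (meson Sup_subset_mono finite_subset)
      moreover have "card (set qs) = length qs" using p(1,2) distinct_card by auto
      ultimately show ?thesis using qs by (simp add: card_Un_disjoint Int_commute)
    qed
    ultimately show "card \<Sigma>' + card (\<Union> ?H') = card ?H' + 2" using euler by simp
    show "\<forall>v T. T \<subseteq> {e \<in> ?H'. v \<in> e} \<longrightarrow> T \<noteq> {} \<longrightarrow> T \<noteq> {e \<in> ?H'. v \<in> e} \<longrightarrow>
        (\<exists>x\<in>\<Sigma>'. fst x \<inter> T \<noteq> {} \<and> fst x \<inter> ({e \<in> ?H'. v \<in> e} - T) \<noteq> {})"
    proof (intro allI impI)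
      fix v T assume T: "T \<subseteq> {e \<in> ?H'. v \<in> e}" "T \<noteq> {}" "T \<noteq> {e \<in> ?H'. v \<in> e}"
      let ?goal = "\<exists>x\<in>\<Sigma>'. fst x \<inter> T \<noteq> {} \<and> fst x \<inter> ({e \<in> ?H'. v \<in> e} - T) \<noteq> {}"
      have in1: ?goal if "e \<in> ?P1 \<union> ?P" "e \<in> T" "f \<in> ?P1 \<union> ?P" "f \<in> ?H'" "v \<in> f" "f \<notin> T" for e f
        using that unfolding \<Sigma>'_def by (intro bexI[of _ ?n1]) auto
      have in2: ?goal if "e \<in> ?P2 \<union> ?P" "e \<in> T" "f \<in> ?P2 \<union> ?P" "f \<in> ?H'" "v \<in> f" "f \<notin> T" for e f
        using that unfolding \<Sigma>'_def by (intro bexI[of _ ?n2]) auto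
      have PE1: "\<exists>f\<in>?P1. v \<in> f" "\<exists>f\<in>?P. v \<in> f" if "v = a \<or> v = b"
      proof -
        have "v \<in> \<Union> ?P1" "v \<in> \<Union> ?P" using that pedges_Union[of "a # xs @ [b]"] Pv by auto
        then show "\<exists>f\<in>?P1. v \<in> f" "\<exists>f\<in>?P. v \<in> f" by auto
      qed
      \<comment> \<open>\<open>T\<close> may separate old edges at \<open>v\<close>, miss all of
        them, or contain all of them. In the first case the old link works unless its face is the
        divided one; in the other two an ear edge is linked to another edge at \<open>v\<close> by a
        new face.\<close>
      consider (both) "T \<inter> H \<noteq> {}" "{e \<in> H. v \<in> e} - T \<noteq> {}"
        | (noH) "T \<inter> H = {}" | (allH) "{e \<in> H. v \<in> e} \<subseteq> T" by blast
      then show ?goal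
      proof cases
        case both
        have "\<exists>x\<in>\<Sigma>. fst x \<inter> (T \<inter> H) \<noteq> {} \<and> fst x \<inter> ({e \<in> H. v \<in> e} - T \<inter> H) \<noteq> {}"
          by (rule link) (use both T in auto)
        then obtain x e f where x: "x \<in> \<Sigma>" "e \<in> fst x" "e \<in> T" "e \<in> H" "f \<in> fst x" "f \<in> H" "v \<in> f" "f \<notin> T" by blast
        show ?thesis
        proof (cases "x = (C, R)")
          case False
          then show ?thesis using x unfolding \<Sigma>'_def by (intro bexI[of _ x]) auto
        next
          case True
          then have ef: "e \<in> ?P1 \<union> ?P2" "f \<in> ?P1 \<union> ?P2" using x C12 by auto
          have ve: "v \<in> e" using x T by auto
          show ?thesis
          proof (cases "(e \<in> ?P1 \<and> f \<in> ?P1) \<or> (e \<in> ?P2 \<and> f \<in> ?P2)")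
            case True
            then show ?thesis using in1[of e f] in2[of e f] x by blast
          next
            case False
            then have mixed: "(e \<in> ?P1 \<and> f \<in> ?P2) \<or> (e \<in> ?P2 \<and> f \<in> ?P1)" using ef by blast
            then have "v \<in> \<Union> ?P1 \<inter> \<Union> ?P2" using ve x by blast
            then have "v \<in> set (a # xs @ [b]) \<inter> set (b # ys @ [a])"
              using subsetD[OF pedges_vertices[of "a # xs @ [b]"]] subsetD[OF pedges_vertices[of "b # ys @ [a]"]]
              by (simp del: set_simps)
            then have "v = a \<or> v = b" using d by auto
            \<comment> \<open>The edges \<open>e\<close> and \<open>f\<close> now lie on different
              new faces, but an ear edge \<open>h\<close> at \<open>v\<close> lies on both and takes
              over the link, on whichever side of \<open>T\<close> it falls.\<close>
            then obtain h where h: "h \<in> ?P" "v \<in> h" using PE1(2) by blast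
            show ?thesis
            proof (cases "h \<in> T")
              case True
              show ?thesis using mixed
              proof
                assume "e \<in> ?P1 \<and> f \<in> ?P2"
                then show ?thesis using in2[of h f] True h x by blast
              next
                assume "e \<in> ?P2 \<and> f \<in> ?P1"
                then show ?thesis using in1[of h f] True h x by blast
              qed
            next
              case False
              show ?thesis using mixed
              proof
                assume "e \<in> ?P1 \<and> f \<in> ?P2"
                then show ?thesis using in1[of e h] False h x by blast
              next
                assume "e \<in> ?P2 \<and> f \<in> ?P1"
                then show ?thesis using in2[of e h] False h x by blast
              qed
            qed
          qed
        qed
      next
        case noH
        then obtain e where e: "e \<in> T" "e \<in> ?P" "v \<in> e" using T by blast
        show ?thesis
        proof (cases "v = a \<or> v = b")
          case True
          then obtain f where f: "f \<in> ?P1" "v \<in> f" using PE1(1) by blast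
          then have "f \<notin> T" "f \<in> ?H'" using noH P1H by auto
          then show ?thesis using in1[of e f] e f by blast
        next
          case False
          then have "v \<notin> \<Union> H" using e(2,3) Pv qs by auto
          moreover obtain f where f: "f \<in> ?H'" "v \<in> f" "f \<notin> T" using T by blast
          ultimately have "f \<in> ?P" by auto
          then show ?thesis using in1[of e f] e f by blast
        qed
      next
        case allH
        obtain f where f: "f \<in> ?H'" "v \<in> f" "f \<notin> T" using T by blast
        then have fP: "f \<in> ?P" using allH by auto
        show ?thesis
        proof (cases "v = a \<or> v = b")
          case True
          then obtain e where e: "e \<in> ?P1" "v \<in> e" using PE1(1) by blast
          then have "e \<in> T" using allH P1H by auto
          then show ?thesis using in1[of e f] e f fP by blast
        next
          case False
          then have "v \<notin> \<Union> H" using f(2) fP Pv qs by auto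
          moreover obtain e where e: "e \<in> T" "v \<in> e" "e \<in> ?H'" using T by blast
          ultimately have "e \<in> ?P" by auto
          then show ?thesis using in1[of e f] e f fP by blast
        qed
      qed
    qed
  qed
  then show ?thesis by blast
qed

text \<open>A missing edge with both ends in \<open>\<Union> H\<close> is an ear by itself.
  Otherwise some edge \<open>{u, v}\<close> leaves \<open>\<Union> H\<close>; as deleting
  \<open>u\<close> does not disconnect the graph, the component of \<open>v\<close> off
  \<open>\<Union> H\<close> has a neighbour \<open>b \<noteq> u\<close> in
  \<open>\<Union> H\<close>.\<close>

lemma ear_exists:
  assumes con: "connected_on E V" "\<And>u. u \<in> V \<Longrightarrow> connected_on E (V - {u})"
    and H: "H \<subseteq> E" "H \<noteq> E" and u0: "u0 \<in> \<Union> H" and v0: "v0 \<in> \<Union> H" "v0 \<noteq> u0"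
  obtains p a qs b where "p = a # qs @ [b]" "distinct p" "pedges p \<subseteq> E" "pedges p \<inter> H = {}"
    "a \<in> \<Union> H" "b \<in> \<Union> H" "set qs \<inter> \<Union> H = {}"
proof -
  let ?W = "\<Union> H"
  show ?thesis
  proof (cases "\<exists>e\<in>E - H. e \<subseteq> ?W")
    case True
    then obtain e where e: "e \<in> E" "e \<notin> H" "e \<subseteq> ?W" by auto
    obtain a b where ab: "e = {a, b}" "a \<noteq> b" using two_setsE[OF two_sets_E e(1)] by blast
    show ?thesis by (rule that[of "[a, b]" a "[]" b]) (use e ab in auto)
  next
    case False
    have WV: "?W \<subseteq> V" using H E_sub by auto
    obtain e where "e \<in> E" "e \<notin> H" using H by auto
    then have "e \<subseteq> V" "\<not> e \<subseteq> ?W" using False E_sub by auto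
    then have "?W \<noteq> V" by auto
    then obtain u v where uv: "u \<in> ?W" "v \<in> V - ?W" "{u, v} \<in> E"
      using con(1) WV u0 unfolding connected_on_def by (metis empty_iff)
    let ?S = "V - {u}"
    define A where "A = {y \<in> V - ?W. conn E (V - ?W) v y}"
    have vA: "v \<in> A" using uv unfolding A_def by auto
    have AS: "A \<subseteq> ?S" "A \<noteq> ?S"
    proof -
      show "A \<subseteq> ?S" using uv unfolding A_def by auto
      obtain w where "w \<in> ?W" "w \<noteq> u" using u0 v0 by blast
      then show "A \<noteq> ?S" using WV unfolding A_def by blast
    qed
    then obtain y b where yb: "y \<in> A" "b \<in> ?S - A" "{y, b} \<in> E"
      using con(2)[of u] uv(1) WV vA unfolding connected_on_def by (metis empty_iff subsetD)
    have bW: "b \<in> ?W"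
    proof (rule ccontr)
      assume "b \<notin> ?W"
      then have "conn E (V - ?W) y b" using yb unfolding A_def by (intro conn_edge) auto
      then have "conn E (V - ?W) v b" using conn_trans[of E "V - ?W" v y b] yb(1) unfolding A_def by simp
      then show False using yb(2) \<open>b \<notin> ?W\<close> unfolding A_def by simp
    qed
    have "conn E (V - ?W) v y" using yb unfolding A_def by auto
    then obtain q where q: "q \<noteq> []" "distinct q" "hd q = v" "last q = y" "set q \<subseteq> V - ?W" "pedges q \<subseteq> E"
      using conn_obtain_path uv(2) by metis
    have e: "pedges (u # q @ [b]) = insert {u, v} (insert {y, b} (pedges q))"
      using q by (simp add: pedges_Cons pedges_snoc)
    show ?thesis
    proof (rule that[of "u # q @ [b]" u q b])
      show "distinct (u # q @ [b])" using q uv bW yb by auto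
      show "pedges (u # q @ [b]) \<subseteq> E" using e uv yb q by auto
      have "\<And>f. f \<in> pedges q \<Longrightarrow> f \<notin> H"
      proof
        fix f assume f: "f \<in> pedges q" "f \<in> H"
        then have "f \<subseteq> set q" "f \<subseteq> ?W" using pedges_vertices[of q] by auto
        moreover have "f \<noteq> {}" using f H two_sets_E unfolding two_sets_def by fastforce
        ultimately show False using q(5) by blast
      qed
      moreover have "{u, v} \<notin> H" "{y, b} \<notin> H" using uv yb unfolding A_def by auto
      ultimately show "pedges (u # q @ [b]) \<inter> H = {}" unfolding e by auto
    qed (use uv bW q in auto)
  qed
qed

text \<open>A maximal subgraph that contains \<open>c\<close> and has a face system is the whole
  graph, since an ear could be added to any smaller one.\<close>

theorem face_system_exists:
  assumes con: "connected_on E V" "\<And>u. u \<in> V \<Longrightarrow> connected_on E (V - {u})" and c: "cyc E c"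
  obtains \<Sigma> where "face_system E \<Sigma>"
proof -
  define \<H> where "\<H> = {H. H \<subseteq> E \<and> cedges c \<subseteq> H \<and> (\<exists>\<Sigma>. face_system H \<Sigma>)}"
  have cE: "cedges c \<subseteq> E" using c by (auto simp: cyc_def)
  have "cedges c \<in> \<H>" unfolding \<H>_def using face_system_cycle[OF c] cE by blast
  moreover have "finite \<H>" unfolding \<H>_def using finite_E by (auto intro: finite_subset[of _ "Pow E"])
  ultimately obtain H where H: "H \<in> \<H>" and mx: "\<And>H'. H' \<in> \<H> \<Longrightarrow> H \<subseteq> H' \<Longrightarrow> H' = H"
    by (metis finite_has_maximal empty_iff)
  obtain \<Sigma> where S: "face_system H \<Sigma>" and HE: "H \<subseteq> E" "cedges c \<subseteq> H" using H unfolding \<H>_def by blast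
  have "H = E"
  proof (rule ccontr)
    assume ne: "H \<noteq> E"
    have "c \<noteq> []" using c by (auto simp: cyc_def)
    then have "set c \<subseteq> \<Union> H" using cedges_Union[of c] Union_mono[OF HE(2)] by simp
    moreover obtain u v where "u \<in> set c" "v \<in> set c" "v \<noteq> u"
      using c by (cases c; cases "tl c") (auto simp: cyc_def)
    ultimately have uv: "u \<in> \<Union> H" "v \<in> \<Union> H" "v \<noteq> u" by auto
    obtain p a qs b where p: "p = a # qs @ [b]" "distinct p" "pedges p \<subseteq> E" "pedges p \<inter> H = {}"
      "a \<in> \<Union> H" "b \<in> \<Union> H" "set qs \<inter> \<Union> H = {}"
      by (rule ear_exists[OF con HE(1) ne uv])
    obtain \<Sigma>' where "face_system (H \<union> pedges p) \<Sigma>'" using face_system_ear[OF S HE(1) p] by blast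
    then have "H \<union> pedges p \<in> \<H>" unfolding \<H>_def using HE p(3) by blast
    then have "pedges p \<subseteq> H" using mx by blast
    then have "pedges p = {}" using p(4) by auto
    then show False using p(1) by (simp add: pedges_Cons)
  qed
  then show ?thesis using that S by blast
qed

end

section \<open>Reducible configurations\<close>

lemma IF_part_subset_edges: "IF_part E B F \<Longrightarrow> E' \<subseteq> E \<Longrightarrow> IF_part E' B F"
  unfolding IF_part_def acyclic_on_def cyc_def by blast

lemma cyc_chord:
  assumes "cyc E (a # xs @ b # ys)" "{a, b} \<in> E" "xs \<noteq> []"
  shows "cyc E (a # xs @ [b])"
proof -
  have "pedges (a # xs @ [b]) \<subseteq> E" using assms(1) by (auto simp: cyc_def cedges_append)
  moreover have "distinct (a # xs @ [b])" "3 \<le> length (a # xs @ [b])"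
    using assms by (cases xs; auto simp: cyc_def)+
  ultimately show ?thesis using assms(2) by (simp add: cyc_def cedges_def insert_commute)
qed

lemma cedges_hd_edge:
  assumes "distinct (v # p)" "2 \<le> length p" "{v, u} \<in> cedges (v # p)"
  shows "u = hd p \<or> u = last p"
proof -
  have "{v, u} \<in> {e \<in> cedges (v # p). v \<in> e}" using assms(3) by simp
  then have "{v, u} \<in> {{v, hd p}, {v, last p}}" unfolding cedges_at_hd(1)[OF assms(1,2)] .
  then show ?thesis by (auto simp: doubleton_eq_iff)
qed

text \<open>This covers all triangles of the graph, whether or not they bound a face. The three
  vertices are distinct because edges have two elements.\<close>

definition triE :: "'a set set \<Rightarrow> 'a \<Rightarrow> 'a \<Rightarrow> 'a \<Rightarrow> bool" where
  "triE E x y z \<longleftrightarrow> {x, y} \<in> E \<and> {y, z} \<in> E \<and> {x, z} \<in> E"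

text \<open>What remains of a minimal counterexample once the drawing is forgotten. The degree bound
  at \<open>v0\<close> is weaker because \<open>v0\<close> cannot be removed and recoloured: its
  side is prescribed.\<close>

locale critical_graph =
  fixes V :: "'a set" and E :: "'a set set" and v0 :: 'a and col :: bool
  assumes finite_V: "finite V" and two_sets_E: "two_sets E" and E_sub: "\<Union> E \<subseteq> V" and v0: "v0 \<in> V"
    and deg3: "\<And>v. v \<in> V \<Longrightarrow> v \<noteq> v0 \<Longrightarrow> 3 \<le> card (nbrs E v)" and deg2: "2 \<le> card (nbrs E v0)"
    and connected: "connected_on E V"
    and no567: "\<And>c. cyc E c \<Longrightarrow> length c \<notin> {5, 6, 7}"
    and tri_far: "\<And>x y z x' y' z' u v. triE E x y z \<Longrightarrow> triE E x' y' z' \<Longrightarrow> {x, y, z} \<noteq> {x', y', z'} \<Longrightarrow>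
      u \<in> {x, y, z} \<Longrightarrow> v \<in> {x', y', z'} \<Longrightarrow> u \<noteq> v \<and> {u, v} \<notin> E"
    and no_partition: "\<And>F. IF_part E V F \<Longrightarrow> (v0 \<in> F) \<noteq> col"
    and sub_partition: "\<And>W. W \<subset> V \<Longrightarrow> v0 \<in> W \<Longrightarrow> \<exists>F. IF_part E W F \<and> (v0 \<in> F) = col"
begin

lemma nbrs_sub: "nbrs E v \<subseteq> V"
  using E_sub by (auto simp: nbrs_def)

lemma finite_nbrs [simp]: "finite (nbrs E v)"
  using finite_subset[OF nbrs_sub finite_V] .

lemma no_loop [simp]: "{v} \<notin> E"
  using two_sets_irrefl[OF two_sets_E, of v v] by auto

lemma edge_neq: "{u, v} \<in> E \<Longrightarrow> u \<noteq> v"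
  using two_sets_irrefl[OF two_sets_E] .

lemma edge_in_V: "{u, v} \<in> E \<Longrightarrow> u \<in> V \<and> v \<in> V"
  using E_sub by auto

lemma edge_nbrs: "{u, v} \<in> E \<longleftrightarrow> v \<in> nbrs E u"
  by (simp add: nbrs_def)

lemma edge_nbrs': "{u, v} \<in> E \<longleftrightarrow> u \<in> nbrs E v"
  by (simp add: nbrs_def insert_commute)

text \<open>The vertices exempt from the degree conditions: the precoloured vertex and, if its degree
  is 2, its neighbours.  All other vertices have only neighbours of degree at least 3.\<close>

definition X :: "'a set" where
  "X = insert v0 (if card (nbrs E v0) = 2 then nbrs E v0 else {})"

definition light :: "'a \<Rightarrow> bool" where
  "light v \<longleftrightarrow> v \<in> V \<and> v \<notin> X \<and> card (nbrs E v) = 3"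

definition heavy4 :: "'a \<Rightarrow> bool" where
  "heavy4 v \<longleftrightarrow> v \<in> V \<and> v \<notin> X \<and> card (nbrs E v) = 4"

lemma light_neq: "light v \<Longrightarrow> v \<noteq> v0" "heavy4 v \<Longrightarrow> v \<noteq> v0" "light v \<Longrightarrow> v \<in> V" "heavy4 v \<Longrightarrow> v \<in> V"
  "light v \<Longrightarrow> card (nbrs E v) = 3" "heavy4 v \<Longrightarrow> card (nbrs E v) = 4"
  by (auto simp: light_def heavy4_def X_def)

lemma light_nbrs:
  assumes "light v" "{v, a} \<in> E" "{v, b} \<in> E" "{v, c} \<in> E" "a \<noteq> b" "a \<noteq> c" "b \<noteq> c"
  shows "nbrs E v = {a, b, c}"
proof -
  have "{a, b, c} \<subseteq> nbrs E v" using assms by (auto simp: nbrs_def)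
  moreover have "card {a, b, c} = card (nbrs E v)" using assms light_neq(5)[of v] by simp
  ultimately show ?thesis using card_subset_eq[of "nbrs E v" "{a, b, c}"] by simp
qed

text \<open>By minimality the graph without \<open>L\<close> has a partition with \<open>v0\<close>
  on the prescribed side, and as \<open>v0\<close> is outside \<open>L\<close> an extension keeps
  that side.\<close>

lemma reducible:
  assumes L: "L \<subseteq> V" "L \<noteq> {}" "v0 \<notin> L"
    and ext: "\<And>F. IF_part E (V - L) F \<Longrightarrow> \<exists>F'. IF_part E V F' \<and> F' \<inter> (V - L) = F"
  shows False
proof -
  have "V - L \<subset> V" "v0 \<in> V - L" using L v0 by auto
  then obtain F where F: "IF_part E (V - L) F" "(v0 \<in> F) = col" using sub_partition by metis
  then obtain F' where F': "IF_part E V F'" "F' \<inter> (V - L) = F" using ext by metis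
  then have "(v0 \<in> F') = col" using F(2) \<open>v0 \<in> V - L\<close> by auto
  then show False using no_partition[OF F'(1)] by simp
qed

text \<open>A chord splits the 8-cycle into cycles of lengths \<open>i + 2\<close> and
  \<open>j + 2\<close> with \<open>i + j = 6\<close>, that is 3 and 7, 4 and 6, or 5 and 5; one of
  the two is always forbidden.\<close>

lemma chordless8:
  assumes c: "cyc E c" "length c = 8" and uv: "u \<in> set c" "v \<in> set c" "{u, v} \<in> E"
  shows "{u, v} \<in> cedges c"
proof (rule ccontr)
  assume no: "{u, v} \<notin> cedges c"
  obtain n r where r: "rotate n c = u # r" using rotate_to_front[OF uv(1)] .
  have "v \<noteq> u" using edge_neq[OF uv(3)] by simp
  then have "v \<in> set r" using uv(2) r by (metis set_ConsD set_rotate)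
  then obtain xs ys where "r = xs @ v # ys" by (meson split_list)
  then have rc: "rotate n c = u # xs @ v # ys" using r by simp
  have cy: "cyc E (u # xs @ v # ys)" using c(1) rc cyc_rotate[of E n c] by simp
  have ce: "cedges (u # xs @ v # ys) = cedges c" using rc cedges_rotate[of n c] by simp
  have len: "length xs + length ys = 6" using c(2) rc length_rotate[of n c] by simp
  have "rotate (Suc (length xs)) (u # xs @ v # ys) = v # ys @ u # xs"
    using rotate_append[of "u # xs" "v # ys"] by (simp del: rotate_Suc)
  then have cy2: "cyc E (v # ys @ u # xs)" using cy cyc_rotate by metis
  have nx: "xs \<noteq> []" "ys \<noteq> []"
    using no unfolding ce[symmetric] by (auto simp: cedges_def insert_commute)
  have "length (u # xs @ [v]) \<notin> {5, 6, 7}" using no567[OF cyc_chord[OF cy uv(3) nx(1)]] .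
  moreover have "length (v # ys @ [u]) \<notin> {5, 6, 7}"
    using no567[OF cyc_chord[OF cy2 _ nx(2)]] uv(3) by (simp add: insert_commute)
  moreover define i j where "i = length xs" "j = length ys"
  ultimately have "i + 2 \<notin> {5, 6, 7}" "j + 2 \<notin> {5, 6, 7}" "i + j = 6" "i \<noteq> 0" "j \<noteq> 0"
    using len nx by simp_all
  then show False by (simp; presburger)
qed

text \<open>As the cycle has no chords, \<open>x\<close> on it would have to be the other cycle
  neighbour of both \<open>a\<close> and \<open>b\<close>. An edge from \<open>x\<close> to
  \<open>y\<close> leaves \<open>i + j = 5\<close> further vertices of \<open>r\<close> on the two
  sides of \<open>y\<close> and closes cycles of lengths \<open>i + 3\<close>, \<open>j + 3\<close>,
  \<open>i + 4\<close> and \<open>j + 4\<close>. One of them is forbidden unless \<open>i\<close> or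
  \<open>j\<close> is 0, and then a second triangle shares a vertex with the given one.\<close>

lemma apex8:
  assumes c: "cyc E (a # b # r)" "length r = 6" and T: "triE E a b x"
  shows "x \<notin> set (a # b # r)" "\<And>y. y \<in> set r \<Longrightarrow> {x, y} \<notin> E"
proof -
  have d: "distinct (a # b # r)" using c by (simp add: cyc_def)
  have e: "{a, x} \<in> E" "{b, x} \<in> E" "{a, b} \<in> E" using T by (auto simp: triE_def)
  show xn: "x \<notin> set (a # b # r)"
  proof
    assume x: "x \<in> set (a # b # r)"
    have at_a: "{e \<in> cedges (a # b # r). a \<in> e} = {{a, b}, {a, last r}}"
      using cedges_at_hd(1)[of a "b # r"] d c(2) by (auto split: if_splits)
    have "{a, x} \<in> {e \<in> cedges (a # b # r). a \<in> e}" using chordless8[OF c(1), of a x] e(1) x c(2) by simp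
    then have xl: "x = last r" using edge_neq[OF e(2)] unfolding at_a by (auto simp: doubleton_eq_iff)
    have rot: "rotate 1 (a # b # r) = b # r @ [a]" by simp
    have at_b: "{e \<in> cedges (b # r @ [a]). b \<in> e} = {{b, hd r}, {b, a}}"
    proof -
      have "r \<noteq> []" using c(2) by auto
      then have h: "hd (r @ [a]) = hd r" by (rule hd_append2)
      have D: "distinct (b # r @ [a])" "2 \<le> length (r @ [a])" using d c(2) by auto
      show ?thesis using cedges_at_hd(1)[OF D] unfolding h last_snoc .
    qed
    have "{b, x} \<in> {e \<in> cedges (b # r @ [a]). b \<in> e}"
      using chordless8[OF c(1), of b x] e(2) x c(2) cedges_rotate[of 1 "a # b # r"] rot by simp
    then have xh: "x = hd r" using edge_neq[OF e(1)] unfolding at_b by (auto simp: doubleton_eq_iff)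
    obtain r1 r' where r: "r = r1 # r'" using c(2) by (cases r) auto
    have "r' \<noteq> []" using c(2) r by auto
    then have "last r \<in> set r'" "hd r = r1" using r by simp_all
    then have "r1 \<in> set r'" using xl xh by metis
    then show False using d r by simp
  qed
  fix y assume y: "y \<in> set r"
  show "{x, y} \<notin> E"
  proof
    assume xy: "{x, y} \<in> E"
    obtain ys zs where r: "r = ys @ y # zs" using y by (meson split_list)
    have len: "length ys + length zs = 5" using c(2) r by simp
    have ce: "pedges (b # ys @ [y]) \<subseteq> E" "pedges (y # zs @ [a]) \<subseteq> E"
    proof -
      have "cedges (a # (b # ys) @ y # zs) = pedges (a # (b # ys) @ [y]) \<union> pedges (y # zs @ [a])"
        by (rule cedges_append)
      then have "pedges (a # b # ys @ [y]) \<subseteq> E" "pedges (y # zs @ [a]) \<subseteq> E"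
        using c(1) r by (auto simp: cyc_def)
      then show "pedges (b # ys @ [y]) \<subseteq> E" "pedges (y # zs @ [a]) \<subseteq> E" by auto
    qed
    have c1: "cyc E (x # b # ys @ [y])"
      using ce(1) e xy d xn r by (auto simp: cyc_def cedges_def insert_commute)
    have c2: "cyc E (x # y # zs @ [a])"
      using ce(2) e xy d xn r by (auto simp: cyc_def cedges_def insert_commute)
    have c3: "cyc E (x # a # b # ys @ [y])"
      using ce(1) e xy d xn r by (auto simp: cyc_def cedges_def insert_commute)
    have c4: "cyc E (x # y # zs @ [a, b])"
    proof -
      have "pedges (y # zs @ [a, b]) = insert {a, b} (pedges (y # zs @ [a]))"
        using pedges_snoc2[of "y # zs" a b] by simp
      then show ?thesis using ce(2) e xy d xn r by (auto simp: cyc_def cedges_def insert_commute)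
    qed
    have n0: "ys \<noteq> []"
    proof
      assume "ys = []"
      then have t: "triE E x b y" using ce(1) e xy by (auto simp: triE_def insert_commute)
      have "{a, b, x} \<noteq> {x, b, y}" using d r xn by auto
      then show False using tri_far[OF T t, of b b] by auto
    qed
    have n5: "zs \<noteq> []"
    proof
      assume "zs = []"
      then have t: "triE E x y a" using ce(2) e xy by (auto simp: triE_def insert_commute)
      have "{a, b, x} \<noteq> {x, y, a}" using d r xn by auto
      then show False using tri_far[OF T t, of a a] by auto
    qed
    define i j where "i = length ys" "j = length zs"
    then have "i + 3 \<notin> {5, 6, 7}" "j + 3 \<notin> {5, 6, 7}" "i + 4 \<notin> {5, 6, 7}" "j + 4 \<notin> {5, 6, 7}"
      "i + j = 5" "i \<noteq> 0" "j \<noteq> 0"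
      using no567[OF c1] no567[OF c2] no567[OF c3] no567[OF c4] len n0 n5 by simp_all
    then show False by (simp; presburger)
  qed
qed

text \<open>If \<open>x\<close> is off the cycle it is inserted between \<open>a\<close> and
  \<open>b\<close>, so that all three neighbours of \<open>a\<close> lie on the resulting cycle. As
  \<open>v0\<close> is not on it, connectivity provides a vertex with a neighbour off the cycle, and
  \<open>cycle_extension\<close> applies. The condition on \<open>{a, x}\<close> ensures that
  \<open>x\<close> is not the other neighbour of \<open>a\<close> along the cycle.\<close>

lemma light_cycle_triangle:
  assumes c: "cyc E (a # b # r)" and lt: "\<And>v. v \<in> set (a # b # r) \<Longrightarrow> light v"
    and T: "triE E a b x" and x: "light x" "{a, x} \<notin> cedges (a # b # r)"
  shows False
proof -
  have e: "{a, x} \<in> E" "{b, x} \<in> E" "{a, b} \<in> E" using T by (auto simp: triE_def)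
  obtain d where d: "cyc E d" "set d = insert x (set (a # b # r))"
  proof (cases "x \<in> set (a # b # r)")
    case True then show ?thesis using that[of "a # b # r"] c by auto
  next
    case False
    have "cyc E (a # x # b # r)" using c e False by (auto simp: cyc_def cedges_def insert_commute)
    then show ?thesis by (rule that) auto
  qed
  have lt': "light v" if "v \<in> set d" for v using that d(2) lt x by auto
  have rn: "r \<noteq> []" using c by (auto simp: cyc_def)
  have le: "{a, last r} \<in> cedges (a # b # r)" using rn by (auto simp: cedges_def insert_commute)
  then have "x \<noteq> last r" using x by auto
  moreover have "{a, last r} \<in> E" using c le by (auto simp: cyc_def)
  moreover have "last r \<noteq> b" using c rn by (auto simp: cyc_def)
  ultimately have "nbrs E a = {b, x, last r}"
    by (intro light_nbrs) (use lt e edge_neq[OF e(2)] in auto)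
  then have full: "a \<in> set d" "nbrs E a \<subseteq> set d" using d(2) rn by auto
  have dV: "set d \<subseteq> V" using lt' light_neq(3) by blast
  have v0d: "v0 \<notin> set d" using lt' light_neq(1) by blast
  obtain w w' where w: "w \<in> set d" "w' \<in> V - set d" "{w, w'} \<in> E"
    using connected dV v0d v0 full(1) unfolding connected_on_def by (metis empty_iff)
  then have nonfull: "\<not> nbrs E w \<subseteq> set d" by (auto simp: nbrs_def)
  show False
  proof (rule reducible[OF dV _ v0d])
    show "set d \<noteq> {}" using full by auto
    fix F assume F: "IF_part E (V - set d) F"
    have "\<exists>F'. extends E (V - set d) F ((V - set d) \<union> set d) F'"
    proof (rule cycle_extension[OF two_sets_E _ F d(1) _ _ full w(1) nonfull])
      show "nbrs E v \<subseteq> (V - set d) \<union> set d \<and> card (nbrs E v) \<le> 3" if "v \<in> set d" for v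
        using nbrs_sub[of v] light_neq(5)[OF lt'[OF that]] by auto
    qed auto
    then show "\<exists>F'. IF_part E V F' \<and> F' \<inter> (V - set d) = F"
      using dV by (auto simp: extends_def Un_absorb2)
  qed
qed

section \<open>Reductions around a 4-vertex, with deleted and restored edges\<close>

lemma IF_part_delete_edge:
  assumes "IF_part (E - {{a, b}}) B F" "a \<noteq> b" "a \<in> F \<or> b \<in> F"
    and "a \<in> F \<Longrightarrow> b \<in> F \<Longrightarrow> \<not> conn (E - {{a, b}}) F a b"
  shows "IF_part E B F"
proof -
  have "acyclic_on E F" using acyclic_add_edge[of E a b F] assms unfolding IF_part_def by blast
  moreover have "{x, y} \<notin> E" if "x \<in> B - F" "y \<in> B - F" for x y
  proof -
    have "{x, y} \<noteq> {a, b}" using that assms(3) by (auto simp: doubleton_eq_iff)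
    then show ?thesis using assms(1) that unfolding IF_part_def by blast
  qed
  ultimately show ?thesis using assms(1) by (simp add: IF_part_def)
qed

lemma two_sets_delete: "two_sets (E - D)"
  using two_sets_E by (auto simp: two_sets_def)

lemma nbrs_delete: "nbrs (E - D) v \<subseteq> nbrs E v"
  by (auto simp: nbrs_def)

lemma finite_nbrs_delete: "finite (nbrs (E - D) v)"
  using finite_subset[OF nbrs_delete finite_nbrs] .

lemma card_nbrs_delete: "card (nbrs (E - D) v) \<le> card (nbrs E v)"
  using card_mono[OF finite_nbrs nbrs_delete] .

text \<open>Outside the configuration, \<open>w\<close> has exactly one neighbour \<open>b\<close>
  and \<open>r\<close> exactly one neighbour \<open>r'\<close>. The four combinations of their sides
  are treated separately; in each, one of \<open>w\<close>, \<open>r\<close>, \<open>s\<close> is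
  fixed early so that the last vertices still have a legal side. The all-light triangle at
  \<open>{p, q}\<close> supplies the freedom when \<open>b\<close> is independent and
  \<open>r'\<close> belongs to the forest.\<close>

lemma heavy_triangle_reduction:
  assumes c: "cyc E (w # s # m)" "length m = 6" and w: "heavy4 w"
    and lt: "\<And>v. v \<in> set (s # m) \<Longrightarrow> light v"
    and T': "triE E w s r" "light r"
    and T: "s # m = us @ p # q # vs" "triE E p q x" "light x"
  shows False
proof -
  let ?c = "w # s # m"
  define a where "a = last m"
  have mn: "m \<noteq> []" using c(2) by auto
  have d: "distinct ?c" using c by (simp add: cyc_def)
  have am: "a \<in> set m" using mn by (simp add: a_def)
  have e: "{w, r} \<in> E" "{s, r} \<in> E" "{w, s} \<in> E" using T' by (auto simp: triE_def)
  have ce: "pedges (w # s # m) \<subseteq> E" "{w, a} \<in> E"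
    using c(1) mn by (auto simp: cyc_def cedges_def a_def insert_commute)
  have ce': "pedges m \<subseteq> E" "{s, hd m} \<in> E" using ce mn by (auto simp: pedges_Cons)
  have rn: "r \<notin> set ?c" "\<And>y. y \<in> set m \<Longrightarrow> {r, y} \<notin> E" using apex8[OF c T'(1)] by blast+
  have rot: "rotate (Suc (length us)) ?c = p # q # vs @ w # us"
    using rotate_append[of "w # us" "p # q # vs"] T(1) by (simp del: rotate_Suc)
  have cp: "cyc E (p # q # vs @ w # us)" using c(1) rot cyc_rotate by metis
  have lp: "length (vs @ w # us) = 6"
    using arg_cong[OF T(1), of length] c(2) by simp
  have scp: "set ?c = set (p # q # vs @ w # us)" using rot by (metis set_rotate)
  have xn: "x \<notin> set ?c" "\<And>y. y \<in> set (vs @ w # us) \<Longrightarrow> {x, y} \<notin> E" using apex8[OF cp lp T(2)] scp by auto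
  have pqm: "p \<in> set (s # m)" "q \<in> set (s # m)" using T(1) by auto
  have xw: "{x, w} \<notin> E" using xn by simp
  have "w \<notin> {p, q, x}" using d pqm xn by auto
  then have "{w, s, r} \<noteq> {p, q, x}" by blast
  note far = tri_far[OF T'(1) T(2) this]
  have rx: "r \<noteq> x" "{r, x} \<notin> E" "{s, x} \<notin> E" using far[of r x] far[of s x] by auto
  have sn: "nbrs E s = {w, r, hd m}"
    by (rule light_nbrs) (use lt e ce' rn d mn in \<open>auto simp: insert_commute\<close>)
  have lv: "light s" using lt by simp
  obtain b where b: "nbrs E w = {s, a, r, b}" "b \<notin> {s, a, r}"
  proof -
    have sub: "{s, a, r} \<subseteq> nbrs E w" using ce e by (auto simp: nbrs_def)
    have "s \<noteq> a" "s \<noteq> r" "a \<noteq> r" using d am rn by auto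
    then have c3: "card {s, a, r} = 3" by simp
    have "card (nbrs E w - {s, a, r}) = 1" using card_Diff_subset[OF _ sub] c3 light_neq(6)[OF w] by simp
    then obtain b where "nbrs E w - {s, a, r} = {b}" by (auto simp: card_1_singleton_iff)
    then show ?thesis using that[of b] sub by auto
  qed
  obtain r' where r': "nbrs E r = {w, s, r'}" "r' \<notin> {w, s}"
  proof -
    have sub: "{w, s} \<subseteq> nbrs E r" using e by (auto simp: nbrs_def insert_commute)
    have c2: "card {w, s} = 2" using d by auto
    have "card (nbrs E r - {w, s}) = 1" using card_Diff_subset[OF _ sub] c2 light_neq(5)[OF T'(2)] by simp
    then obtain b where "nbrs E r - {w, s} = {b}" by (auto simp: card_1_singleton_iff)
    then show ?thesis using that[of b] sub by auto
  qed
  have bE: "{w, b} \<in> E" "{r, r'} \<in> E" using b r' by (auto simp: edge_nbrs)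
  have bn: "b \<notin> set ?c" "b \<noteq> x"
  proof -
    show "b \<noteq> x" using bE xw by (auto simp: insert_commute)
    show "b \<notin> set ?c"
    proof
      assume "b \<in> set ?c"
      then have "{w, b} \<in> cedges ?c" using chordless8[OF c(1), of w b] bE(1) c(2) by simp
      then have "b = s \<or> b = a" using cedges_hd_edge[OF d] c(2) mn by (simp add: a_def)
      then show False using b(2) by simp
    qed
  qed
  have rn': "r' \<notin> set ?c" "r' \<noteq> x" "r' \<noteq> r" using rn(2) r' bE rx edge_neq[OF bE(2)] by auto
  let ?K = "insert r (insert x (set ?c))"
  have KV: "?K \<subseteq> V" using lt w T' T light_neq by auto
  have K0: "v0 \<notin> ?K" using lt w T' T light_neq by auto
  have bV: "b \<in> V - ?K" "r' \<in> V - ?K" using edge_in_V bE bn rn' b(2) by auto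
  show False
  proof (rule reducible[OF KV _ K0])
    fix F assume F: "IF_part E (V - ?K) F"
    show "\<exists>F'. IF_part E V F' \<and> F' \<inter> (V - ?K) = F"
    proof (cases "b \<notin> F \<and> r' \<in> F")
      \<comment> \<open>Here \<open>r\<close> is made independent and the edge \<open>{w, r}\<close>
        is deleted, after which \<open>w\<close> has degree 3. The cycle with \<open>x\<close>
        inserted is closed up by \<open>cycle_extension\<close>: \<open>p\<close> has all its
        neighbours on it, and \<open>s\<close> has the coloured neighbour \<open>r\<close>.\<close>
      case True
      have "extends E (V - ?K) F (insert r (V - ?K)) F"
        by (rule extend_I[OF two_sets_E F]) (use r' True d lv in auto)
      then have F1: "IF_part E (insert r (V - ?K)) F" by (simp add: extends_def)
      let ?E = "E - {{w, r}}"
      have F1': "IF_part ?E (insert r (V - ?K)) F" using IF_part_subset_edges[OF F1] by auto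
      have wr: "w \<noteq> r" using rn by auto
      have cE: "cyc ?E (p # x # q # vs @ w # us)"
      proof -
        have "cyc E (p # x # q # vs @ w # us)" using cp T(2) xn scp by (auto simp: cyc_def cedges_def triE_def insert_commute)
        moreover have "{w, r} \<notin> cedges (p # x # q # vs @ w # us)"
        proof
          assume "{w, r} \<in> cedges (p # x # q # vs @ w # us)"
          then have "r \<in> set (p # x # q # vs @ w # us)" using cedges_Union[of "p # x # q # vs @ w # us"] by blast
          then show False using rn scp rx by auto
        qed
        ultimately show ?thesis by (auto simp: cyc_def)
      qed
      have sd: "set (p # x # q # vs @ w # us) = insert x (set ?c)" using scp by auto
      have "\<exists>F'. extends ?E (insert r (V - ?K)) F (insert r (V - ?K) \<union> set (p # x # q # vs @ w # us)) F'"
      proof (rule cycle_extension[OF two_sets_delete finite_nbrs_delete F1' cE])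
        show "set (p # x # q # vs @ w # us) \<inter> insert r (V - ?K) = {}" unfolding sd using rn rx by auto
        show "nbrs ?E v \<subseteq> insert r (V - ?K) \<union> set (p # x # q # vs @ w # us) \<and> card (nbrs ?E v) \<le> 3"
          if v: "v \<in> set (p # x # q # vs @ w # us)" for v
        proof
          have "nbrs ?E v \<subseteq> V" using nbrs_sub[of v] by (auto simp: nbrs_def)
          then show "nbrs ?E v \<subseteq> insert r (V - ?K) \<union> set (p # x # q # vs @ w # us)" unfolding sd by auto
          show "card (nbrs ?E v) \<le> 3"
          proof (cases "v = w")
            case True
            have "nbrs ?E w = nbrs E w - {r}" by (auto simp: nbrs_def doubleton_eq_iff)
            then show ?thesis using True light_neq(6)[OF w] b(1) by simp
          next
            case False
            then have "light v" using v sd lt T by auto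
            then show ?thesis using card_nbrs_delete[of "{{w, r}}" v] light_neq(5)[of v] by simp
          qed
        qed
        show "p \<in> set (p # x # q # vs @ w # us)" by simp
        let ?l = "last (vs @ w # us)"
        have "nbrs E p = {x, q, ?l}"
        proof (rule light_nbrs)
          show "light p" using pqm lt by auto
          show "{p, x} \<in> E" "{p, q} \<in> E" using T(2) by (auto simp: triE_def)
          show "{p, ?l} \<in> E" using cp by (auto simp: cyc_def cedges_def insert_commute)
          show "x \<noteq> q" using xn scp by auto
          show "x \<noteq> ?l" using xn scp by (metis last_in_set list.set_intros(2) append_is_Nil_conv list.distinct(1))
          show "q \<noteq> ?l" using cp unfolding cyc_def by (metis distinct.simps(2) last_in_set append_is_Nil_conv list.distinct(1))
        qed
        moreover have "?l \<in> set (vs @ w # us)" by (rule last_in_set) simp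
        ultimately show "nbrs ?E p \<subseteq> set (p # x # q # vs @ w # us)" by (auto simp: nbrs_def)
        show "s \<in> set (p # x # q # vs @ w # us)" unfolding sd by simp
        have "r \<in> nbrs ?E s" using e d by (auto simp: nbrs_def doubleton_eq_iff)
        then show "\<not> nbrs ?E s \<subseteq> set (p # x # q # vs @ w # us)" unfolding sd using rn rx by auto
      qed
      then obtain F' where F': "extends ?E (insert r (V - ?K)) F (insert r (V - ?K) \<union> insert x (set ?c)) F'"
        unfolding sd by blast
      have VV: "insert r (V - ?K) \<union> insert x (set ?c) = V" using KV by auto
      have IF': "IF_part ?E V F'" and FF: "F' \<inter> insert r (V - ?K) = F" using F' unfolding VV extends_def by auto
      have "r \<notin> F" using F by (auto simp: IF_part_def)
      then have rF: "r \<notin> F'" using FF by auto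
      have "b \<notin> F'" using FF True bV by auto
      moreover have "{w, b} \<in> ?E" using bE b(2) by (auto simp: doubleton_eq_iff)
      \<comment> \<open>The independent neighbour \<open>b\<close> forces \<open>w\<close> into the
        forest, so the deleted edge has exactly one independent end and can be restored.\<close>
      ultimately have "w \<in> F'" using IF' KV bV unfolding IF_part_def by (metis DiffD1 DiffI insert_subset list.set_intros(1) subsetD)
      then have "IF_part E V F'" using IF_part_delete_edge[OF IF' wr] rF by blast
      moreover have "F' \<inter> (V - ?K) = F" using FF \<open>r \<notin> F'\<close> by auto
      ultimately show ?thesis by blast
    next
      case nC: False
      have xt: "nbrs E x \<inter> (V - ?K) \<subseteq> nbrs E x - {p, q}" using pqm by auto
      have "{p, q} \<subseteq> nbrs E x" using T(2) by (auto simp: triE_def nbrs_def insert_commute)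
      moreover have "p \<noteq> q" using cp by (auto simp: cyc_def)
      ultimately have "card (nbrs E x - {p, q}) = 1"
        using light_neq(5)[OF T(3)] by (subst card_Diff_subset) auto
      then have "card (nbrs E x \<inter> (V - ?K)) \<le> 2" using card_mono[OF _ xt] by simp
      then obtain F1 where F1: "extends E (V - ?K) F (insert x (V - ?K)) F1"
        using greedy_step[OF two_sets_E F, of x] by auto
      define B1 where "B1 = insert x (V - ?K)"
      have B1: "B1 \<inter> insert r (set ?c) = {}" "B1 \<union> insert r (set ?c) = V" "b \<in> B1" "r' \<in> B1"
        using xn rx bV KV unfolding B1_def by auto
      have I1: "IF_part E B1 F1" and F1b: "F1 \<inter> (V - ?K) = F" "F1 \<subseteq> B1"
        using F1 unfolding extends_def B1_def IF_part_def by auto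
      have br: "b \<in> F1 \<longleftrightarrow> b \<in> F" "r' \<in> F1 \<longleftrightarrow> r' \<in> F" using F1b bV by auto
      have fin: ?thesis if "extends E B1 F1 V F'" for F'
        using that F1 extends_trans unfolding B1_def extends_def by blast
      have lt3: "card (nbrs E u) \<le> 3" if "u \<in> set (s # m)" for u using lt[OF that] light_neq(5) by simp
      have walk1: "pedges (rev (s # m) @ [r]) \<subseteq> E"
      proof -
        have "pedges (rev (s # m) @ [r]) = pedges (r # s # m)" using pedges_rev[of "r # s # m"] by simp
        then show ?thesis using ce e by (auto simp: insert_commute)
      qed
      have walk2: "pedges (m @ [w]) \<subseteq> E"
        using ce' ce mn by (auto simp: pedges_snoc a_def insert_commute)
      consider (1) "b \<in> F" "r' \<notin> F" | (2) "b \<in> F" "r' \<in> F" | (3) "b \<notin> F" "r' \<notin> F" using nC by blast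
      then show ?thesis
      proof cases
        \<comment> \<open>With \<open>w\<close> independent, the walk from the far end of
          \<open>m\<close> back to \<open>s\<close> leaves \<open>r\<close> for last, and only
          \<open>s\<close> among the neighbours of \<open>r\<close> can be in the forest.\<close>
        case 1
        have e2: "extends E B1 F1 (insert w B1) F1"
          by (rule extend_I[OF two_sets_E I1]) (use B1 b br 1 am in auto)
        then have "\<exists>F'. extends E (insert w B1) F1 (insert w B1 \<union> set (rev (s # m))) F'"
          by (intro greedy_walk[OF two_sets_E _ _ walk1]) (use lt3 B1 d rn in \<open>auto simp: extends_def\<close>)
        then obtain F3 where e3: "extends E (insert w B1) F1 (insert w B1 \<union> set (s # m)) F3" by auto
        have wF: "w \<notin> F1" using F1b B1 by auto
        have "w \<notin> F3" "r' \<notin> F3" using e3 wF br 1 B1 by (auto simp: extends_def)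
        then have "nbrs E r \<inter> F3 \<subseteq> {s}" using r' by auto
        then have "card (nbrs E r \<inter> F3) \<le> 1" using card_mono[of "{s}"] by fastforce
        then have "extends E (insert w B1 \<union> set (s # m)) F3 (insert r (insert w B1 \<union> set (s # m))) (insert r F3)"
          by (intro extend_F) (use e3 rn B1 in \<open>auto simp: extends_def\<close>)
        moreover have "insert r (insert w B1 \<union> set (s # m)) = V" using B1 by auto
        ultimately show ?thesis using fin e2 e3 extends_trans by metis
      next
        \<comment> \<open>Starting \<open>s\<close> as a new component keeps it apart from
          \<open>b\<close> and \<open>r'\<close> throughout. The side of \<open>a\<close> then
          decides which of \<open>w\<close> and \<open>r\<close> is independent; the other one joins
          \<open>s\<close> to a component known to be different.\<close>
        case 2
        have ns: "nbrs E s \<inter> B1 = {}" using sn B1 mn by auto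
        then have nsF: "nbrs E s \<inter> F1 = {}" using F1b by auto
        have e2: "extends E B1 F1 (insert s B1) (insert s F1)"
          by (rule extend_F[OF I1]) (use B1 nsF in auto)
        then have "\<exists>F'. extends E (insert s B1) (insert s F1) (insert s B1 \<union> set m) F'"
          by (intro greedy_walk[OF two_sets_E _ _ walk2]) (use lt3 B1 d in \<open>auto simp: extends_def\<close>)
        then obtain F3 where e3: "extends E (insert s B1) (insert s F1) (insert s B1 \<union> set m) F3" by auto
        define B3 where "B3 = insert s B1 \<union> set m"
        have I3: "IF_part E B3 F3" using e3 by (simp add: extends_def B3_def)
        have in3: "s \<in> F3" "b \<in> F3" "r' \<in> F3" using e3 br 2 by (auto simp: extends_def)
        have nc: "\<not> conn E F3 s z" "\<not> conn E F3 z s" if "z \<in> F1" for z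
        proof -
          have "z \<noteq> s" using that F1b B1 by auto
          moreover have "conn E F3 z s \<Longrightarrow> conn E (insert s F1) z s" using e3 that by (auto simp: extends_def)
          ultimately show "\<not> conn E F3 z s" using not_conn_isolated[of E s F1 z] nsF by auto
          then show "\<not> conn E F3 s z" using conn_sym by metis
        qed
        have B3n: "w \<notin> B3" "r \<notin> B3" "insert r (insert w B3) = V" "insert w (insert r B3) = V"
          using B1 d rn unfolding B3_def by auto
        have fin3: ?thesis if "IF_part E V F'" "F' \<inter> B3 = F3" for F'
        proof -
          have "F' \<inter> (V - ?K) = F"
            using that(2) e3 e2 F1b(1) unfolding extends_def B3_def B1_def by blast
          then show ?thesis using that(1) by blast
        qed
        show ?thesis
        proof (cases "a \<in> F3")
          case True
          have "extends E B3 F3 (insert w B3) F3"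
            by (rule extend_I[OF two_sets_E I3 B3n(1)]) (use b in3 True B3n in auto)
          then have I4: "IF_part E (insert w B3) F3" by (simp add: extends_def)
          have wF: "w \<notin> F3" "r \<notin> F3" using I3 B3n by (auto simp: IF_part_def)
          have "IF_part E (insert r (insert w B3)) (insert r F3)"
          proof (rule IF_part_insert_F[OF I4])
            show "r \<notin> insert w B3" using B3n rn by auto
            have N: "nbrs E r \<inter> F3 = {s, r'}" using r' wF in3 by auto
            show "\<not> conn E F3 y z" if "y \<in> nbrs E r \<inter> F3" "z \<in> nbrs E r \<inter> F3" "y \<noteq> z" for y z
              using that nc[of r'] br 2 unfolding N by auto
          qed
          moreover have "insert r F3 \<inter> B3 = F3" using I3 B3n by (auto simp: IF_part_def)
          ultimately show ?thesis using fin3 B3n by metis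
        next
          case False
          have "extends E B3 F3 (insert r B3) F3"
            by (rule extend_I[OF two_sets_E I3 B3n(2)]) (use r' in3 B3n in auto)
          then have I4: "IF_part E (insert r B3) F3" by (simp add: extends_def)
          have wF: "w \<notin> F3" "r \<notin> F3" using I3 B3n by (auto simp: IF_part_def)
          have "IF_part E (insert w (insert r B3)) (insert w F3)"
          proof (rule IF_part_insert_F[OF I4])
            show "w \<notin> insert r B3" using B3n rn by auto
            have N: "nbrs E w \<inter> F3 = {s, b}" using b wF in3 False by auto
            show "\<not> conn E F3 y z" if "y \<in> nbrs E w \<inter> F3" "z \<in> nbrs E w \<inter> F3" "y \<noteq> z" for y z
              using that nc[of b] br 2 unfolding N by auto
          qed
          moreover have "insert w F3 \<inter> B3 = F3" using I3 B3n by (auto simp: IF_part_def)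
          ultimately show ?thesis using fin3 B3n by metis
        qed
      next
        \<comment> \<open>Making \<open>s\<close> independent leaves \<open>w\<close> with at most
          the forest neighbour \<open>a\<close>, and then \<open>r\<close> with at most
          \<open>w\<close>.\<close>
        case 3
        have ns: "nbrs E s \<inter> B1 = {}" using sn B1 mn by auto
        have e2: "extends E B1 F1 (insert s B1) F1"
          by (rule extend_I[OF two_sets_E I1]) (use B1 ns in auto)
        then have "\<exists>F'. extends E (insert s B1) F1 (insert s B1 \<union> set m) F'"
          by (intro greedy_walk[OF two_sets_E _ _ walk2]) (use lt3 B1 d in \<open>auto simp: extends_def\<close>)
        then obtain F3 where e3: "extends E (insert s B1) F1 (insert s B1 \<union> set m) F3" by auto
        have sF: "s \<notin> F1" using F1b B1 by auto
        have n3: "s \<notin> F3" "b \<notin> F3" "r' \<notin> F3" using e3 br 3 sF B1 by (auto simp: extends_def)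
        have F3B: "F3 \<subseteq> insert s B1 \<union> set m" using e3 by (auto simp: extends_def IF_part_def)
        then have rF3: "r \<notin> F3" using B1 rn by auto
        have "nbrs E w \<inter> F3 \<subseteq> {a}" using b n3 rF3 by auto
        then have "card (nbrs E w \<inter> F3) \<le> 1" using card_mono[of "{a}"] by fastforce
        then have e4: "extends E (insert s B1 \<union> set m) F3 (insert w (insert s B1 \<union> set m)) (insert w F3)"
          by (intro extend_F) (use e3 d B1 in \<open>auto simp: extends_def\<close>)
        have "nbrs E r \<inter> insert w F3 \<subseteq> {w}" using r' n3 by auto
        then have "card (nbrs E r \<inter> insert w F3) \<le> 1" using card_mono[of "{w}"] by fastforce
        then have "extends E (insert w (insert s B1 \<union> set m)) (insert w F3)
            (insert r (insert w (insert s B1 \<union> set m))) (insert r (insert w F3))"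
          by (intro extend_F) (use e4 rn B1 in \<open>auto simp: extends_def\<close>)
        moreover have "insert r (insert w (insert s B1 \<union> set m)) = V" using B1 by auto
        ultimately show ?thesis using fin e2 e3 e4 extends_trans by metis
      qed
    qed
  qed auto
qed

text \<open>The cycles share the edge \<open>{w, c7}\<close>; deleting it gives \<open>w\<close>
  degree 3 and leaves \<open>c7\<close> without coloured neighbours. One walk then traverses both
  cycles, from \<open>x\<close> over \<open>c3\<close> to \<open>c6\<close>, through
  \<open>x'\<close> backwards along the second cycle to \<open>u\<close> and \<open>w\<close>, and
  it ends at \<open>c1\<close>, where the early coloured \<open>c2\<close> and the outside vertex
  \<open>y\<close> allow it to close up. The two cycles may overlap elsewhere, as long as
  \<open>c1\<close>, \<open>c2\<close> and \<open>y\<close> are off the second one.\<close>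

lemma opposite_face_reduction:
  assumes c: "cyc E [w, c1, c2, c3, c4, c5, c6, c7]" and w: "heavy4 w"
    and lt: "\<And>v. v \<in> {c1, c2, c3, c4, c5, c6, c7} \<Longrightarrow> light v"
    and Q: "{c1, y} \<in> E" "{y, z} \<in> E" "{z, w} \<in> E" "y \<noteq> w" "z \<notin> {c1, c7, u}"
    and T: "triE E c2 c3 x" "light x" and T': "triE E c6 c7 x'"
    and d: "cyc E [c7, w, u, d3, d4, d5, d6, x']"
    and ltd: "\<And>v. v \<in> {u, d3, d4, d5, d6, x'} \<Longrightarrow> light v"
    and nd: "c1 \<notin> set [c7, w, u, d3, d4, d5, d6, x']" "c2 \<notin> set [c7, w, u, d3, d4, d5, d6, x']"
      "y \<notin> set [c7, w, u, d3, d4, d5, d6, x']"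
  shows False
proof -
  let ?c = "[w, c1, c2, c3, c4, c5, c6, c7]" and ?d = "[c7, w, u, d3, d4, d5, d6, x']"
  have dc: "distinct ?c" "distinct ?d" using c d by (simp_all add: cyc_def)
  have ec: "{w, c1} \<in> E" "{c1, c2} \<in> E" "{c2, c3} \<in> E" "{c3, c4} \<in> E" "{c4, c5} \<in> E" "{c5, c6} \<in> E"
    "{c6, c7} \<in> E" "{c7, w} \<in> E" using c by (auto simp: cyc_def cedges_def)
  have ed: "{w, u} \<in> E" "{u, d3} \<in> E" "{d3, d4} \<in> E" "{d4, d5} \<in> E" "{d5, d6} \<in> E" "{d6, x'} \<in> E"
    "{x', c7} \<in> E" using d by (auto simp: cyc_def cedges_def)
  have eT: "{c2, x} \<in> E" "{c3, x} \<in> E" "{c6, x'} \<in> E" "{c7, x'} \<in> E" using T T' by (auto simp: triE_def)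
  have r2: "cyc E [c2, c3, c4, c5, c6, c7, w, c1]" using cyc_rotate[of E 2 ?c] c by (simp add: numeral_2_eq_2)
  have r6: "cyc E [c6, c7, w, c1, c2, c3, c4, c5]" using cyc_rotate[of E 6 ?c] c by (simp add: eval_nat_numeral)
  have xn: "x \<notin> set ?c" "\<And>y. y \<in> {c4, c5, c6, c7, w, c1} \<Longrightarrow> {x, y} \<notin> E"
    using apex8[OF r2 _ T(1)] by auto
  have x'n: "x' \<notin> set ?c" using apex8[OF r6 _ T'(1)] by auto
  have n7: "nbrs E c7 = {c6, w, x'}"
    by (rule light_nbrs) (use lt ec eT dc x'n in \<open>auto simp: insert_commute\<close>)
  have n2: "nbrs E c2 = {c1, c3, x}"
    by (rule light_nbrs) (use lt ec eT dc xn in \<open>auto simp: insert_commute\<close>)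
  have u1: "u \<noteq> c1" using nd by auto
  have zw: "z \<noteq> w" "y \<noteq> z" "y \<noteq> c1" using edge_neq[OF Q(3)] edge_neq[OF Q(2)] edge_neq[OF Q(1)] by auto
  have nw: "nbrs E w = {c1, c7, z, u}"
  proof -
    have "{c1, c7, z, u} \<subseteq> nbrs E w" using ec ed Q by (auto simp: nbrs_def insert_commute)
    moreover have "card {c1, c7, z, u} = 4" using dc Q u1 by auto
    ultimately show ?thesis using card_subset_eq[of "nbrs E w" "{c1, c7, z, u}"] light_neq(6)[OF w] by simp
  qed
  have zn: "z \<notin> set ?c" "z \<notin> set ?d" "z \<noteq> x"
  proof -
    show "z \<noteq> x" using xn(2)[of w] Q by auto
    show "z \<notin> set ?c"
    proof
      assume "z \<in> set ?c"
      then have "{w, z} \<in> cedges ?c" using chordless8[OF c, of w z] Q by (simp add: insert_commute)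
      then have "z = c1 \<or> z = c7" using cedges_hd_edge[OF dc(1), of z] by simp
      then show False using Q by simp
    qed
    show "z \<notin> set ?d"
    proof
      assume z: "z \<in> set ?d"
      have "cyc E [w, u, d3, d4, d5, d6, x', c7]" using cyc_rotate[of E 1 ?d] d by simp
      then have "{w, z} \<in> cedges [w, u, d3, d4, d5, d6, x', c7]"
        using chordless8[of "[w, u, d3, d4, d5, d6, x', c7]" w z] Q z by (auto simp add: insert_commute)
      moreover have "distinct [w, u, d3, d4, d5, d6, x', c7]" using dc by auto
      ultimately show False using cedges_hd_edge[of w "[u, d3, d4, d5, d6, x', c7]" z] Q by simp
    qed
  qed
  have yn: "y \<notin> set ?c" "y \<noteq> x"
  proof -
    show "y \<noteq> x" using xn(2)[of c1] Q by (auto simp: insert_commute)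
    have r1: "cyc E [c1, c2, c3, c4, c5, c6, c7, w]" using cyc_rotate[of E 1 ?c] c by simp
    show "y \<notin> set ?c"
    proof
      assume y: "y \<in> set ?c"
      then have "{c1, y} \<in> cedges [c1, c2, c3, c4, c5, c6, c7, w]"
        using chordless8[OF r1, of c1 y] Q by auto
      moreover have "distinct [c1, c2, c3, c4, c5, c6, c7, w]" using dc by auto
      ultimately have "y = c2" using cedges_hd_edge[of c1 "[c2, c3, c4, c5, c6, c7, w]" y] Q by simp
      then have "z \<in> {c1, c3, x}" using n2 Q by (auto simp: edge_nbrs)
      then show False using zn by auto
    qed
  qed
  let ?L = "insert x (set ?c \<union> set ?d)"
  have LV: "?L \<subseteq> V" using lt ltd w T(2) light_neq by auto
  have L0: "v0 \<notin> ?L" using lt ltd w T(2) light_neq by auto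
  have zV: "z \<in> V - ?L" "y \<in> V - ?L" using edge_in_V[OF Q(2)] zn yn nd by auto
  let ?E = "E - {{w, c7}}"
  show False
  proof (rule reducible[OF LV _ L0])
    fix F assume "IF_part E (V - ?L) F"
    then have F: "IF_part ?E (V - ?L) F" using IF_part_subset_edges by blast
    have n7E: "nbrs ?E c7 \<inter> (V - ?L) = {}" using n7 by (auto simp: nbrs_def)
    have FB: "F \<subseteq> V - ?L" using F by (auto simp: IF_part_def)
    \<comment> \<open>The vertex \<open>c7\<close> copies the side of \<open>z\<close>. If
      \<open>z\<close> is independent, \<open>w\<close> is forced into the forest; if both are in
      the forest, \<open>c7\<close> starts as a component of its own. Either way the edge
      \<open>{w, c7}\<close> can be restored.\<close>
    define F1 where "F1 = (if z \<in> F then insert c7 F else F)"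
    have F1: "extends ?E (V - ?L) F (insert c7 (V - ?L)) F1"
    proof (cases "z \<in> F")
      case True
      have "nbrs ?E c7 \<inter> F = {}" using n7E FB by blast
      then show ?thesis using extend_F[OF F _ finite_nbrs_delete, of c7] True by (simp add: F1_def)
    next
      case False
      then show ?thesis using extend_I[OF two_sets_delete F, of c7] n7E by (simp add: F1_def)
    qed
    let ?B1 = "insert c7 (V - ?L)"
    let ?us = "[x, c3, c4, c5, c6, x', d6, d5, d4, d3, u, w]"
    have I1: "IF_part ?E ?B1 F1" using F1 by (simp add: extends_def)
    have "\<exists>F'. extends ?E ?B1 F1 (insert c1 (insert c2 ?B1 \<union> set ?us)) F'"
    proof (rule walk_extension[OF two_sets_delete finite_nbrs_delete I1, of c2 ?us c1 y])
      show "c2 \<notin> ?B1" using dc by auto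
      have "c1 \<notin> ?B1" "c3 \<notin> ?B1" "x \<notin> ?B1" using dc(1) xn(1) by auto
      moreover have "nbrs ?E c2 \<subseteq> {c1, c3, x}" using nbrs_delete[of "{{w, c7}}" c2] unfolding n2 .
      ultimately show "nbrs ?E c2 \<inter> ?B1 = {}" by blast
      have c7n: "c7 \<notin> set (?us @ [c1])" using dc xn by auto
      have "pedges (?us @ [c1]) \<subseteq> E" using ec ed eT by (auto simp: insert_commute)
      moreover have "{w, c7} \<notin> pedges (?us @ [c1])" using pedges_vertices[of "?us @ [c1]"] c7n by blast
      ultimately show "pedges (?us @ [c1]) \<subseteq> ?E" by blast
      have "set ?us \<subseteq> ?L" by auto
      moreover have "c7 \<notin> set ?us" using c7n by simp
      ultimately show "set ?us \<inter> ?B1 = {}" by blast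
      show "c2 \<notin> set ?us" using dc xn nd by auto
      show "c1 \<notin> set ?us" using dc xn nd by auto
      show "c1 \<notin> ?B1" "c2 \<noteq> c1" using dc by auto
      have l3: "card (nbrs ?E v) \<le> 3" if "light v" for v
        using card_nbrs_delete[of "{{w, c7}}" v] light_neq(5)[OF that] by simp
      show "card (nbrs ?E c1) \<le> 3" using l3 lt by simp
      show "card (nbrs ?E v) \<le> 3" if v: "v \<in> set ?us" for v
      proof (cases "v = w")
        case True
        have "nbrs ?E w = nbrs E w - {c7}" by (auto simp: nbrs_def doubleton_eq_iff)
        then show ?thesis using True light_neq(6)[OF w] nw by simp
      next
        case False
        then have "light v" using v lt ltd T by auto
        then show ?thesis using l3 by simp
      qed
      show "{c2, c1} \<in> ?E" using ec dc by (auto simp: insert_commute doubleton_eq_iff)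
      show "y \<in> nbrs ?E c1" using Q dc by (auto simp: nbrs_def doubleton_eq_iff)
      show "y \<in> ?B1" using zV by simp
    qed
    moreover have "insert c1 (insert c2 ?B1 \<union> set ?us) = V" using LV by auto
    ultimately obtain F' where F': "extends ?E ?B1 F1 V F'" by auto
    have IF': "IF_part ?E V F'" and FF: "F' \<inter> ?B1 = F1" using F' by (auto simp: extends_def)
    have zwE: "{z, w} \<in> ?E" using Q dc zn by (auto simp: doubleton_eq_iff)
    have wc7: "w \<noteq> c7" using dc by auto
    have c7F: "c7 \<notin> F" using FB by auto
    have z7: "c7 \<in> F' \<longleftrightarrow> z \<in> F'" using FF zV c7F unfolding F1_def by (auto split: if_splits)
    have wV: "w \<in> V" "z \<in> V" using LV zV by auto
    have "w \<in> F' \<or> c7 \<in> F'"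
      using IF' z7 zwE wV unfolding IF_part_def by blast
    moreover have "\<not> conn ?E F' w c7" if "w \<in> F'" "c7 \<in> F'"
    proof
      assume cn: "conn ?E F' w c7"
      have zF: "z \<in> F'" using z7 that by simp
      then have zF1: "z \<in> F1" "z \<in> F" using FF zV c7F zn by (auto simp: F1_def split: if_splits)
      \<comment> \<open>Through its neighbour \<open>z\<close>, a connection from \<open>w\<close>
        to \<open>c7\<close> would join the component of \<open>z\<close> to that of
        \<open>c7\<close>, and these were separate at the start.\<close>
      have "conn ?E F' z w" using conn_edge[OF zF that(1) zwE] .
      then have "conn ?E F' z c7" using conn_trans cn by metis
      then have "conn ?E F1 z c7" using F' zF1 by (auto simp: extends_def F1_def)
      then have "conn ?E (insert c7 F) z c7" using zF1 by (simp add: F1_def)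
      then have "z = c7" using not_conn_isolated[of ?E c7 F z] n7E FB by auto
      then show False using Q by simp
    qed
    ultimately have "IF_part E V F'" using IF_part_delete_edge[OF IF' wc7] by blast
    moreover have "F' \<inter> (V - ?L) = F" using FF FB c7F F1 unfolding extends_def by blast
    ultimately show "\<exists>F'. IF_part E V F' \<and> F' \<inter> (V - ?L) = F" by blast
  qed auto
qed

end

section \<open>Faces of a critical graph\<close>

lemma double_count:
  assumes "finite A" "finite B"
  shows "(\<Sum>a\<in>A. card {b \<in> B. R a b}) = (\<Sum>b\<in>B. card {a \<in> A. R a b})"
proof -
  have 1: "card {b \<in> B. R a b} = (\<Sum>b\<in>B. if R a b then 1 else 0)" for a
    using assms by (simp add: sum.If_cases Int_def)
  have 2: "card {a \<in> A. R a b} = (\<Sum>a\<in>A. if R a b then 1 else 0)" for b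
    using assms by (simp add: sum.If_cases Int_def)
  show ?thesis unfolding 1 2 by (rule sum.swap)
qed

lemma two_of_three:
  assumes "card S = 3" "finite S" "A \<subseteq> S" "B \<subseteq> S" "card A = 2" "card B = 2"
  obtains e where "e \<in> A" "e \<in> B"
proof -
  have "A \<inter> B \<noteq> {}"
  proof
    assume "A \<inter> B = {}"
    then have "card (A \<union> B) = 4" using assms finite_subset[of _ S] by (simp add: card_Un_disjoint)
    moreover have "card (A \<union> B) \<le> 3" using card_mono[of S "A \<union> B"] assms by auto
    ultimately show False by simp
  qed
  then show ?thesis using that by blast
qed

text \<open>The plane is left behind here: a face is only the edge set of its boundary cycle, and
  \<open>link\<close> is all that remains of the cyclic order of faces around a vertex.\<close>

locale critical_faces = critical_graph +
  fixes Fs :: "'a set set set"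
  assumes finite_Fs: "finite Fs"
    and face_cycle: "\<And>f. f \<in> Fs \<Longrightarrow> \<exists>c. cyc E c \<and> f = cedges c"
    and two_faces: "\<And>e. e \<in> E \<Longrightarrow> card {f \<in> Fs. e \<in> f} = 2"
    and euler: "card V + card Fs = card E + 2"
    and link: "\<And>v T. T \<subseteq> {e \<in> E. v \<in> e} \<Longrightarrow> T \<noteq> {} \<Longrightarrow> T \<noteq> {e \<in> E. v \<in> e} \<Longrightarrow>
        \<exists>f\<in>Fs. f \<inter> T \<noteq> {} \<and> f \<inter> ({e \<in> E. v \<in> e} - T) \<noteq> {}"
begin

definition inc :: "'a set set \<Rightarrow> 'a \<Rightarrow> 'a set set" where
  "inc f v = {e \<in> f. v \<in> e}"

lemma finite_E: "finite E"
  using E_sub finite_V by (meson Sup_le_iff finite_Pow_iff finite_subset Pow_iff subsetI)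

lemma face_sub: "f \<in> Fs \<Longrightarrow> f \<subseteq> E"
  using face_cycle by (auto simp: cyc_def)

lemma finite_face: "f \<in> Fs \<Longrightarrow> finite f"
  using face_sub finite_E finite_subset by blast

lemma face_vertices: "f \<in> Fs \<Longrightarrow> \<Union> f \<subseteq> V"
  using face_sub E_sub by blast

lemma face_list:
  assumes "f \<in> Fs" "{a, b} \<in> f"
  obtains r where "cyc E (a # b # r)" "f = cedges (a # b # r)"
proof -
  obtain c where c: "cyc E c" "f = cedges c" using face_cycle assms by blast
  have cn: "c \<noteq> []" using c by (auto simp: cyc_def)
  then have "a \<in> set c" using assms(2) c(2) cedges_Union by blast
  then obtain n p where np: "rotate n c = a # p" by (rule rotate_to_front)
  have cp: "cyc E (a # p)" "f = cedges (a # p)" using c np by (metis cyc_rotate, metis cedges_rotate)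
  have d: "distinct (a # p)" "2 \<le> length p" using cp by (auto simp: cyc_def)
  then have pn: "p \<noteq> []" by auto
  have "b = hd p \<or> b = last p" using cedges_hd_edge[OF d] assms(2) cp(2) by simp
  then show ?thesis
  proof
    assume "b = hd p"
    then show ?thesis using that[of "tl p"] cp pn by simp
  next
    assume b: "b = last p"
    have r: "rotate (length p) (rev (a # p)) = a # rev p" using rotate_append[of "rev p" "[a]"] by simp
    then have "cyc E (a # rev p)" "f = cedges (a # rev p)" using cp by (metis cyc_rotate cyc_rev, metis cedges_rotate cedges_rev)
    moreover have "rev p = b # tl (rev p)" using pn b by (metis hd_rev list.collapse rev_is_Nil_conv)
    ultimately show ?thesis using that[of "tl (rev p)"] by metis
  qed
qed

lemma face_len: "f \<in> Fs \<Longrightarrow> cyc E c \<Longrightarrow> f = cedges c \<Longrightarrow> card f = length c"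
  using card_cedges by (auto simp: cyc_def)

lemma face_card: "f \<in> Fs \<Longrightarrow> card f = 3 \<or> card f = 4 \<or> 8 \<le> card f"
proof -
  assume f: "f \<in> Fs"
  then obtain c where c: "cyc E c" "f = cedges c" using face_cycle by blast
  have "card f = length c" "3 \<le> length c" "length c \<notin> {5, 6, 7}"
    using face_len[OF f c] c(1) no567[OF c(1)] by (auto simp: cyc_def)
  then show ?thesis by (simp; presburger)
qed

lemma card_inc: "card (inc E v) = card (nbrs E v)"
  using card_edges_at[OF two_sets_E] by (simp add: inc_def)

lemma finite_inc [simp]: "finite (inc E v)"
  using finite_E by (simp add: inc_def)

lemma inc_edge:
  assumes "e \<in> inc E v" obtains u where "e = {v, u}" "{v, u} \<in> E"
proof -
  have e: "e \<in> E" "v \<in> e" using assms by (auto simp: inc_def)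
  obtain a b where ab: "e = {a, b}" using two_setsE[OF two_sets_E e(1)] by blast
  show ?thesis
  proof (cases "v = a")
    case True then show ?thesis using that[of b] ab e by simp
  next
    case False
    then have "e = {v, a}" using ab e by auto
    then show ?thesis using that[of a] e by simp
  qed
qed

lemma face_inc:
  assumes "f \<in> Fs" "v \<in> \<Union> f" shows "card (inc f v) = 2" "inc f v \<subseteq> inc E v"
proof -
  obtain c where c: "cyc E c" "f = cedges c" using face_cycle assms by blast
  have "c \<noteq> []" using c(1) by (auto simp: cyc_def)
  then have "v \<in> set c" using assms(2) c(2) cedges_Union by blast
  then show "card (inc f v) = 2" using card_cedges_at c unfolding inc_def cyc_def by metis
  show "inc f v \<subseteq> inc E v" using face_sub[OF assms(1)] by (auto simp: inc_def)
qed

lemma face_inc_pair: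
  assumes "f \<in> Fs" "{v, a} \<in> f" "{v, b} \<in> f" "a \<noteq> b"
  shows "inc f v = {{v, a}, {v, b}}"
proof -
  have "{{v, a}, {v, b}} \<subseteq> inc f v" using assms by (auto simp: inc_def)
  moreover have "card {{v, a}, {v, b}} = 2" using assms(4) by (auto simp: doubleton_eq_iff card_insert_if)
  moreover have "card (inc f v) = 2" using face_inc(1)[OF assms(1)] assms(2) by blast
  moreover have "finite (inc f v)" using finite_face[OF assms(1)] by (simp add: inc_def)
  ultimately show ?thesis by (metis card_subset_eq)
qed

lemma face_inc_obtain:
  assumes "f \<in> Fs" "{v, a} \<in> f"
  obtains b where "b \<noteq> a" "{v, b} \<in> f" "inc f v = {{v, a}, {v, b}}"
proof -
  obtain r where r: "cyc E (v # a # r)" "f = cedges (v # a # r)" using face_list[OF assms] .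
  have rn: "r \<noteq> []" using r(1) by (auto simp: cyc_def)
  have "last r \<noteq> a" using r(1) rn by (auto simp: cyc_def)
  moreover have "{v, last r} \<in> f" using r(2) rn by (auto simp: cedges_def insert_commute)
  ultimately show ?thesis using that[of "last r"] face_inc_pair[OF assms(1,2)] by metis
qed

lemma faces_of_edge:
  assumes "e \<in> E" obtains f g where "f \<noteq> g" "f \<in> Fs" "g \<in> Fs" "{h \<in> Fs. e \<in> h} = {f, g}"
proof -
  obtain f g where "{h \<in> Fs. e \<in> h} = {f, g}" "f \<noteq> g" using two_faces[OF assms] by (meson card_2_iff)
  then show ?thesis using that by blast
qed

lemma other_face:
  assumes "f \<in> Fs" "e \<in> f"
  obtains g where "g \<in> Fs" "g \<noteq> f" "e \<in> g" "\<And>h. h \<in> Fs \<Longrightarrow> e \<in> h \<Longrightarrow> h = f \<or> h = g"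
proof -
  have "e \<in> E" using assms face_sub by blast
  then obtain f' g' where fg: "f' \<noteq> g'" "f' \<in> Fs" "g' \<in> Fs" "{h \<in> Fs. e \<in> h} = {f', g'}" by (rule faces_of_edge)
  have "f \<in> {f', g'}" using assms fg(4) by blast
  then show ?thesis
  proof
    assume "f = f'" then show ?thesis using that[of g'] fg by blast
  next
    assume "f \<in> {g'}" then show ?thesis using that[of f'] fg by blast
  qed
qed

lemma third_face:
  assumes "f \<in> Fs" "g \<in> Fs" "h \<in> Fs" "e \<in> f" "e \<in> g" "e \<in> h" "f \<noteq> g"
  shows "h = f \<or> h = g"
  using other_face[OF assms(1,4)] assms by metis

text \<open>The two faces already occupy both sides of the two edges, so no face leads from them to
  a further edge at \<open>v\<close>; by \<open>link\<close> there is none.\<close>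

lemma shared_pair_deg2:
  assumes "f \<in> Fs" "g \<in> Fs" "f \<noteq> g" "{v, a} \<in> f" "{v, a} \<in> g" "{v, b} \<in> f" "{v, b} \<in> g" "a \<noteq> b"
  shows "card (nbrs E v) = 2"
proof -
  let ?T = "{{v, a}, {v, b}}"
  have fE: "f \<subseteq> E" using face_sub assms by blast
  have sub: "?T \<subseteq> {e \<in> E. v \<in> e}" using assms fE by auto
  have "?T = {e \<in> E. v \<in> e}"
  proof (rule ccontr)
    assume "?T \<noteq> {e \<in> E. v \<in> e}"
    then obtain h where h: "h \<in> Fs" "h \<inter> ?T \<noteq> {}" "h \<inter> ({e \<in> E. v \<in> e} - ?T) \<noteq> {}"
      using link[OF sub] by blast
    have "h = f \<or> h = g" using h third_face[OF assms(1,2) h(1)] assms by blast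
    moreover have "inc f v = ?T" "inc g v = ?T" using face_inc_pair assms by metis+
    ultimately have "inc h v = ?T" by auto
    then show False using h(3) by (auto simp: inc_def)
  qed
  then have "inc E v = ?T" by (simp add: inc_def)
  then show ?thesis using card_inc[of v] assms(8) by (simp add: doubleton_eq_iff card_insert_if)
qed

definition faces_at :: "'a \<Rightarrow> 'a set set set" where
  "faces_at v = {f \<in> Fs. v \<in> \<Union> f}"

text \<open>The incidences between edges at \<open>v\<close> and faces are counted in two ways:
  every edge lies on two faces, and every face at \<open>v\<close> uses two edges there.\<close>

lemma card_faces_at: "card (faces_at v) = card (nbrs E v)"
proof -
  have fin: "finite (faces_at v)" using finite_Fs by (simp add: faces_at_def)
  have "(\<Sum>e\<in>inc E v. card {f \<in> faces_at v. e \<in> f}) = (\<Sum>f\<in>faces_at v. card {e \<in> inc E v. e \<in> f})"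
    using double_count[OF finite_inc fin] .
  moreover have "card {f \<in> faces_at v. e \<in> f} = 2" if "e \<in> inc E v" for e
  proof -
    have "{f \<in> faces_at v. e \<in> f} = {f \<in> Fs. e \<in> f}" using that by (auto simp: faces_at_def inc_def)
    then show ?thesis using two_faces that by (auto simp: inc_def)
  qed
  moreover have "card {e \<in> inc E v. e \<in> f} = 2" if "f \<in> faces_at v" for f
  proof -
    have "{e \<in> inc E v. e \<in> f} = inc f v" using that face_sub by (auto simp: faces_at_def inc_def)
    then show ?thesis using face_inc(1) that by (auto simp: faces_at_def)
  qed
  ultimately show ?thesis using card_inc[of v] by simp
qed

text \<open>If the neighbour is \<open>v0\<close>, its degree is not 2, for otherwise
  \<open>v\<close> would belong to \<open>X\<close>.\<close>

lemma nbr_deg: "light v \<or> heavy4 v \<Longrightarrow> {v, z} \<in> E \<Longrightarrow> 3 \<le> card (nbrs E z)"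
proof (cases "z = v0")
  case True
  assume "light v \<or> heavy4 v" "{v, z} \<in> E"
  then have "v \<notin> X" "v \<in> nbrs E v0" using True by (auto simp: light_def heavy4_def edge_nbrs')
  then have "card (nbrs E v0) \<noteq> 2" by (auto simp: X_def)
  then show ?thesis using True deg2 by simp
next
  case False
  assume "{v, z} \<in> E"
  then show ?thesis using deg3[of z] False edge_in_V by blast
qed

lemma two_tri_False:
  assumes "triE E x y z" "triE E x' y' z'" "{x, y, z} \<noteq> {x', y', z'}" "u \<in> {x, y, z}" "u \<in> {x', y', z'}"
  shows False
  using tri_far[OF assms(1,2,3,4,5)] by simp

lemma three_face:
  assumes "f \<in> Fs" "card f = 3" "{a, b} \<in> f"
  obtains x where "triE E a b x" "f = {{a, b}, {b, x}, {a, x}}" "cyc E [a, b, x]"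
proof -
  obtain r where r: "cyc E (a # b # r)" "f = cedges (a # b # r)" using face_list[OF assms(1,3)] .
  then have "length r = 1" using face_len[OF assms(1) r] assms(2) by simp
  then obtain x where x: "r = [x]" by (auto simp: length_Suc_conv)
  show ?thesis
    by (rule that[of x]) (use r x in \<open>auto simp: cyc_def cedges_def triE_def insert_commute\<close>)
qed

lemma four_face:
  assumes "f \<in> Fs" "card f = 4" "{a, b} \<in> f"
  obtains c d where "cyc E [a, b, c, d]" "f = {{a, b}, {b, c}, {c, d}, {d, a}}"
proof -
  obtain r where r: "cyc E (a # b # r)" "f = cedges (a # b # r)" using face_list[OF assms(1,3)] .
  then have "length r = 2" using face_len[OF assms(1) r] assms(2) by simp
  then obtain c d where x: "r = [c, d]" by (auto simp: length_Suc_conv numeral_2_eq_2)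
  show ?thesis
    by (rule that[of c d]) (use r x in \<open>auto simp: cedges_def\<close>)
qed

text \<open>Two adjacent triangles would be distinct triangles with a common vertex. A triangle
  beside a 4-face gives a 5-cycle, unless its apex is a vertex of the 4-face; then the 4-face has a
  chord, and a second triangle arises.\<close>

lemma three_face_nonadjacent:
  assumes "f \<in> Fs" "card f = 3" "g \<in> Fs" "card g \<le> 4" "g \<noteq> f" "e \<in> f" "e \<in> g"
  shows False
proof -
  have "e \<in> E" using assms face_sub by blast
  then obtain a b where ab: "e = {a, b}" using two_setsE[OF two_sets_E] by blast
  obtain x where x: "triE E a b x" "f = {{a, b}, {b, x}, {a, x}}" "cyc E [a, b, x]"
    using three_face[OF assms(1,2)] assms(6) ab by metis
  consider "card g = 3" | "card g = 4" using face_card[OF assms(3)] assms(4) by linarith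
  then show False
  proof cases
    case 1
    obtain y where y: "triE E a b y" "g = {{a, b}, {b, y}, {a, y}}" "cyc E [a, b, y]"
      using three_face[OF assms(3) 1] assms(7) ab by metis
    have "x \<noteq> y" using x y assms(5) by auto
    then have "{a, b, x} \<noteq> {a, b, y}" using x(3) by (auto simp: cyc_def)
    then show False using two_tri_False[OF x(1) y(1)] by blast
  next
    case 2
    obtain c d where y: "cyc E [a, b, c, d]" using four_face[OF assms(3) 2] assms(7) ab by metis
    then have ed: "{a, b} \<in> E" "{b, c} \<in> E" "{c, d} \<in> E" "{d, a} \<in> E" and ds: "distinct [a, b, c, d]"
      by (auto simp: cyc_def cedges_def)
    have xe: "{b, x} \<in> E" "{a, x} \<in> E" "x \<noteq> a" "x \<noteq> b" using x by (auto simp: triE_def cyc_def)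
    consider "x = c" | "x = d" | "x \<notin> {c, d}" by blast
    then show False
    proof cases
      case 1
      then have "triE E a c d" using ed xe by (auto simp: triE_def insert_commute)
      moreover have "{a, b, x} \<noteq> {a, c, d}" using ds 1 by auto
      ultimately show False using two_tri_False[OF x(1), of a c d a] by blast
    next
      case 2
      then have "triE E b c d" using ed xe by (auto simp: triE_def insert_commute)
      moreover have "{a, b, x} \<noteq> {b, c, d}" using ds 2 by auto
      ultimately show False using two_tri_False[OF x(1), of b c d b] by blast
    next
      case 3
      then have "cyc E [a, x, b, c, d]" using ed xe ds by (auto simp: cyc_def cedges_def insert_commute)
      then show False using no567 by fastforce
    qed
  qed
qed

text \<open>Two 4-faces with a common edge form a 6-cycle unless they share a further vertex. If the
  next vertices after \<open>a\<close> or after \<open>b\<close> coincide, that end has degree 2; if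
  vertices coincide crosswise, two triangles meet.\<close>

lemma small_nonadjacent:
  assumes "f \<in> Fs" "card f \<le> 4" "g \<in> Fs" "card g \<le> 4" "g \<noteq> f" "{a, b} \<in> f" "{a, b} \<in> g"
    and deg: "3 \<le> card (nbrs E a)" "3 \<le> card (nbrs E b)"
  shows False
proof -
  consider "card f = 3" | "card g = 3" | "card f = 4" "card g = 4"
    using face_card[OF assms(1)] face_card[OF assms(3)] assms(2,4) by linarith
  then show False
  proof cases
    case 1 show False by (rule three_face_nonadjacent[OF assms(1) 1 assms(3,4,5,6,7)])
  next
    case 2 show False by (rule three_face_nonadjacent[OF assms(3) 2 assms(1,2) assms(5)[symmetric] assms(7,6)])
  next
    case 3
    obtain c d where y: "cyc E [a, b, c, d]" "f = {{a, b}, {b, c}, {c, d}, {d, a}}"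
      using four_face[OF assms(1) 3(1) assms(6)] .
    obtain c' d' where y': "cyc E [a, b, c', d']" "g = {{a, b}, {b, c'}, {c', d'}, {d', a}}"
      using four_face[OF assms(3) 3(2) assms(7)] .
    have ed: "{a, b} \<in> E" "{b, c} \<in> E" "{c, d} \<in> E" "{d, a} \<in> E" and ds: "distinct [a, b, c, d]"
      using y(1) by (auto simp: cyc_def cedges_def)
    have ed': "{b, c'} \<in> E" "{c', d'} \<in> E" "{d', a} \<in> E" and ds': "distinct [a, b, c', d']"
      using y'(1) by (auto simp: cyc_def cedges_def)
    have n1: "c \<noteq> c'"
    proof
      assume "c = c'"
      then have "card (nbrs E b) = 2"
        using shared_pair_deg2[OF assms(1,3) assms(5)[symmetric], of b a c] y(2) y'(2) ds by (auto simp: insert_commute)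
      then show False using deg by simp
    qed
    have n2: "d \<noteq> d'"
    proof
      assume "d = d'"
      then have "card (nbrs E a) = 2"
        using shared_pair_deg2[OF assms(1,3) assms(5)[symmetric], of a b d] y(2) y'(2) ds by (auto simp: insert_commute)
      then show False using deg by simp
    qed
    have n3: "c \<noteq> d'"
    proof
      assume "c = d'"
      then have "triE E a b c" "triE E a c d" using ed ed' by (auto simp: triE_def insert_commute)
      moreover have "{a, b, c} \<noteq> {a, c, d}" using ds by auto
      ultimately show False using two_tri_False[of a b c a c d a] by blast
    qed
    have n4: "d \<noteq> c'"
    proof
      assume "d = c'"
      then have "triE E a b d" "triE E b c d" using ed ed' by (auto simp: triE_def insert_commute)
      moreover have "{a, b, d} \<noteq> {b, c, d}" using ds by auto
      ultimately show False using two_tri_False[of a b d b c d b] by blast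
    qed
    have "cyc E [b, c, d, a, d', c']" using ed ed' ds ds' n1 n2 n3 n4
      by (auto simp: cyc_def cedges_def insert_commute)
    then show False using no567 by fastforce
  qed
qed

text \<open>Each of the two faces uses two of the only three edges at \<open>v\<close>.\<close>

lemma light_share:
  assumes "light v" "f \<in> Fs" "g \<in> Fs" "v \<in> \<Union> f" "v \<in> \<Union> g"
  obtains z where "{v, z} \<in> f" "{v, z} \<in> g"
proof -
  have "card (inc E v) = 3" using card_inc light_neq(5)[OF assms(1)] by simp
  then obtain e where e: "e \<in> inc f v" "e \<in> inc g v"
    by (rule two_of_three[OF _ finite_inc face_inc(2)[OF assms(2,4)] face_inc(2)[OF assms(3,5)]
      face_inc(1)[OF assms(2,4)] face_inc(1)[OF assms(3,5)]])
  have "e \<in> inc E v" using e(1) face_inc(2)[OF assms(2,4)] by (rule rev_subsetD)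
  then obtain z where "e = {v, z}" by (rule inc_edge)
  then show ?thesis using that[of z] e by (simp add: inc_def)
qed

lemma light_one_small:
  assumes "light v" "f \<in> Fs" "g \<in> Fs" "v \<in> \<Union> f" "v \<in> \<Union> g" "card f \<le> 4" "card g \<le> 4"
  shows "f = g"
proof (rule ccontr)
  assume ne: "f \<noteq> g"
  obtain z where z: "{v, z} \<in> f" "{v, z} \<in> g" using light_share[OF assms(1-5)] .
  have "{v, z} \<in> E" using z face_sub assms by blast
  then have "3 \<le> card (nbrs E z)" using nbr_deg assms(1) by blast
  then show False
    using small_nonadjacent[OF assms(2,6,3,7) ne[symmetric] z] light_neq(5)[OF assms(1)] by simp
qed

text \<open>These are the triangular faces that will be paid in full. A triangular face at
  \<open>v0\<close> is left unpaid, and there is at most one.\<close>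

definition tri :: "'a set set \<Rightarrow> bool" where
  "tri T \<longleftrightarrow> T \<in> Fs \<and> card T = 3 \<and> v0 \<notin> \<Union> T"

definition te :: "'a set \<Rightarrow> bool" where
  "te e \<longleftrightarrow> (\<exists>T. tri T \<and> e \<in> T)"

definition se :: "'a set \<Rightarrow> bool" where
  "se e \<longleftrightarrow> (\<exists>g\<in>Fs. e \<in> g \<and> card g \<le> 4)"

text \<open>These are the edges for which \<open>\<kappa>\<close> takes its full value 1/3; for a
  triangle with a vertex that is not light it is at most 0.\<close>

definition T0 :: "'a set \<Rightarrow> bool" where
  "T0 e \<longleftrightarrow> (\<exists>T. tri T \<and> e \<in> T \<and> (\<forall>v\<in>\<Union> T. light v))"

lemma T0_te: "T0 e \<Longrightarrow> te e" by (auto simp: T0_def te_def)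
lemma te_se: "te e \<Longrightarrow> se e" by (auto simp: te_def se_def tri_def)

lemma three_triangle:
  assumes "T \<in> Fs" "card T = 3" "{a, b} \<in> T"
  obtains x where "triE E a b x" "T = {{a, b}, {b, x}, {a, x}}" "distinct [a, b, x]" "\<Union> T = {a, b, x}"
proof -
  obtain x where "triE E a b x" "T = {{a, b}, {b, x}, {a, x}}" "cyc E [a, b, x]"
    using three_face assms by metis
  then show ?thesis using that[of x] by (auto simp: cyc_def)
qed

text \<open>Two triangles this close have the same vertices, and the edges of a triangle are all the
  pairs of its vertices.\<close>

lemma three_face_unique:
  assumes "T \<in> Fs" "card T = 3" "T' \<in> Fs" "card T' = 3" "u \<in> \<Union> T" "v \<in> \<Union> T'" "u = v \<or> {u, v} \<in> E"
  shows "T = T'"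
proof -
  obtain e where e: "e \<in> T" "u \<in> e" using assms by blast
  then have "e \<in> E" using assms(1) face_sub by blast
  then obtain a b where ab: "e = {a, b}" using two_setsE[OF two_sets_E] by blast
  obtain x where x: "triE E a b x" "T = {{a, b}, {b, x}, {a, x}}" "distinct [a, b, x]" "\<Union> T = {a, b, x}"
    using three_triangle[OF assms(1,2)] e ab by metis
  obtain e' where e': "e' \<in> T'" "v \<in> e'" using assms by blast
  then have "e' \<in> E" using assms(3) face_sub by blast
  then obtain a' b' where ab': "e' = {a', b'}" using two_setsE[OF two_sets_E] by blast
  obtain x' where x': "triE E a' b' x'" "T' = {{a', b'}, {b', x'}, {a', x'}}" "distinct [a', b', x']" "\<Union> T' = {a', b', x'}"
    using three_triangle[OF assms(3,4)] e' ab' by metis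
  have same: "{a, b, x} = {a', b', x'}"
    using tri_far[OF x(1) x'(1), of u v] assms x(4) x'(4) by blast
  have s: "S = {e. e \<subseteq> {p, q, r} \<and> card e = 2}" if "S = {{p, q}, {q, r}, {p, r}}" "distinct [p, q, r]" for S and p q r :: 'a
  proof -
    have "e \<in> S" if "e \<subseteq> {p, q, r}" "card e = 2" for e
    proof -
      obtain y z where "e = {y, z}" "y \<noteq> z" using \<open>card e = 2\<close> by (auto simp: card_2_iff)
      then show ?thesis using that(1) \<open>S = _\<close> by (simp, elim conjE disjE; simp add: insert_commute)
    qed
    moreover have "e \<subseteq> {p, q, r} \<and> card e = 2" if "e \<in> S" for e
    proof -
      have "e = {p, q} \<or> e = {q, r} \<or> e = {p, r}" using that \<open>S = _\<close> by simp
      then show ?thesis using \<open>distinct [p, q, r]\<close> by (elim disjE) simp_all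
    qed
    ultimately show ?thesis by (intro set_eqI iffI) simp_all
  qed
  show ?thesis using s[OF x(2,3)] s[OF x'(2,3)] same by simp
qed

lemma tri_triangle:
  assumes "tri T" "{a, b} \<in> T"
  obtains x where "triE E a b x" "T = {{a, b}, {b, x}, {a, x}}" "distinct [a, b, x]" "\<Union> T = {a, b, x}"
  using three_triangle[of T a b] assms unfolding tri_def by metis

lemma tri_unique:
  assumes "tri T" "tri T'" "u \<in> \<Union> T" "v \<in> \<Union> T'" "u = v \<or> {u, v} \<in> E"
  shows "T = T'"
  using three_face_unique[of T T' u v] assms unfolding tri_def by blast

lemma tri_deg: "tri T \<Longrightarrow> v \<in> \<Union> T \<Longrightarrow> 3 \<le> card (nbrs E v)"
  using deg3[of v] face_vertices unfolding tri_def by blast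

lemma tri_adjacent_big:
  assumes "tri T" "f \<in> Fs" "f \<noteq> T" "e \<in> T" "e \<in> f" shows "8 \<le> card f"
  using three_face_nonadjacent[of T f e] assms face_card[of f] unfolding tri_def by fastforce

text \<open>Two common edges would meet in a vertex of degree 2.\<close>

lemma tri_meets_once:
  assumes "tri T" "f \<in> Fs" "f \<noteq> T" "e \<in> T" "e \<in> f" "e' \<in> T" "e' \<in> f"
  shows "e = e'"
proof (rule ccontr)
  assume ne: "e \<noteq> e'"
  have "e \<in> E" using assms(1,4) face_sub by (auto simp: tri_def)
  then obtain a b where ab: "e = {a, b}" using two_setsE[OF two_sets_E] by blast
  obtain x where x: "triE E a b x" "T = {{a, b}, {b, x}, {a, x}}" "distinct [a, b, x]" "\<Union> T = {a, b, x}"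
    using tri_triangle[OF assms(1)] assms(4) ab by metis
  have T: "T \<in> Fs" using assms(1) by (simp add: tri_def)
  consider "e' = {b, x}" | "e' = {a, x}" using assms(6) ne ab x by auto
  then show False
  proof cases
    case 1
    have "card (nbrs E b) = 2"
      using shared_pair_deg2[OF T assms(2) assms(3)[symmetric], of b a x] 1 assms x ab by (auto simp: insert_commute)
    then show False using tri_deg[OF assms(1), of b] x(4) by auto
  next
    case 2
    have "card (nbrs E a) = 2"
      using shared_pair_deg2[OF T assms(2) assms(3)[symmetric], of a b x] 2 assms x ab by (auto simp: insert_commute)
    then show False using tri_deg[OF assms(1), of a] x(4) by auto
  qed
qed

text \<open>Such a face would be short of \<open>1/6\<close>, which its 4-vertex \<open>w\<close> pays.\<close>

definition needy :: "'a set set \<Rightarrow> 'a \<Rightarrow> bool" where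
  "needy f w \<longleftrightarrow> heavy4 w \<and> f \<in> Fs \<and> (\<exists>c1 c2 c3 c4 c5 c6 c7.
     f = cedges [w, c1, c2, c3, c4, c5, c6, c7] \<and> cyc E [w, c1, c2, c3, c4, c5, c6, c7] \<and>
     (\<forall>v\<in>{c1, c2, c3, c4, c5, c6, c7}. light v) \<and>
     se {w, c1} \<and> T0 {c2, c3} \<and> se {c4, c5} \<and> T0 {c6, c7})"

lemma needy_card: "needy f w \<Longrightarrow> card f = 8"
  unfolding needy_def using face_len by fastforce

lemma needyE:
  assumes "needy f w"
  obtains c1 c2 c3 c4 c5 c6 c7 where "f = cedges [w, c1, c2, c3, c4, c5, c6, c7]"
    "cyc E [w, c1, c2, c3, c4, c5, c6, c7]" "\<forall>v\<in>{c1, c2, c3, c4, c5, c6, c7}. light v"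
    "se {w, c1}" "T0 {c2, c3}" "se {c4, c5}" "T0 {c6, c7}"
  using assms unfolding needy_def by blast

text \<open>Around \<open>w\<close> the faces follow in the order \<open>f\<close>,
  \<open>Q\<close>, \<open>B\<close>, \<open>h\<close>, separated by the edges from \<open>w\<close>
  to \<open>c1\<close>, \<open>z\<close>, \<open>u\<close>, and \<open>c7\<close>. Only
  \<open>Q\<close> is small, and \<open>h\<close> lies opposite to it; so \<open>f\<close> and
  \<open>B\<close> will be the only candidates for needy faces.\<close>

lemma needy_structure:
  assumes "needy f w"
  obtains c1 c2 c3 c4 c5 c6 c7 z u Q B h where
    "f = cedges [w, c1, c2, c3, c4, c5, c6, c7]" "cyc E [w, c1, c2, c3, c4, c5, c6, c7]"
    "\<forall>v\<in>{c1, c2, c3, c4, c5, c6, c7}. light v" "T0 {c2, c3}" "T0 {c6, c7}"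
    "distinct [c1, c7, z, u]" "nbrs E w = {c1, c7, z, u}"
    "Q \<in> Fs" "B \<in> Fs" "h \<in> Fs" "distinct [f, Q, B, h]" "faces_at w = {f, Q, B, h}"
    "inc f w = {{w, c1}, {w, c7}}" "inc Q w = {{w, c1}, {w, z}}" "inc B w = {{w, z}, {w, u}}"
    "inc h w = {{w, u}, {w, c7}}" "card Q \<le> 4" "8 \<le> card B" "8 \<le> card h"
    "se {w, z}" "\<not> se {w, u}" "\<not> se {w, c7}"
proof -
  obtain c1 c2 c3 c4 c5 c6 c7 where f: "f = cedges [w, c1, c2, c3, c4, c5, c6, c7]"
    and c: "cyc E [w, c1, c2, c3, c4, c5, c6, c7]"
    and lt: "\<And>v. v \<in> {c1, c2, c3, c4, c5, c6, c7} \<Longrightarrow> light v"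
    and se1: "se {w, c1}" and T23: "T0 {c2, c3}" and T67: "T0 {c6, c7}"
    using assms unfolding needy_def by blast
  have w: "heavy4 w" and fF: "f \<in> Fs" using assms by (auto simp: needy_def)
  have f8: "card f = 8" using needy_card[OF assms] .
  have ef: "{w, c1} \<in> f" "{w, c7} \<in> f" "{c6, c7} \<in> f" unfolding f by (auto simp: cedges_def insert_commute)
  have c17: "c1 \<noteq> c7" using c by (auto simp: cyc_def)
  have incf: "inc f w = {{w, c1}, {w, c7}}" using face_inc_pair[OF fF ef(1,2) c17] .
  obtain Q where Q: "Q \<in> Fs" "{w, c1} \<in> Q" "card Q \<le> 4" using se1 by (auto simp: se_def)
  have fQ: "f \<noteq> Q" using Q f8 by auto
  obtain z where z: "z \<noteq> c1" "{w, z} \<in> Q" "inc Q w = {{w, c1}, {w, z}}" using face_inc_obtain[OF Q(1,2)] .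
  obtain T where T: "tri T" "{c6, c7} \<in> T" "\<forall>v\<in>\<Union> T. light v" using T67 by (auto simp: T0_def)
  have TF: "T \<in> Fs" "card T \<le> 4" "c7 \<in> \<Union> T" using T by (auto simp: tri_def)
  have wnl: "\<not> light w" using light_neq(5,6)[of w] w by auto
  have wT: "w \<notin> \<Union> T" using T(3) wnl by blast
  \<comment> \<open>The light vertex \<open>c7\<close> has only one small face, its all-light
    triangle, and \<open>w\<close> is not on that triangle; so no small face contains
    \<open>{w, c7}\<close>.\<close>
  have no7: "g = T" if "g \<in> Fs" "{w, c7} \<in> g" "card g \<le> 4" for g
    using light_one_small[of c7 g T] lt that TF by blast
  have no7': "8 \<le> card g" if "g \<in> Fs" "{w, c7} \<in> g" for g
    using no7[OF that] that wT face_card[OF that(1)] by fastforce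
  have z7: "z \<noteq> c7" using no7'[OF Q(1)] z(2) Q(3) by auto
  have wE: "{w, c1} \<in> E" "{w, c7} \<in> E" "{w, z} \<in> E" using ef z(2) Q(1) face_sub fF by blast+
  obtain u where u: "nbrs E w = {c1, c7, z, u}" "u \<notin> {c1, c7, z}"
  proof -
    have sub: "{c1, c7, z} \<subseteq> nbrs E w" using wE by (auto simp: edge_nbrs)
    have "card {c1, c7, z} = 3" using c17 z(1) z7 by auto
    then have "card (nbrs E w - {c1, c7, z}) = 1" using card_Diff_subset[OF _ sub] light_neq(6)[OF w] by simp
    then obtain u where "nbrs E w - {c1, c7, z} = {u}" by (auto simp: card_1_singleton_iff)
    then show ?thesis using that[of u] sub by auto
  qed
  have dist: "distinct [c1, c7, z, u]" using c17 z(1) z7 u(2) by auto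
  have uE: "{w, u} \<in> E" using u by (auto simp: edge_nbrs)
  have at: "x \<in> {c1, c7, z, u}" if "{w, x} \<in> g" "g \<in> Fs" for g x
    using that face_sub u(1) edge_nbrs[of w x] by blast
  have q: "{w, x} \<in> g \<longleftrightarrow> {w, x} \<in> inc g w" for g x by (simp add: inc_def)
  obtain B where B: "B \<in> Fs" "B \<noteq> Q" "{w, z} \<in> B" using other_face[OF Q(1) z(2)] by metis
  have fz: "{w, z} \<notin> f" "{w, u} \<notin> f" using q[of z f] q[of u f] dist unfolding incf by (auto simp: doubleton_eq_iff)
  have Bf: "B \<noteq> f" using B(3) fz by auto
  have B1: "{w, c1} \<notin> B" using third_face[OF fF Q(1) B(1) ef(1) Q(2) _ fQ] Bf B(2) by metis
  have Qu: "{w, u} \<notin> Q" "{w, c7} \<notin> Q" using q[of u Q] q[of c7 Q] dist unfolding z(3) by (auto simp: doubleton_eq_iff)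
  obtain x where x: "x \<noteq> z" "{w, x} \<in> B" "inc B w = {{w, z}, {w, x}}" using face_inc_obtain[OF B(1,3)] .
  have xu: "x = u"
  proof (rule ccontr)
    assume "x \<noteq> u"
    then have x7: "x = c7" using at[OF x(2) B(1)] x(1) B1 x(2) by auto
    have Bu: "{w, u} \<notin> B" using q[of u B] dist unfolding x(3) x7 by (auto simp: doubleton_eq_iff)
    \<comment> \<open>If \<open>B\<close> turned back to \<open>c7\<close>, the faces
      \<open>f\<close>, \<open>Q\<close>, \<open>B\<close> would occupy both sides of the edges to
      \<open>c1\<close>, \<open>z\<close> and \<open>c7\<close>, and no face could contain
      \<open>{w, u}\<close>.\<close>
    obtain g g' where gg: "g \<noteq> g'" "g \<in> Fs" "g' \<in> Fs" "{h \<in> Fs. {w, u} \<in> h} = {g, g'}"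
      by (rule faces_of_edge[OF uE])
    then have g: "g \<in> Fs" "{w, u} \<in> g" by blast+
    obtain y where y: "y \<noteq> u" "{w, y} \<in> g" using face_inc_obtain[OF g] by metis
    have "y \<in> {c1, c7, z}" using at[OF y(2) g(1)] y(1) by auto
    then consider "y = c1" | "y = c7" | "y = z" by auto
    then have "g = f \<or> g = Q \<or> g = B"
    proof cases
      case 1 then show ?thesis using third_face[OF fF Q(1) g(1) ef(1) Q(2) _ fQ] y(2) by blast
    next
      case 2 then show ?thesis using third_face[OF fF B(1) g(1) ef(2) _ _ Bf[symmetric]] x(2) x7 y(2) by blast
    next
      case 3 then show ?thesis using third_face[OF Q(1) B(1) g(1) z(2) B(3) _ B(2)[symmetric]] y(2) by blast
    qed
    then show False using g(2) fz Qu Bu by auto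
  qed
  have incB: "inc B w = {{w, z}, {w, u}}" and wuB: "{w, u} \<in> B" using x xu by auto
  obtain h where h: "h \<in> Fs" "h \<noteq> B" "{w, u} \<in> h" using other_face[OF B(1) wuB] by metis
  obtain y where y: "y \<noteq> u" "{w, y} \<in> h" "inc h w = {{w, u}, {w, y}}" using face_inc_obtain[OF h(1,3)] .
  have hf: "h \<noteq> f" "h \<noteq> Q" using h(3) fz Qu by auto
  have y7: "y = c7"
  proof -
    have "y \<noteq> c1" using third_face[OF fF Q(1) h(1) ef(1) Q(2) _ fQ] hf y(2) by metis
    moreover have "y \<noteq> z" using third_face[OF Q(1) B(1) h(1) z(2) B(3) _ B(2)[symmetric]] hf h(2) y(2) by metis
    ultimately show ?thesis using at[OF y(2) h(1)] y(1) by auto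
  qed
  have distF: "distinct [f, Q, B, h]" using fQ Bf B(2) h(2) hf by auto
  have faces: "faces_at w = {f, Q, B, h}"
  proof -
    have "{f, Q, B, h} \<subseteq> faces_at w" using fF Q B h ef by (auto simp: faces_at_def)
    moreover have "card (faces_at w) = 4" using card_faces_at light_neq(6)[OF w] by simp
    moreover have "card {f, Q, B, h} = 4" using distF by simp
    moreover have "finite (faces_at w)" using finite_Fs by (simp add: faces_at_def)
    ultimately show ?thesis using card_subset_eq[of "faces_at w" "{f, Q, B, h}"] by metis
  qed
  have dz: "3 \<le> card (nbrs E z)" using nbr_deg wE w by blast
  have Bbig: "8 \<le> card B"
    using small_nonadjacent[OF Q(1,3) B(1) _ B(2) z(2) B(3) _ dz] light_neq(6)[OF w] face_card[OF B(1)] by fastforce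
  have hbig: "8 \<le> card h" using no7'[OF h(1)] y(2) y7 by simp
  have sz: "se {w, z}" using Q z(2) by (auto simp: se_def)
  have su: "\<not> se {w, u}"
  proof
    assume "se {w, u}"
    then obtain g where g: "g \<in> Fs" "{w, u} \<in> g" "card g \<le> 4" by (auto simp: se_def)
    then have "g = B \<or> g = h" using third_face[OF B(1) h(1) g(1) wuB h(3) g(2)] h(2) by auto
    then show False using g(3) Bbig hbig by auto
  qed
  have s7: "\<not> se {w, c7}" unfolding se_def using no7' by fastforce
  show ?thesis
    by (rule that[OF f c ballI[OF lt] T23 T67 dist u(1) Q(1) B(1) h(1) distF faces incf z(3) incB _ Q(3) Bbig hbig sz su s7])
      (use y y7 in auto)
qed

end

section \<open>Discharging\<close>

context critical_faces
begin

definition \<eta> :: "'a \<Rightarrow> real" where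
  "\<eta> v = (if light v then 0 else 1)"

definition the_tri :: "'a set \<Rightarrow> 'a set set" where
  "the_tri e = (THE T. tri T \<and> e \<in> T)"

definition hv :: "'a set \<Rightarrow> real" where
  "hv e = (\<Sum>v\<in>\<Union> (the_tri e). \<eta> v)"

text \<open>On a triangle edge, \<open>\<tau>\<close> consists of 1/2 for each end that is not light
  and of this rest. Each vertex lies on two edges of the triangle, so the halves add up to the
  number \<open>hv e\<close> of such vertices, and the rest has to make up \<open>1 - hv e\<close>
  over the three edges.\<close>

definition \<kappa> :: "'a set \<Rightarrow> real" where
  "\<kappa> e = (if te e then (1 - hv e) / 3 else 0)"

text \<open>The charge that a triangle receives across its edge \<open>e\<close>; the three edges together give 1.\<close>

definition \<tau> :: "'a set \<Rightarrow> real" where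
  "\<tau> e = (if te e then (\<Sum>v\<in>e. \<eta> v) / 2 + \<kappa> e else 0)"

definition smallat :: "'a set set \<Rightarrow> 'a \<Rightarrow> bool" where
  "smallat f v \<longleftrightarrow> (\<exists>e\<in>f. v \<in> e \<and> se e)"

definition N :: "'a \<Rightarrow> 'a set set set" where
  "N w = {f. needy f w}"

text \<open>A 4-vertex recovers what it pays to its needy faces from the other big faces around it.\<close>

definition req :: "'a \<Rightarrow> 'a set set \<Rightarrow> real" where
  "req w f = (if needy f w then - 1 / 6
     else if card (N w) = 1 \<and> smallat f w then 1 / 6
     else if card (N w) = 2 \<and> \<not> smallat f w then 1 / 3 else 0)"

text \<open>The net charge that a big face \<open>f\<close> passes to its vertex \<open>v\<close>.\<close>

definition xch :: "'a set set \<Rightarrow> 'a \<Rightarrow> real" where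
  "xch f v = (if light v then (if smallat f v then 1 / 2 else 1 / 3)
     else if heavy4 v then req v f
     else - 1 / 6 - card {e \<in> f. v \<in> e \<and> te e} / 6)"

text \<open>The part of \<open>\<tau>\<close> that stems from vertices is booked at the vertices.
  What a face gives away is then the sum of \<open>ych\<close> over its vertices and of
  \<open>\<kappa>\<close> over its edges, where \<open>ych\<close> never exceeds 1/2.\<close>

definition ych :: "'a set set \<Rightarrow> 'a \<Rightarrow> real" where
  "ych f v = xch f v + \<eta> v / 2 * card {e \<in> f. v \<in> e \<and> te e}"

lemma inc_pairD:
  assumes "inc h v = {{v, a}, {v, b}}" "{v, x} \<in> h" shows "x = a \<or> x = b"
proof -
  have "{v, x} \<in> inc h v" using assms(2) by (simp add: inc_def)
  then show ?thesis unfolding assms(1) by (auto simp: doubleton_eq_iff)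
qed

lemma tri_in_Fs: "tri T \<Longrightarrow> T \<in> Fs" by (simp add: tri_def)

lemma edge_vertex: "f \<in> Fs \<Longrightarrow> e \<in> f \<Longrightarrow> \<exists>a b. e = {a, b} \<and> a \<noteq> b \<and> {a, b} \<in> E"
  using face_sub two_setsE[OF two_sets_E] by (metis subsetD)

lemma the_tri: assumes "tri T" "e \<in> T" shows "the_tri e = T"
  unfolding the_tri_def
proof (rule the_equality)
  show "tri T \<and> e \<in> T" using assms by simp
  fix T' assume T': "tri T' \<and> e \<in> T'"
  obtain a b where "e = {a, b}" using edge_vertex[OF tri_in_Fs[OF assms(1)] assms(2)] by blast
  then have "a \<in> \<Union> T" "a \<in> \<Union> T'" using assms T' by auto
  then show "T' = T" using tri_unique[of T' T a a] T' assms by blast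
qed

lemma finite_face_vertices: "f \<in> Fs \<Longrightarrow> finite (\<Union> f)"
  using face_vertices finite_V finite_subset by metis

lemma hv_nonneg: "0 \<le> hv e"
  by (simp add: hv_def \<eta>_def sum_nonneg)

lemma T0_hv: assumes "te e" shows "T0 e \<longleftrightarrow> hv e = 0" "\<not> T0 e \<Longrightarrow> 1 \<le> hv e"
proof -
  obtain T where T: "tri T" "e \<in> T" using assms by (auto simp: te_def)
  have fin: "finite (\<Union> T)" using finite_face_vertices tri_in_Fs T by blast
  have hv: "hv e = (\<Sum>v\<in>\<Union> T. \<eta> v)" using the_tri[OF T] by (simp add: hv_def)
  show "\<not> T0 e \<Longrightarrow> 1 \<le> hv e"
  proof -
    assume "\<not> T0 e"
    then obtain v where v: "v \<in> \<Union> T" "\<not> light v" using T unfolding T0_def by blast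
    then have "\<eta> v \<le> (\<Sum>v\<in>\<Union> T. \<eta> v)" by (intro member_le_sum fin) (auto simp: \<eta>_def)
    then show ?thesis using v hv by (simp add: \<eta>_def)
  qed
  moreover have "T0 e \<Longrightarrow> hv e = 0"
  proof -
    assume "T0 e"
    then obtain T' where T': "tri T'" "e \<in> T'" "\<forall>v\<in>\<Union> T'. light v" by (auto simp: T0_def)
    then show ?thesis unfolding hv_def the_tri[OF T'(1,2)] by (intro sum.neutral) (simp add: \<eta>_def)
  qed
  ultimately show "T0 e \<longleftrightarrow> hv e = 0" by fastforce
qed

lemma \<kappa>_bounds: "\<kappa> e \<le> 1 / 3" "\<not> T0 e \<Longrightarrow> \<kappa> e \<le> 0" "\<not> te e \<Longrightarrow> \<kappa> e = 0"
  "te e \<Longrightarrow> 2 \<le> hv e \<Longrightarrow> \<kappa> e \<le> - 1 / 3"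
  using hv_nonneg[of e] T0_hv[of e] by (auto simp: \<kappa>_def)

lemma te_tri: assumes "te e" "e \<in> f" "f \<in> Fs" "8 \<le> card f"
  obtains T where "tri T" "e \<in> T" "T \<noteq> f"
proof -
  obtain T where T: "tri T" "e \<in> T" using assms(1) unfolding te_def by blast
  then have "T \<noteq> f" using assms(4) by (auto simp: tri_def)
  then show ?thesis using that T by blast
qed

text \<open>The triangles at the two edges are at distance at most 1, hence equal, and a triangle
  meets \<open>f\<close> in one edge only.\<close>

lemma te_far:
  assumes "f \<in> Fs" "8 \<le> card f" "e \<in> f" "e' \<in> f" "te e" "te e'" "u \<in> e" "v \<in> e'" "u = v \<or> {u, v} \<in> E"
  shows "e = e'"
proof -
  obtain T where T: "tri T" "e \<in> T" "T \<noteq> f" using te_tri[OF assms(5,3,1,2)] .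
  obtain T' where T': "tri T'" "e' \<in> T'" "T' \<noteq> f" using te_tri[OF assms(6,4,1,2)] .
  have "u \<in> \<Union> T" "v \<in> \<Union> T'" using assms(7,8) T(2) T'(2) by blast+
  then have "T = T'" using tri_unique[OF T(1) T'(1)] assms(9) by simp
  then show ?thesis using tri_meets_once[OF T(1) assms(1) T(3)[symmetric] T(2) assms(3) _ assms(4)] T' by simp
qed

lemma card_te_le1:
  assumes "f \<in> Fs" "8 \<le> card f" shows "card {e \<in> f. v \<in> e \<and> te e} \<le> 1"
proof -
  have "finite {e \<in> f. v \<in> e \<and> te e}" using finite_face[OF assms(1)] by simp
  moreover have "e = e'" if "e \<in> {e \<in> f. v \<in> e \<and> te e}" "e' \<in> {e \<in> f. v \<in> e \<and> te e}" for e e'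
    using te_far[OF assms, of e e' v v] that by simp
  ultimately show ?thesis by (simp add: card_le_Suc0_iff_eq)
qed

lemma needy_T0_nbr:
  assumes "needy g w" obtains T c where "tri T" "\<forall>v\<in>\<Union> T. light v" "c \<in> \<Union> T" "{w, c} \<in> E"
proof -
  obtain c1 c2 c3 c4 c5 c6 c7 where c: "g = cedges [w, c1, c2, c3, c4, c5, c6, c7]"
    "cyc E [w, c1, c2, c3, c4, c5, c6, c7]" "\<forall>v\<in>{c1, c2, c3, c4, c5, c6, c7}. light v"
    "se {w, c1}" "T0 {c2, c3}" "se {c4, c5}" "T0 {c6, c7}" by (rule needyE[OF assms])
  obtain T where T: "tri T" "{c6, c7} \<in> T" "\<forall>v\<in>\<Union> T. light v" using c(7) unfolding T0_def by blast
  have "{w, c7} \<in> E" using c(2) by (auto simp: cyc_def cedges_def insert_commute)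
  moreover have "c7 \<in> \<Union> T" using T(2) by blast
  ultimately show ?thesis using that[OF T(1,3)] by blast
qed

lemma heavy4_not_light: "heavy4 v \<Longrightarrow> \<not> light v"
  using light_neq(5,6)[of v] by auto

text \<open>A triangle through \<open>w\<close> would be too close to the all-light triangle
  adjacent to \<open>w\<close>, so it would be that triangle, and \<open>w\<close> would be
  light.\<close>

lemma needy_not_tri:
  assumes "needy g w" "tri T" shows "w \<notin> \<Union> T"
proof
  assume w: "w \<in> \<Union> T"
  obtain T' c where T': "tri T'" "\<forall>v\<in>\<Union> T'. light v" "c \<in> \<Union> T'" "{w, c} \<in> E" using needy_T0_nbr[OF assms(1)] .
  have "T = T'" using tri_unique[OF assms(2) T'(1) w T'(3)] T'(4) by blast
  then have "light w" using w T'(2) by blast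
  then show False using assms(1) heavy4_not_light by (auto simp: needy_def)
qed

lemma N_empty_req: "N w = {} \<Longrightarrow> req w f = 0"
  by (auto simp: req_def N_def)

lemma needy_smallat: "needy f w \<Longrightarrow> smallat f w"
proof -
  assume n: "needy f w"
  obtain c1 c2 c3 c4 c5 c6 c7 where "f = cedges [w, c1, c2, c3, c4, c5, c6, c7]"
    "cyc E [w, c1, c2, c3, c4, c5, c6, c7]" "\<forall>v\<in>{c1, c2, c3, c4, c5, c6, c7}. light v"
    "se {w, c1}" "T0 {c2, c3}" "se {c4, c5}" "T0 {c6, c7}" by (rule needyE[OF n])
  then show ?thesis unfolding smallat_def by (intro bexI[of _ "{w, c1}"]) (auto simp: cedges_def)
qed

lemma smallat_inc: "smallat f w \<longleftrightarrow> (\<exists>e\<in>inc f w. se e)"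
  by (auto simp: smallat_def inc_def)

text \<open>The face \<open>Q\<close> is too short to be needy, and \<open>h\<close> has no small
  edge at \<open>w\<close>.\<close>

lemma needy_N:
  assumes "needy f w" and S: "faces_at w = {f, Q, B, h}" "card Q \<le> 4" "inc h w = {{w, u}, {w, c7}}" "\<not> se {w, u}" "\<not> se {w, c7}"
  shows "N w = {f} \<or> N w = {f, B}"
proof -
  have "g \<in> {f, B}" if "g \<in> N w" for g
  proof -
    have g: "needy g w" using that by (simp add: N_def)
    then have "g \<in> Fs" by (simp add: needy_def)
    moreover have "w \<in> \<Union> g" using needy_smallat[OF g] by (auto simp: smallat_def)
    ultimately have "g \<in> {f, Q, B, h}" using S(1) by (auto simp: faces_at_def)
    moreover have "g \<noteq> Q" using needy_card[OF g] S(2) by auto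
    moreover have "g \<noteq> h" using needy_smallat[OF g] S(3-5) by (auto simp: smallat_inc)
    ultimately show ?thesis by blast
  qed
  moreover have "f \<in> N w" using assms(1) by (simp add: N_def)
  ultimately show ?thesis by blast
qed

text \<open>With \<open>g\<close> as the only needy face, the other big face with a small edge at
  \<open>w\<close> is \<open>B\<close>, whose edge to \<open>z\<close> is small and whose edge to
  \<open>u\<close> is not.\<close>

lemma req_small:
  assumes "f \<in> Fs" "8 \<le> card f" "w \<in> \<Union> f" "req w f = 1 / 6"
  obtains a b where "a \<noteq> b" "inc f w = {{w, a}, {w, b}}" "se {w, a}" "\<not> se {w, b}"
proof -
  have r: "\<not> needy f w" "card (N w) = 1" "smallat f w" using assms(4) by (auto simp: req_def split: if_splits)
  then obtain g where "N w = {g}" by (auto simp: card_1_singleton_iff)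
  then have g: "needy g w" by (auto simp: N_def)
  obtain c1 c2 c3 c4 c5 c6 c7 z u Q B h where
    gl: "g = cedges [w, c1, c2, c3, c4, c5, c6, c7]" and gc: "cyc E [w, c1, c2, c3, c4, c5, c6, c7]" and
    lt: "\<forall>v\<in>{c1, c2, c3, c4, c5, c6, c7}. light v" and T23: "T0 {c2, c3}" and T67: "T0 {c6, c7}" and
    ds: "distinct [c1, c7, z, u]" and nw: "nbrs E w = {c1, c7, z, u}" and
    F: "Q \<in> Fs" "B \<in> Fs" "h \<in> Fs" and dF: "distinct [g, Q, B, h]" and
    S: "faces_at w = {g, Q, B, h}" and ig: "inc g w = {{w, c1}, {w, c7}}" and iQ: "inc Q w = {{w, c1}, {w, z}}" and
    iB: "inc B w = {{w, z}, {w, u}}" and ih: "inc h w = {{w, u}, {w, c7}}" and Q4: "card Q \<le> 4" and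
    B8: "8 \<le> card B" and h8: "8 \<le> card h" and se: "se {w, z}" "\<not> se {w, u}" "\<not> se {w, c7}"
    by (rule needy_structure[OF g])
  have "f \<in> {g, Q, B, h}" using S assms by (auto simp: faces_at_def)
  moreover have "f \<noteq> g" "f \<noteq> Q" using r g assms Q4 by auto
  moreover have "f \<noteq> h" using r(3) ih se by (auto simp: smallat_inc)
  ultimately have "f = B" by blast
  then show ?thesis using that[of z u] ds iB se by simp
qed

lemma T0_edge_of_face:
  assumes "tri T" "\<forall>v\<in>\<Union> T. light v" "c \<in> \<Union> T" "h \<in> Fs" "c \<in> \<Union> h"
  obtains y where "{c, y} \<in> T" "{c, y} \<in> h" "T0 {c, y}"
proof -
  obtain y where "{c, y} \<in> T" "{c, y} \<in> h" using light_share[OF _ tri_in_Fs[OF assms(1)] assms(4,3,5)] assms by blast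
  then show ?thesis using that[of y] assms by (auto simp: T0_def)
qed

text \<open>The face asked for 1/3 is \<open>h\<close>, between the needy faces \<open>g\<close> and
  \<open>B\<close>. Its neighbours of \<open>w\<close> are light vertices of all-light triangles,
  and each of these triangles has an edge on \<open>h\<close>. The last claim gives \<open>h\<close>
  room to pay; without it \<open>opposite_face_reduction\<close> would apply.\<close>

lemma req_large:
  assumes "f \<in> Fs" "8 \<le> card f" "w \<in> \<Union> f" "req w f = 1 / 3"
  obtains a b y y' where "a \<noteq> b" "inc f w = {{w, a}, {w, b}}" "{a, y} \<in> f" "T0 {a, y}" "{b, y'} \<in> f" "T0 {b, y'}"
    "card f \<noteq> 8 \<or> (\<exists>v\<in>\<Union> f. v \<noteq> w \<and> \<not> light v)"
proof -
  have r: "\<not> needy f w" "card (N w) = 2" "\<not> smallat f w" using assms(4) by (auto simp: req_def split: if_splits)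
  then obtain g where g: "needy g w" unfolding N_def by (metis card.empty empty_Collect_eq zero_neq_numeral)
  obtain c1 c2 c3 c4 c5 c6 c7 z u Q B h where
    gl: "g = cedges [w, c1, c2, c3, c4, c5, c6, c7]" and gc: "cyc E [w, c1, c2, c3, c4, c5, c6, c7]" and
    lt: "\<forall>v\<in>{c1, c2, c3, c4, c5, c6, c7}. light v" and T23: "T0 {c2, c3}" and T67: "T0 {c6, c7}" and
    ds: "distinct [c1, c7, z, u]" and nw: "nbrs E w = {c1, c7, z, u}" and
    F: "Q \<in> Fs" "B \<in> Fs" "h \<in> Fs" and dF: "distinct [g, Q, B, h]" and
    S: "faces_at w = {g, Q, B, h}" and ig: "inc g w = {{w, c1}, {w, c7}}" and iQ: "inc Q w = {{w, c1}, {w, z}}" and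
    iB: "inc B w = {{w, z}, {w, u}}" and ih: "inc h w = {{w, u}, {w, c7}}" and Q4: "card Q \<le> 4" and
    B8: "8 \<le> card B" and h8: "8 \<le> card h" and se: "se {w, z}" "\<not> se {w, u}" "\<not> se {w, c7}"
    by (rule needy_structure[OF g])
  have gF: "g \<in> Fs" and w: "heavy4 w" using g by (auto simp: needy_def)
  have "N w = {g} \<or> N w = {g, B}" using needy_N[OF g S Q4 ih se(2,3)] .
  then have NB: "N w = {g, B}" using r(2) by auto
  then have Bn: "needy B w" by (auto simp: N_def)
  have "f \<in> {g, Q, B, h}" using S assms by (auto simp: faces_at_def)
  then have fh: "f = h" using r(1) g Bn assms(2) Q4 by auto
  obtain T where T: "tri T" "{c6, c7} \<in> T" "\<forall>v\<in>\<Union> T. light v" using T67 by (auto simp: T0_def)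
  have eh: "{w, u} \<in> h" "{w, c7} \<in> h" using ih by (auto simp: inc_def)
  obtain y where y: "{c7, y} \<in> T" "{c7, y} \<in> h" "T0 {c7, y}"
    by (rule T0_edge_of_face[OF T(1,3), of c7 h]) (use T(2) eh F in auto)
  obtain b1 b2 b3 b4 b5 b6 b7 where bl: "B = cedges [w, b1, b2, b3, b4, b5, b6, b7]"
    and bc: "cyc E [w, b1, b2, b3, b4, b5, b6, b7]" and "\<forall>v\<in>{b1, b2, b3, b4, b5, b6, b7}. light v"
    and bs: "se {w, b1}" and "T0 {b2, b3}" and "se {b4, b5}" and bT: "T0 {b6, b7}"
    by (rule needyE[OF Bn])
  have eb: "{w, b1} \<in> inc B w" "{w, b7} \<in> inc B w" "b1 \<noteq> b7"
    using bc unfolding bl by (auto simp: inc_def cedges_def cyc_def insert_commute)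
  then have b7: "b7 = u" using bs se unfolding iB by (auto simp: doubleton_eq_iff)
  obtain T' where T': "tri T'" "{b6, b7} \<in> T'" "\<forall>v\<in>\<Union> T'. light v" using bT by (auto simp: T0_def)
  obtain y' where y': "{u, y'} \<in> T'" "{u, y'} \<in> h" "T0 {u, y'}"
    by (rule T0_edge_of_face[OF T'(1,3), of u h]) (use T'(2) eh F b7 in auto)
  have R: False if h8': "card h = 8" and lth: "\<And>v. v \<in> \<Union> h \<Longrightarrow> v \<noteq> w \<Longrightarrow> light v"
  proof -
    have "{c7, w} \<in> h" using eh by (simp add: insert_commute)
    then obtain r where r: "cyc E (c7 # w # r)" "h = cedges (c7 # w # r)" by (rule face_list[OF F(3)])
    then have lr: "length r = 6" using face_len[OF F(3) r] h8' by simp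
    then obtain d2 d3 d4 d5 d6 d7 where rd: "r = [d2, d3, d4, d5, d6, d7]"
      by (auto simp: length_Suc_conv eval_nat_numeral)
    have dd: "distinct [c7, w, d2, d3, d4, d5, d6, d7]" using r(1) rd by (simp add: cyc_def)
    have eh': "{w, d2} \<in> h" "{c7, d7} \<in> h" unfolding r(2) rd by (auto simp: cedges_def insert_commute)
    then have "{w, d2} \<in> inc h w" by (simp add: inc_def)
    then have d2: "d2 = u" using dd unfolding ih by (auto simp: doubleton_eq_iff)
    have e67: "{c6, c7} \<in> g" "{w, c7} \<in> g" "{w, c1} \<in> g" "{c2, c3} \<in> g" "{c1, c2} \<in> g"
      unfolding gl by (auto simp: cedges_def insert_commute)
    have T3: "card T = 3" "T \<in> Fs" using T(1) by (auto simp: tri_def)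
    have g8: "card g = 8" using needy_card[OF g] .
    obtain x' where x': "triE E c6 c7 x'" "T = {{c6, c7}, {c7, x'}, {c6, x'}}" "distinct [c6, c7, x']" "\<Union> T = {c6, c7, x'}"
      by (rule tri_triangle[OF T(1,2)])
    have n67: "{c6, c7} \<notin> h"
    proof
      assume "{c6, c7} \<in> h"
      moreover have "g \<noteq> T" using T3 g8 by auto
      ultimately have "h = g \<or> h = T" using third_face[OF gF T3(2) F(3) e67(1) T(2)] by metis
      moreover have "h \<noteq> T" using T3 h8 by auto
      ultimately show False using dF by simp
    qed
    \<comment> \<open>Of the two triangle edges at \<open>c7\<close>, \<open>{c6, c7}\<close>
      already lies on \<open>g\<close> and on the triangle itself, so the one on \<open>h\<close>
      leads to the apex \<open>x'\<close>.\<close>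
    have "y = x'" using y(1,2) n67 x'(2,3) by (auto simp: doubleton_eq_iff insert_commute)
    then have xh: "{c7, x'} \<in> h" using y(2) by simp
    have "inc h c7 = {{c7, w}, {c7, d7}}" by (rule face_inc_pair[OF F(3)]) (use \<open>{c7, w} \<in> h\<close> eh' dd in auto)
    then have "x' = w \<or> x' = d7" using inc_pairD xh by metis
    moreover have "x' \<noteq> w" using needy_not_tri[OF g T(1)] x'(4) by auto
    ultimately have d7: "d7 = x'" by simp
    have hc: "cyc E [c7, w, u, d3, d4, d5, d6, x']" using r(1) rd d2 d7 by simp
    have hl: "h = cedges [c7, w, u, d3, d4, d5, d6, x']" using r(2) rd d2 d7 by simp
    have hv: "\<Union> h = set [c7, w, u, d3, d4, d5, d6, x']" unfolding hl by (rule cedges_Union) simp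
    have r1: "cyc E [w, u, d3, d4, d5, d6, x', c7]" using cyc_rotate[of E 1 "[c7, w, u, d3, d4, d5, d6, x']"] hc by simp
    have notin: "v \<notin> \<Union> h" if "{w, v} \<in> E" "v \<notin> {u, c7}" for v
    proof
      assume "v \<in> \<Union> h"
      then have "{w, v} \<in> cedges [w, u, d3, d4, d5, d6, x', c7]" using chordless8[OF r1, of w v] hv that(1) by auto
      then have "{w, v} \<in> h" unfolding hl using cedges_rotate[of 1 "[c7, w, u, d3, d4, d5, d6, x']"] by simp
      then show False using that(2) inc_pairD[OF ih] by blast
    qed
    have c1h: "c1 \<notin> \<Union> h" "z \<notin> \<Union> h" using notin[of c1] notin[of z] nw ds by (auto simp: edge_nbrs)
    obtain x where x: "triE E c2 c3 x" "light x"
    proof -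
      obtain T2 where T2: "tri T2" "{c2, c3} \<in> T2" "\<forall>v\<in>\<Union> T2. light v" using T23 by (auto simp: T0_def)
      then show ?thesis using tri_triangle[OF T2(1,2)] that by (metis insert_iff)
    qed
    have c2h: "c2 \<notin> \<Union> h"
    proof
      assume c2: "c2 \<in> \<Union> h"
      obtain T2 where T2: "tri T2" "{c2, c3} \<in> T2" using T23 by (auto simp: T0_def)
      have T2F: "T2 \<in> Fs" "card T2 = 3" using T2 by (auto simp: tri_def)
      have "light c2" using lt by simp
      then obtain v where v: "{c2, v} \<in> g" "{c2, v} \<in> h" using light_share[of c2 g h] gF F(3) e67(4) c2 by blast
      have "inc g c2 = {{c2, c1}, {c2, c3}}"
        by (rule face_inc_pair[OF gF]) (use e67 gc in \<open>auto simp: insert_commute cyc_def\<close>)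
      then have "v = c1 \<or> v = c3" using inc_pairD v(1) by metis
      moreover have "v \<noteq> c1" using v(2) c1h by auto
      moreover have "v \<noteq> c3"
      proof
        assume "v = c3"
        then have "{c2, c3} \<in> h" using v(2) by simp
        moreover have "g \<noteq> T2" using T2F g8 by auto
        ultimately have "h = g \<or> h = T2" using third_face[OF gF T2F(1) F(3) e67(4) T2(2)] by metis
        moreover have "h \<noteq> T2" using T2F h8 by auto
        ultimately show False using dF by simp
      qed
      ultimately show False by blast
    qed
    have eQ: "{w, c1} \<in> Q" "{w, z} \<in> Q" using iQ by (auto simp: inc_def)
    \<comment> \<open>If \<open>Q\<close> were a triangle, it would contain \<open>w\<close> and be
      too close to the triangle at \<open>c7\<close>.\<close>
    have Q4': "card Q = 4"
    proof (rule ccontr)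
      assume "card Q \<noteq> 4"
      then have "card Q = 3" using Q4 face_card[OF F(1)] by auto
      moreover have "w \<noteq> v0" using w light_neq by auto
      moreover have "v0 \<notin> \<Union> Q"
      proof
        assume "v0 \<in> \<Union> Q"
        obtain x where "triE E w c1 x" "Q = {{w, c1}, {c1, x}, {w, x}}" using three_face[OF F(1) \<open>card Q = 3\<close> eQ(1)] .
        then have tr: "triE E w c1 x" by simp
        have "{w, c1, x} \<noteq> {c6, c7, x'}" using needy_not_tri[OF g T(1)] x'(4) by auto
        then show False using tri_far[OF tr x'(1), of w c7] e67(2) gF face_sub by blast
      qed
      ultimately have "tri Q" using F(1) by (simp add: tri_def)
      then show False using needy_not_tri[OF g] eQ by blast
    qed
    obtain p q where pq: "cyc E [w, c1, p, q]" "Q = {{w, c1}, {c1, p}, {p, q}, {q, w}}" using four_face[OF F(1) Q4' eQ(1)] .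
    have qz: "q = z"
    proof -
      have "{w, q} \<in> inc Q w" using pq by (auto simp: inc_def insert_commute)
      moreover have "q \<noteq> c1" "q \<noteq> w" using pq by (auto simp: cyc_def)
      ultimately show ?thesis unfolding iQ by (auto simp: doubleton_eq_iff)
    qed
    have pw: "p \<noteq> w" "p \<noteq> c1" "p \<noteq> z" using pq qz by (auto simp: cyc_def)
    \<comment> \<open>A light \<open>p\<close> on both \<open>Q\<close> and \<open>h\<close> would
      make them share an edge at \<open>p\<close>, and so put \<open>c1\<close> or \<open>z\<close>
      on \<open>h\<close>.\<close>
    have ph: "p \<notin> \<Union> h"
    proof
      assume p: "p \<in> \<Union> h"
      then have "light p" using lth pw by blast
      then obtain v where v: "{p, v} \<in> Q" "{p, v} \<in> h" using light_share[of p Q h] F p pq by blast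
      have "inc Q p = {{p, c1}, {p, z}}"
        by (rule face_inc_pair[OF F(1)]) (use pq qz ds in \<open>auto simp: insert_commute\<close>)
      then have "v = c1 \<or> v = z" using inc_pairD v(1) by metis
      then show False using v(2) c1h by auto
    qed
    have eQE: "{c1, p} \<in> E" "{p, z} \<in> E" "{z, w} \<in> E" using pq qz by (auto simp: cyc_def cedges_def)
    show False
    proof (rule opposite_face_reduction[OF gc w lt[rule_format] eQE pw(1) _ x x'(1) hc])
      show "z \<notin> {c1, c7, u}" using ds by auto
      show "light v" if "v \<in> {u, d3, d4, d5, d6, x'}" for v
        using lth[of v] that hv dd d2 d7 by auto
      show "c1 \<notin> set [c7, w, u, d3, d4, d5, d6, x']" "c2 \<notin> set [c7, w, u, d3, d4, d5, d6, x']"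
        "p \<notin> set [c7, w, u, d3, d4, d5, d6, x']" using c1h(1) c2h ph unfolding hv by blast+
    qed
  qed
  show ?thesis
    by (rule that[of u c7 y' y]) (use ds ih fh y y' R in auto)
qed

lemma ych_light: "light v \<Longrightarrow> ych f v = (if smallat f v then 1 / 2 else 1 / 3)"
  by (simp add: ych_def xch_def \<eta>_def)

lemma req_cases: "req w f \<in> {- 1 / 6, 0, 1 / 6, 1 / 3}"
  by (auto simp: req_def)

text \<open>At a triangle edge \<open>\<eta>\<close> contributes 1/2, and \<open>req\<close>
  vanishes because a vertex of a triangle has no needy face. This gives 1/2 for a 4-vertex and 1/2 -
  1/6 - 1/6 otherwise.\<close>

lemma ych_heavy:
  assumes "f \<in> Fs" "8 \<le> card f" "v \<in> \<Union> f" "\<not> light v"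
  shows "\<And>e. e \<in> f \<Longrightarrow> v \<in> e \<Longrightarrow> te e \<Longrightarrow> ych f v = (if heavy4 v then 1 / 2 else 1 / 6)"
    and "(\<And>e. e \<in> f \<Longrightarrow> v \<in> e \<Longrightarrow> \<not> te e) \<Longrightarrow> ych f v = (if heavy4 v then req v f else - 1 / 6)"
proof -
  have fin: "finite {e \<in> f. v \<in> e \<and> te e}" using finite_face[OF assms(1)] by simp
  fix e assume e: "e \<in> f" "v \<in> e" "te e"
  then have "card {e \<in> f. v \<in> e \<and> te e} \<noteq> 0" using fin by auto
  then have c1: "card {e \<in> f. v \<in> e \<and> te e} = 1" using card_te_le1[OF assms(1,2), of v] by simp
  obtain T where T: "tri T" "e \<in> T" using e(3) by (auto simp: te_def)
  have "N v = {}" using needy_not_tri[OF _ T(1), of _ v] T(2) e(2) by (auto simp: N_def)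
  then have r0: "req v f = 0" by (rule N_empty_req)
  show "ych f v = (if heavy4 v then 1 / 2 else 1 / 6)"
    using assms(4) unfolding ych_def xch_def \<eta>_def c1 by (simp add: r0)
next
  assume "\<And>e. e \<in> f \<Longrightarrow> v \<in> e \<Longrightarrow> \<not> te e"
  then have "{e \<in> f. v \<in> e \<and> te e} = {}" by blast
  then have "card {e \<in> f. v \<in> e \<and> te e} = 0" by (metis card.empty)
  then show "ych f v = (if heavy4 v then req v f else - 1 / 6)"
    using assms(4) by (simp add: ych_def xch_def \<eta>_def)
qed

lemma ych_le_half:
  assumes "f \<in> Fs" "8 \<le> card f" "v \<in> \<Union> f" shows "ych f v \<le> 1 / 2"
proof (cases "light v")
  case False
  then show ?thesis
  proof (cases "\<exists>e\<in>f. v \<in> e \<and> te e")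
    case True
    then show ?thesis using ych_heavy(1)[OF assms False] by auto
  next
    case n: False
    then have "ych f v = (if heavy4 v then req v f else - 1 / 6)" using ych_heavy(2)[OF assms False] by blast
    then show ?thesis using req_cases[of v f] by auto
  qed
qed (simp add: ych_light)

lemma ych_nontri_heavy:
  assumes "f \<in> Fs" "8 \<le> card f" "v \<in> \<Union> f" "\<not> light v" "\<And>e. e \<in> f \<Longrightarrow> v \<in> e \<Longrightarrow> \<not> te e"
  shows "ych f v \<le> 1 / 3"
  using ych_heavy(2)[OF assms] req_cases[of v f] by auto

end

lemma sum_rotate:
  fixes s :: "nat \<Rightarrow> nat"
  assumes "0 < k" shows "(\<Sum>i<k. s (Suc i mod k)) = (\<Sum>i<k. s i)"
proof -
  obtain m where m: "k = Suc m" using assms gr0_conv_Suc by auto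
  have "(\<Sum>i<m. s (Suc i mod Suc m)) = (\<Sum>i<m. s (Suc i))" by (intro sum.cong) auto
  then show ?thesis unfolding m sum.lessThan_Suc_shift[of s m] by simp
qed

lemma pedges_split: "e \<in> pedges xs \<Longrightarrow> \<exists>us p q vs. xs = us @ p # q # vs \<and> e = {p, q}"
proof (induction xs rule: pedges.induct)
  case (1 x y xs)
  show ?case
  proof (cases "e = {x, y}")
    case True then show ?thesis by (intro exI[of _ "[]"]) auto
  next
    case False
    then obtain us p q vs where "y # xs = us @ p # q # vs" "e = {p, q}" using 1 by auto
    then show ?thesis by (intro exI[of _ "x # us"]) auto
  qed
qed auto

lemma sum_le_half:
  fixes g :: "'a \<Rightarrow> real"
  assumes "finite S" "\<And>v. v \<in> S \<Longrightarrow> g v \<le> 1 / 2"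
  shows "sum g S \<le> card S / 2"
  using sum_bounded_above[of S g "1/2"] assms by simp

lemma sum_le_half_except:
  fixes g :: "'a \<Rightarrow> real"
  assumes "finite S" "\<And>v. v \<in> S \<Longrightarrow> g v \<le> 1 / 2" "w \<in> S"
  shows "sum g S \<le> (real (card S) - 1) / 2 + g w"
proof -
  have "sum g S = g w + sum g (S - {w})" using assms by (simp add: sum.remove)
  moreover have "sum g (S - {w}) \<le> card (S - {w}) / 2" using assms by (intro sum_le_half) auto
  moreover have "real (card (S - {w})) = real (card S) - 1"
  proof -
    have "0 < card S" using assms(1,3) card_gt_0_iff by blast
    then show ?thesis using assms(3) by (simp add: card_Diff_singleton of_nat_diff)
  qed
  ultimately show ?thesis by simp
qed

section \<open>Triangle edges on a big face and the gaps between them\<close>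

context critical_faces
begin

lemma face_card_vertices: "f \<in> Fs \<Longrightarrow> card (\<Union> f) = card f"
proof -
  assume f: "f \<in> Fs"
  then obtain c where c: "cyc E c" "f = cedges c" using face_cycle by blast
  have "c \<noteq> []" using c by (auto simp: cyc_def)
  then have "\<Union> f = set c" using cedges_Union c(2) by metis
  then show ?thesis using face_len[OF f c] c(1) distinct_card by (metis cyc_def)
qed

lemma te_path1:
  assumes "f \<in> Fs" "8 \<le> card f" "{a, b} \<in> f" "{b, c} \<in> f" "a \<noteq> c" "te {a, b}"
  shows "\<not> te {b, c}"
proof
  assume "te {b, c}"
  then have "{a, b} = {b, c}" using te_far[OF assms(1-4,6), of b b] by simp
  then show False using assms(5) by (auto simp: doubleton_eq_iff)
qed

lemma te_path2:
  assumes "f \<in> Fs" "8 \<le> card f" "{a, b} \<in> f" "{b, c} \<in> f" "{c, d} \<in> f" "distinct [a, b, c, d]" "te {a, b}"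
  shows "\<not> te {c, d}"
proof
  assume t: "te {c, d}"
  have "{b, c} \<in> E" using face_sub assms by blast
  then have "{a, b} = {c, d}" using te_far[OF assms(1-3,5,7) t, of b c] by simp
  then show False using assms(6) by (auto simp: doubleton_eq_iff)
qed

text \<open>Any three consecutive edges of a face contain at most one triangle edge; summing this
  over all positions counts every edge three times.\<close>

lemma count_te:
  assumes "f \<in> Fs" "8 \<le> card f" shows "3 * card {e \<in> f. te e} \<le> card f"
proof -
  obtain c where c: "cyc E c" "f = cedges c" using face_cycle assms by blast
  define k where "k = length c"
  have k: "card f = k" "8 \<le> k" using face_len[OF assms(1) c] assms(2) by (auto simp: k_def)
  have d: "distinct c" "3 \<le> length c" "c \<noteq> []" using c by (auto simp: cyc_def)
  let ?e = "\<lambda>i. {c ! i, c ! (Suc i mod k)}"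
  define s where "s i = (if te (?e i) then 1 else 0 :: nat)" for i
  have inj: "inj_on ?e {..<k}" using inj_on_cyc_edges[OF d(1,2)] by (simp add: k_def)
  have img: "f = ?e ` {..<k}" using cedges_nth[OF d(3)] c(2) by (simp add: k_def)
  have "card {e \<in> f. te e} = (\<Sum>e\<in>f. if te e then 1 else 0)"
    using finite_face[OF assms(1)] by (simp add: sum.If_cases Int_def)
  also have "\<dots> = (\<Sum>i<k. s i)" unfolding s_def img by (subst sum.reindex[OF inj]) simp
  finally have cs: "card {e \<in> f. te e} = (\<Sum>i<k. s i)" .
  have m: "Suc i mod k < k" for i using k by simp
  have nxt: "Suc i mod k = (if Suc i = k then 0 else Suc i)" if "i < k" for i using that by auto
  have nq: "a < k \<Longrightarrow> b < k \<Longrightarrow> (c ! a = c ! b) = (a = b)" for a b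
    using d(1) by (simp add: nth_eq_iff_index_eq k_def)
  have le1: "s i + s (Suc i mod k) + s (Suc (Suc i mod k) mod k) \<le> 1" if i: "i < k" for i
  proof -
    let ?j = "Suc i mod k" let ?l = "Suc ?j mod k" let ?n = "Suc ?l mod k"
    have lt: "?j < k" "?l < k" "?n < k" using m by auto
    have ne: "i \<noteq> ?j" "i \<noteq> ?l" "i \<noteq> ?n" "?j \<noteq> ?l" "?j \<noteq> ?n" "?l \<noteq> ?n"
      using nxt[OF i] nxt[OF lt(1)] nxt[OF lt(2)] k(2) i by (auto split: if_splits)
    have ef: "?e i \<in> f" "?e ?j \<in> f" "?e ?l \<in> f" using img i lt by auto
    have ds: "distinct [c ! i, c ! ?j, c ! ?l, c ! ?n]" using ne nq i lt by auto
    have "te (?e i) \<Longrightarrow> \<not> te (?e ?j)" using te_path1[OF assms ef(1,2)] ds by auto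
    moreover have "te (?e ?j) \<Longrightarrow> \<not> te (?e ?l)" using te_path1[OF assms ef(2,3)] ds by auto
    moreover have "te (?e i) \<Longrightarrow> \<not> te (?e ?l)" using te_path2[OF assms ef ds] by auto
    ultimately show ?thesis by (auto simp: s_def)
  qed
  have "(\<Sum>i<k. s i + s (Suc i mod k) + s (Suc (Suc i mod k) mod k)) \<le> (\<Sum>i<k. 1)"
    using le1 by (intro sum_mono) auto
  moreover have "(\<Sum>i<k. s (Suc i mod k)) = (\<Sum>i<k. s i)" using sum_rotate[of k s] k by simp
  moreover have "(\<Sum>i<k. s (Suc (Suc i mod k) mod k)) = (\<Sum>i<k. s (Suc i mod k))"
    using sum_rotate[of k "\<lambda>i. s (Suc i mod k)"] k by simp
  ultimately show ?thesis using cs k(1) by (simp add: sum.distrib)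
qed

lemma sum_\<kappa>:
  assumes "f \<in> Fs" "A \<subseteq> f" "\<And>e. e \<in> f - A \<Longrightarrow> \<kappa> e \<le> 0"
  shows "sum \<kappa> f \<le> sum \<kappa> A"
proof -
  have fin: "finite f" using finite_face assms by blast
  have "sum \<kappa> f = sum \<kappa> A + sum \<kappa> (f - A)" using sum.subset_diff[OF assms(2) fin, of \<kappa>] by simp
  moreover have "sum \<kappa> (f - A) \<le> 0" using assms(3) by (intro sum_nonpos) auto
  ultimately show ?thesis by simp
qed

lemma sum_\<kappa>_te: assumes "f \<in> Fs" shows "sum \<kappa> f \<le> card {e \<in> f. T0 e} / 3"
proof -
  have "sum \<kappa> f \<le> sum \<kappa> {e \<in> f. T0 e}" using \<kappa>_bounds(2) by (intro sum_\<kappa>[OF assms]) auto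
  also have "\<dots> \<le> card {e \<in> f. T0 e} * (1 / 3)" using \<kappa>_bounds(1) by (intro sum_bounded_above) auto
  finally show ?thesis by simp
qed

lemma T0_card_le: "f \<in> Fs \<Longrightarrow> card {e \<in> f. T0 e} \<le> card {e \<in> f. te e}"
  using finite_face T0_te by (intro card_mono) auto

lemma T0_light: assumes "T0 {a, b}" shows "light a" "light b"
  using assms unfolding T0_def by blast+

text \<open>The light vertex \<open>b\<close> has only one small face, the triangle, and that meets
  \<open>f\<close> in \<open>{a, b}\<close> alone.\<close>

lemma T0_no_small:
  assumes "f \<in> Fs" "8 \<le> card f" "{a, b} \<in> f" "{b, c} \<in> f" "a \<noteq> c" "T0 {a, b}"
  shows "\<not> se {b, c}"
proof
  assume "se {b, c}"
  then obtain g where g: "g \<in> Fs" "{b, c} \<in> g" "card g \<le> 4" by (auto simp: se_def)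
  obtain T where T: "tri T" "{a, b} \<in> T" using assms(6) by (auto simp: T0_def)
  have TF: "T \<in> Fs" "card T = 3" using T by (auto simp: tri_def)
  have "T = g" using light_one_small[of b T g] T0_light(2)[OF assms(6)] TF T(2) g by auto
  moreover have "f \<noteq> T" using TF assms(2) by auto
  ultimately have "{a, b} = {b, c}" using tri_meets_once[OF T(1) assms(1) _ T(2) assms(3) _ assms(4)] g by metis
  then show False using assms(5) by (auto simp: doubleton_eq_iff)
qed

lemma light_one_small_edge:
  assumes "f \<in> Fs" "8 \<le> card f" "{a, b} \<in> f" "{b, c} \<in> f" "a \<noteq> c" "light b" "se {a, b}"
  shows "\<not> se {b, c}"
proof
  assume "se {b, c}"
  then obtain g where g: "g \<in> Fs" "{b, c} \<in> g" "card g \<le> 4" by (auto simp: se_def)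
  obtain h where h: "h \<in> Fs" "{a, b} \<in> h" "card h \<le> 4" using assms(7) by (auto simp: se_def)
  have "h = g" using light_one_small[OF assms(6), of h g] g h by auto
  moreover have "f \<noteq> g" using g assms(2) by auto
  ultimately have "card (nbrs E b) = 2"
    using shared_pair_deg2[OF assms(1) g(1), of b a c] assms(3-5) g h by (simp add: insert_commute)
  then show False using light_neq(5)[OF assms(6)] by simp
qed

text \<open>Otherwise the face and the all-light triangle form the configuration of
  \<open>light_cycle_triangle\<close>.\<close>

lemma all_light_no_T0:
  assumes "f \<in> Fs" "8 \<le> card f" "e \<in> f" "T0 e" shows "\<exists>v\<in>\<Union> f. \<not> light v"
proof (rule ccontr)
  assume "\<not> ?thesis"
  then have lt: "\<And>v. v \<in> \<Union> f \<Longrightarrow> light v" by blast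
  obtain a b where ab: "e = {a, b}" using edge_vertex[OF assms(1,3)] by blast
  obtain T where T: "tri T" "{a, b} \<in> T" "\<forall>v\<in>\<Union> T. light v" using assms(4) ab by (auto simp: T0_def)
  obtain r where r: "cyc E (a # b # r)" "f = cedges (a # b # r)" using face_list assms(1,3) ab by metis
  obtain x where x: "triE E a b x" "T = {{a, b}, {b, x}, {a, x}}" "distinct [a, b, x]" "\<Union> T = {a, b, x}"
    using tri_triangle[OF T(1,2)] .
  have fv: "\<Union> f = set (a # b # r)" unfolding r(2) by (rule cedges_Union) simp
  show False
  proof (rule light_cycle_triangle[OF r(1) _ x(1)])
    show "light v" if "v \<in> set (a # b # r)" for v using lt fv that by blast
    show "light x" using T(3) x(4) by blast
    show "{a, x} \<notin> cedges (a # b # r)"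
    proof
      assume "{a, x} \<in> cedges (a # b # r)"
      then have "{a, x} \<in> f" "{a, x} \<in> T" using r(2) x(2) by auto
      moreover have "f \<noteq> T" using T(1) assms(2) by (auto simp: tri_def)
      ultimately have "{a, b} = {a, x}" using tri_meets_once[OF T(1) assms(1) _ T(2)] assms(3) ab by metis
      then show False using x(3) by (auto simp: doubleton_eq_iff)
    qed
  qed
qed

lemma nontri_vertex:
  assumes "f \<in> Fs" "8 \<le> card f" "{v, a} \<in> f" "{v, b} \<in> f" "a \<noteq> b" "\<not> te {v, a}" "\<not> te {v, b}"
  shows "light v \<Longrightarrow> ych f v = (if se {v, a} \<or> se {v, b} then 1 / 2 else 1 / 3)"
    and "\<not> light v \<Longrightarrow> ych f v = (if heavy4 v then req v f else - 1 / 6)"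
    and "\<not> light v \<Longrightarrow> ych f v \<le> 1 / 3"
proof -
  have i: "inc f v = {{v, a}, {v, b}}" using face_inc_pair[OF assms(1,3,4,5)] .
  have v: "v \<in> \<Union> f" using assms(3) by blast
  have nt: "\<not> te e" if "e \<in> f" "v \<in> e" for e
  proof -
    have "e \<in> inc f v" using that by (simp add: inc_def)
    then have "e = {v, a} \<or> e = {v, b}" unfolding i by simp
    then show ?thesis using assms(6,7) by auto
  qed
  show "light v \<Longrightarrow> ych f v = (if se {v, a} \<or> se {v, b} then 1 / 2 else 1 / 3)"
    using ych_light[of v f] smallat_inc[of f v] unfolding i by simp
  show "\<not> light v \<Longrightarrow> ych f v = (if heavy4 v then req v f else - 1 / 6)"
    using ych_heavy(2)[OF assms(1,2) v _ nt] by simp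
  show "\<not> light v \<Longrightarrow> ych f v \<le> 1 / 3" using ych_nontri_heavy[OF assms(1,2) v _ nt] by simp
qed

lemma gap_vertex:
  assumes "f \<in> Fs" "8 \<le> card f" "{v, a} \<in> f" "{v, b} \<in> f" "a \<noteq> b" "\<not> se {v, a}" "\<not> se {v, b}"
  shows "ych f v \<le> 1 / 3"
proof -
  have nt: "\<not> te {v, a}" "\<not> te {v, b}" using te_se assms(6,7) by blast+
  show ?thesis
  proof (cases "light v")
    case True then show ?thesis using nontri_vertex(1)[OF assms(1-5) nt] assms(6,7) by simp
  next
    case False then show ?thesis using nontri_vertex(3)[OF assms(1-5) nt] by simp
  qed
qed

lemma req_third_nbrs:
  assumes "f \<in> Fs" "8 \<le> card f" "{v, a} \<in> f" "{v, b} \<in> f" "a \<noteq> b" "req v f = 1 / 3"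
  shows "\<exists>y. {a, y} \<in> f \<and> T0 {a, y}" "\<exists>y. {b, y} \<in> f \<and> T0 {b, y}"
    "card f \<noteq> 8 \<or> (\<exists>u\<in>\<Union> f. u \<noteq> v \<and> \<not> light u)"
proof -
  have i: "inc f v = {{v, a}, {v, b}}" using face_inc_pair[OF assms(1,3,4,5)] .
  have v: "v \<in> \<Union> f" using assms(3) by blast
  obtain a' b' y y' where r: "a' \<noteq> b'" "inc f v = {{v, a'}, {v, b'}}" "{a', y} \<in> f" "T0 {a', y}" "{b', y'} \<in> f" "T0 {b', y'}"
    "card f \<noteq> 8 \<or> (\<exists>u\<in>\<Union> f. u \<noteq> v \<and> \<not> light u)"
    by (rule req_large[OF assms(1,2) v assms(6)])
  have "(a = a' \<or> a = b') \<and> (b = a' \<or> b = b')" using inc_pairD[OF r(2)] assms(3,4) by blast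
  then show "\<exists>y. {a, y} \<in> f \<and> T0 {a, y}" "\<exists>y. {b, y} \<in> f \<and> T0 {b, y}" using r(3-6) by blast+
  show "card f \<noteq> 8 \<or> (\<exists>u\<in>\<Union> f. u \<noteq> v \<and> \<not> light u)" by (rule r(7))
qed

lemma req_sixth_small:
  assumes "f \<in> Fs" "8 \<le> card f" "{v, a} \<in> f" "{v, b} \<in> f" "a \<noteq> b" "req v f = 1 / 6"
  shows "se {v, a} \<noteq> se {v, b}"
proof -
  have i: "inc f v = {{v, a}, {v, b}}" using face_inc_pair[OF assms(1,3,4,5)] .
  have v: "v \<in> \<Union> f" using assms(3) by blast
  obtain a' b' where r: "a' \<noteq> b'" "inc f v = {{v, a'}, {v, b'}}" "se {v, a'}" "\<not> se {v, b'}"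
    by (rule req_small[OF assms(1,2) v assms(6)])
  have "(a = a' \<or> a = b') \<and> (b = a' \<or> b = b')" using inc_pairD[OF r(2)] assms(3,4) by blast
  then show ?thesis using r(3,4) assms(5) by blast
qed

text \<open>A request of 1/3 would need an all-light triangle edge of \<open>f\<close> at
  \<open>a\<close>, and neither edge of \<open>f\<close> at \<open>a\<close> is a triangle edge. A
  request of 1/6 occurs only where exactly one of the two edges at \<open>v\<close> is
  small.\<close>

lemma heavy_sixth:
  assumes "f \<in> Fs" "8 \<le> card f" "{v, a} \<in> f" "{v, b} \<in> f" "a \<noteq> b" "\<not> te {v, a}" "\<not> te {v, b}" "\<not> light v"
    and "{a, c} \<in> f" "c \<noteq> v" "\<not> te {a, c}"
  shows "ych f v \<le> 1 / 6 \<and> (ych f v \<le> 0 \<or> se {v, a} \<noteq> se {v, b})"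
proof -
  have y: "ych f v = (if heavy4 v then req v f else - 1 / 6)" using nontri_vertex(2)[OF assms(1-7)] assms(8) by blast
  have "req v f \<noteq> 1 / 3"
  proof
    assume "req v f = 1 / 3"
    then obtain y where "{a, y} \<in> f" "T0 {a, y}" using req_third_nbrs(1)[OF assms(1-5)] by blast
    moreover have "inc f a = {{a, v}, {a, c}}"
      using face_inc_pair[OF assms(1), of a v c] assms(3,9,10) by (simp add: insert_commute)
    ultimately have "y = v \<or> y = c" using inc_pairD by metis
    then show False using \<open>T0 {a, y}\<close> T0_te assms(6,11) by (auto simp: insert_commute)
  qed
  then have "req v f \<le> 1 / 6" "req v f \<le> 0 \<or> req v f = 1 / 6" using req_cases[of v f] by auto
  then show ?thesis using y req_sixth_small[OF assms(1-5)] by (auto split: if_splits)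
qed

text \<open>The two triangle edges leave two gaps of two vertices. The critical case has
  \<open>a\<close>, \<open>b\<close>, \<open>d\<close> light with \<open>{w, a}\<close> and
  \<open>{b, d}\<close> small, where these three take 3/2. It is exactly the case in which
  \<open>needy\<close> makes a 4-vertex \<open>w\<close> pay 1/6; any other \<open>w\<close> that is
  not light pays 1/6 anyway.\<close>

lemma gap22:
  assumes f: "f \<in> Fs" "f = cedges [w, a, p, q, b, d, p', q']" and c: "cyc E [w, a, p, q, b, d, p', q']"
    and T: "T0 {p, q}" "T0 {p', q'}" and w: "\<not> light w"
  shows "ych f w + ych f a + ych f b + ych f d \<le> 4 / 3"
proof -
  have f8: "card f = 8" "8 \<le> card f" using face_len[OF f(1) c f(2)] by simp_all
  have ds: "distinct [w, a, p, q, b, d, p', q']" using c by (simp add: cyc_def)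
  have e: "{w, a} \<in> f" "{a, p} \<in> f" "{p, q} \<in> f" "{q, b} \<in> f" "{b, d} \<in> f" "{d, p'} \<in> f" "{p', q'} \<in> f" "{q', w} \<in> f"
    unfolding f(2) by (auto simp: cedges_def insert_commute)
  have e': "{a, w} \<in> f" "{p, a} \<in> f" "{q, p} \<in> f" "{b, q} \<in> f" "{d, b} \<in> f" "{p', d} \<in> f" "{q', p'} \<in> f" "{w, q'} \<in> f"
    using e by (simp_all add: insert_commute)
  have T': "T0 {q, p}" "T0 {q', p'}" using T by (simp_all add: insert_commute)
  have ns: "\<not> se {p, a}" "\<not> se {q, b}" "\<not> se {p', d}" "\<not> se {q', w}"
    using T0_no_small[OF f(1) f8(2) e'(3) e'(2) _ T'(1)] T0_no_small[OF f(1) f8(2) e(3,4) _ T(1)]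
      T0_no_small[OF f(1) f8(2) e'(7,6) _ T'(2)] T0_no_small[OF f(1) f8(2) e(7,8) _ T(2)] ds by auto
  have ns': "\<not> se {a, p}" "\<not> se {b, q}" "\<not> se {d, p'}" "\<not> se {w, q'}" using ns by (simp_all add: insert_commute)
  have nt: "\<not> te {a, p}" "\<not> te {b, q}" "\<not> te {d, p'}" "\<not> te {w, q'}" using ns' te_se by blast+
  have t1: "\<not> te {a, w}" using te_path2[OF f(1) f8(2) e'(3,2,1) _ T0_te[OF T'(1)]] ds by auto
  have t2: "\<not> te {b, d}" using te_path2[OF f(1) f8(2) e(3,4,5) _ T0_te[OF T(1)]] ds by simp
  have t': "\<not> te {w, a}" "\<not> te {d, b}" using t1 t2 by (simp_all add: insert_commute)
  have dd: "a \<noteq> q'" "w \<noteq> p" "d \<noteq> q" "b \<noteq> p'" using ds by auto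
  note Ya = nontri_vertex[OF f(1) f8(2) e'(1) e(2) dd(2) t1 nt(1)]
  note Yb = nontri_vertex[OF f(1) f8(2) e(5) e'(4) dd(3) t2 nt(2)]
  note Yd = nontri_vertex[OF f(1) f8(2) e'(5) e(6) dd(4) t'(2) nt(3)]
  note Yw = nontri_vertex[OF f(1) f8(2) e(1) e'(8) dd(1) t'(1) nt(4)]
  have Hw: "ych f w \<le> 1 / 6 \<and> (ych f w \<le> 0 \<or> se {w, a} \<noteq> se {w, q'})"
    using heavy_sixth[OF f(1) f8(2) e(1) e'(8) dd(1) t'(1) nt(4) w e(2) _ nt(1)] ds by auto
  have Ha: "\<not> light a \<Longrightarrow> ych f a \<le> 1 / 6"
    using heavy_sixth[OF f(1) f8(2) e'(1) e(2) dd(2) t1 nt(1) _ e'(8) _ nt(4)] ds by auto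
  have Hb: "\<not> light b \<Longrightarrow> ych f b \<le> 1 / 6"
    using heavy_sixth[OF f(1) f8(2) e(5) e'(4) dd(3) t2 nt(2) _ e(6) _ nt(3)] ds by auto
  have Hd: "\<not> light d \<Longrightarrow> ych f d \<le> 1 / 6"
    using heavy_sixth[OF f(1) f8(2) e'(5) e(6) dd(4) t'(2) nt(3) _ e'(4) _ nt(2)] ds by auto
  have half: "ych f a \<le> 1 / 2" "ych f b \<le> 1 / 2" "ych f d \<le> 1 / 2"
    using ych_le_half[OF f(1) f8(2)] e by blast+
  show ?thesis
  proof (cases "light a \<and> light b \<and> light d")
    case False
    then show ?thesis using Hw Ha Hb Hd half by linarith
  next
    case True
    have A: "ych f a = (if se {w, a} then 1 / 2 else 1 / 3)" using Ya(1) True ns' by (simp add: insert_commute)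
    have B: "ych f b = (if se {b, d} then 1 / 2 else 1 / 3)" using Yb(1) True ns' by simp
    have D: "ych f d = (if se {b, d} then 1 / 2 else 1 / 3)" using Yd(1) True ns' by (simp add: insert_commute)
    show ?thesis
    proof (cases "se {w, a} \<and> se {b, d}")
      case s: True
      have "ych f w \<le> - 1 / 6"
      proof (cases "heavy4 w")
        case h: True
        have "needy f w" unfolding needy_def using h f c True s T T0_light[OF T(1)] T0_light[OF T(2)] by blast
        then have "req w f = - 1 / 6" by (simp add: req_def)
        then show ?thesis using Yw(2)[OF w] h by simp
      qed (use Yw(2)[OF w] in simp)
      then show ?thesis using A B D by (auto split: if_splits)
    next
      case s: False
      then show ?thesis using A B D Hw ns'(4) by (auto split: if_splits)
    qed
  qed
qed

text \<open>The triangle edges leave gaps of one and of three vertices. A light \<open>b\<close> has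
  a small edge on at most one side, so \<open>a\<close>, \<open>b\<close>, \<open>d\<close> take at
  most 4/3 together if all are light. Then \<open>x\<close> is the only vertex that is not light,
  and \<open>req_third_nbrs\<close> and \<open>req_sixth_small\<close> leave it nothing
  positive.\<close>

lemma gap13:
  assumes f: "f \<in> Fs" "f = cedges [x, p, q, a, b, d, p', q']" and c: "cyc E [x, p, q, a, b, d, p', q']"
    and T: "T0 {p, q}" "T0 {p', q'}"
  shows "ych f x + ych f a + ych f b + ych f d \<le> 4 / 3"
proof -
  have f8: "card f = 8" "8 \<le> card f" using face_len[OF f(1) c f(2)] by simp_all
  have ds: "distinct [x, p, q, a, b, d, p', q']" using c by (simp add: cyc_def)
  have fv: "\<Union> f = set [x, p, q, a, b, d, p', q']" unfolding f(2) by (rule cedges_Union) simp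
  have e: "{x, p} \<in> f" "{p, q} \<in> f" "{q, a} \<in> f" "{a, b} \<in> f" "{b, d} \<in> f" "{d, p'} \<in> f" "{p', q'} \<in> f" "{q', x} \<in> f"
    unfolding f(2) by (auto simp: cedges_def insert_commute)
  have e': "{p, x} \<in> f" "{q, p} \<in> f" "{a, q} \<in> f" "{b, a} \<in> f" "{d, b} \<in> f" "{p', d} \<in> f" "{q', p'} \<in> f" "{x, q'} \<in> f"
    using e by (simp_all add: insert_commute)
  have T': "T0 {q, p}" "T0 {q', p'}" using T by (simp_all add: insert_commute)
  have ns: "\<not> se {p, x}" "\<not> se {q, a}" "\<not> se {p', d}" "\<not> se {q', x}"
    using T0_no_small[OF f(1) f8(2) e'(2) e'(1) _ T'(1)] T0_no_small[OF f(1) f8(2) e(2,3) _ T(1)]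
      T0_no_small[OF f(1) f8(2) e'(7,6) _ T'(2)] T0_no_small[OF f(1) f8(2) e(7,8) _ T(2)] ds by auto
  have ns': "\<not> se {x, p}" "\<not> se {a, q}" "\<not> se {d, p'}" "\<not> se {x, q'}" using ns by (simp_all add: insert_commute)
  have nt: "\<not> te {x, p}" "\<not> te {a, q}" "\<not> te {d, p'}" "\<not> te {x, q'}" using ns' te_se by blast+
  have t1: "\<not> te {a, b}" using te_path2[OF f(1) f8(2) e(2,3,4) _ T0_te[OF T(1)]] ds by simp
  have t2: "\<not> te {d, b}" using te_path2[OF f(1) f8(2) e'(7,6,5) _ T0_te[OF T'(2)]] ds by auto
  have t': "\<not> te {b, a}" "\<not> te {b, d}" using t1 t2 by (simp_all add: insert_commute)
  have dd: "p \<noteq> q'" "b \<noteq> q" "a \<noteq> d" "b \<noteq> p'" using ds by auto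
  note Ya = nontri_vertex[OF f(1) f8(2) e(4) e'(3) dd(2) t1 nt(2)]
  note Yb = nontri_vertex[OF f(1) f8(2) e'(4) e(5) dd(3) t'(1,2)]
  note Yd = nontri_vertex[OF f(1) f8(2) e'(5) e(6) dd(4) t2 nt(3)]
  note Yx = nontri_vertex[OF f(1) f8(2) e(1) e'(8) dd(1) nt(1,4)]
  have Ha: "\<not> light a \<Longrightarrow> ych f a \<le> 1 / 6 \<and> (ych f a \<le> 0 \<or> se {a, b} \<noteq> se {a, q})"
    using heavy_sixth[OF f(1) f8(2) e(4) e'(3) dd(2) t1 nt(2) _ e(5) _ t'(2)] ds by auto
  have Hb: "\<not> light b \<Longrightarrow> ych f b \<le> 1 / 6 \<and> (ych f b \<le> 0 \<or> se {b, a} \<noteq> se {b, d})"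
    using heavy_sixth[OF f(1) f8(2) e'(4) e(5) dd(3) t'(1,2) _ e'(3) _ nt(2)] ds by auto
  have Hd: "\<not> light d \<Longrightarrow> ych f d \<le> 1 / 6 \<and> (ych f d \<le> 0 \<or> se {d, b} \<noteq> se {d, p'})"
    using heavy_sixth[OF f(1) f8(2) e'(5) e(6) dd(4) t2 nt(3) _ e'(4) _ t'(1)] ds by auto
  have X3: "ych f x \<le> 1 / 3" using gap_vertex[OF f(1) f8(2) e(1) e'(8) dd(1) ns'(1,4)] .
  have half: "ych f a \<le> 1 / 2" "ych f b \<le> 1 / 2" "ych f d \<le> 1 / 2"
    using ych_le_half[OF f(1) f8(2)] e by blast+
  have A: "light a \<Longrightarrow> ych f a = (if se {a, b} then 1 / 2 else 1 / 3)" using Ya(1) ns' by simp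
  have B: "light b \<Longrightarrow> ych f b = (if se {a, b} \<or> se {b, d} then 1 / 2 else 1 / 3)" using Yb(1) by (simp add: insert_commute)
  have D: "light d \<Longrightarrow> ych f d = (if se {b, d} then 1 / 2 else 1 / 3)" using Yd(1) ns' by (simp add: insert_commute)
  have one: "light b \<Longrightarrow> \<not> (se {a, b} \<and> se {b, d})" using light_one_small_edge[OF f(1) f8(2) e(4,5) dd(3)] by blast
  have sw: "se {b, a} = se {a, b}" "se {d, b} = se {b, d}" by (simp_all add: insert_commute)
  consider (none) "light a" "light b" "light d" | (a) "\<not> light a" "light b" "light d"
    | (b) "light a" "\<not> light b" "light d" | (d) "light a" "light b" "\<not> light d"
    | (many) "\<not> light a \<and> \<not> light b \<or> \<not> light a \<and> \<not> light d \<or> \<not> light b \<and> \<not> light d" by blast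
  then show ?thesis
  proof cases
    case none
    have "\<exists>v\<in>\<Union> f. \<not> light v" using all_light_no_T0[OF f(1) f8(2) e(2) T(1)] .
    then have xh: "\<not> light x" using none T0_light[OF T(1)] T0_light[OF T(2)] unfolding fv by auto
    have "\<not> (\<exists>u\<in>\<Union> f. u \<noteq> x \<and> \<not> light u)" using none T0_light[OF T(1)] T0_light[OF T(2)] unfolding fv by auto
    then have "req x f \<noteq> 1 / 3" using req_third_nbrs(3)[OF f(1) f8(2) e(1) e'(8) dd(1)] f8(1) by blast
    moreover have "req x f \<noteq> 1 / 6" using req_sixth_small[OF f(1) f8(2) e(1) e'(8) dd(1)] ns'(1,4) by blast
    ultimately have "ych f x \<le> 0" using Yx(2)[OF xh] req_cases[of x f] by auto
    then show ?thesis using A B D one none half by (auto split: if_splits)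
  next
    case a
    then show ?thesis using X3 B D one Ha ns'(2) by (auto split: if_splits)
  next
    case b
    then show ?thesis using X3 A D Hb sw by (auto split: if_splits)
  next
    case d
    then show ?thesis using X3 A B one Hd ns'(3) sw by (auto split: if_splits)
  next
    case many
    then show ?thesis using X3 Ha Hb Hd half by linarith
  qed
qed

end

section \<open>Faces of length 8 and 9, and the bound for all big faces\<close>

context critical_faces
begin

text \<open>On an 8-cycle the gaps have 1 and 3 or 2 and 2 vertices. The four ends of the triangle
  edges take at most 1/2 each and the gap vertices at most 4/3 together, which leaves 2/3 for the
  two triangles.\<close>

lemma face8_two_T0:
  assumes f: "f \<in> Fs" "card f = 8" and e: "e0 \<in> f" "e1 \<in> f" "T0 e0" "T0 e1" "e0 \<noteq> e1"
  shows "sum (ych f) (\<Union> f) \<le> 10 / 3"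
proof -
  have f8: "8 \<le> card f" using f by simp
  obtain p q where pq: "e0 = {p, q}" using edge_vertex[OF f(1) e(1)] by blast
  obtain r where r: "cyc E (p # q # r)" "f = cedges (p # q # r)" using face_list[OF f(1)] e(1) pq by metis
  have "length r = 6" using face_len[OF f(1) r] f(2) by simp
  then obtain r1 r2 r3 r4 r5 r6 where rr: "r = [r1, r2, r3, r4, r5, r6]"
    by (auto simp: length_Suc_conv eval_nat_numeral)
  let ?c = "[p, q, r1, r2, r3, r4, r5, r6]"
  have c: "cyc E ?c" and fc: "f = cedges ?c" using r rr by auto
  have ds: "distinct ?c" using c by (simp add: cyc_def)
  have fv: "\<Union> f = set ?c" unfolding fc by (rule cedges_Union) simp
  have S: "sum (ych f) (\<Union> f) = ych f p + ych f q + ych f r1 + ych f r2 + ych f r3 + ych f r4 + ych f r5 + ych f r6"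
    unfolding fv using ds by simp
  have ed: "{p, q} \<in> f" "{q, r1} \<in> f" "{r1, r2} \<in> f" "{p, r6} \<in> f" "{r6, r5} \<in> f" "{q, p} \<in> f"
    unfolding fc by (auto simp: cedges_def insert_commute)
  have half: "ych f v \<le> 1 / 2" if "v \<in> set ?c" for v using ych_le_half[OF f(1) f8] that fv by blast
  have t: "te {p, q}" "te {q, p}" using T0_te[OF e(3)] pq by (simp_all add: insert_commute)
  have x1: "\<not> te {q, r1}" using te_path1[OF f(1) f8 ed(1,2) _ t(1)] ds by auto
  have x2: "\<not> te {r1, r2}" using te_path2[OF f(1) f8 ed(1,2,3) _ t(1)] ds by auto
  have x3: "\<not> te {p, r6}" using te_path1[OF f(1) f8 ed(6,4) _ t(2)] ds by auto
  have x4: "\<not> te {r6, r5}" using te_path2[OF f(1) f8 ed(6,4,5) _ t(2)] ds by auto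
  have "e1 \<in> {{p, q}, {q, r1}, {r1, r2}, {r2, r3}, {r3, r4}, {r4, r5}, {r6, r5}, {p, r6}}"
    using e(2) unfolding fc by (simp add: cedges_def insert_commute)
  then consider "e1 = {r2, r3}" | "e1 = {r3, r4}" | "e1 = {r4, r5}"
    using x1 x2 x3 x4 T0_te[OF e(4)] e(5) pq by auto
  then show ?thesis
  proof cases
    case 1
    have "cyc E [r1, r2, r3, r4, r5, r6, p, q]" "f = cedges [r1, r2, r3, r4, r5, r6, p, q]"
      using c fc cyc_rotate[of E 2 ?c] cedges_rotate[of 2 ?c] by (simp_all add: numeral_2_eq_2)
    then have "ych f r1 + ych f r4 + ych f r5 + ych f r6 \<le> 4 / 3"
      using gap13[OF f(1)] e pq 1 by blast
    then show ?thesis unfolding S using half[of p] half[of q] half[of r2] half[of r3] by simp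
  next
    case 3
    have "cyc E [r6, p, q, r1, r2, r3, r4, r5]" "f = cedges [r6, p, q, r1, r2, r3, r4, r5]"
      using c fc cyc_rotate[of E 7 ?c] cedges_rotate[of 7 ?c] by (simp_all add: eval_nat_numeral)
    then have "ych f r6 + ych f r1 + ych f r2 + ych f r3 \<le> 4 / 3"
      using gap13[OF f(1)] e pq 3 by blast
    then show ?thesis unfolding S using half[of p] half[of q] half[of r4] half[of r5] by simp
  next
    case 2
    have T: "T0 {p, q}" "T0 {q, p}" "T0 {r3, r4}" "T0 {r4, r3}" using e pq 2 by (simp_all add: insert_commute)
    have lt: "light p" "light q" "light r3" "light r4" using T0_light[OF T(1)] T0_light[OF T(3)] by auto
    obtain v where v: "v \<in> \<Union> f" "\<not> light v" using all_light_no_T0[OF f(1) f8 e(1,3)] by blast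
    then have "v = r1 \<or> v = r2 \<or> v = r5 \<or> v = r6" using lt unfolding fv by auto
    moreover have ?thesis if "v = r2"
    proof -
      have "cyc E [r2, r1, q, p, r6, r5, r4, r3]" "f = cedges [r2, r1, q, p, r6, r5, r4, r3]"
        using c fc cyc_rotate[of E 4 "rev ?c"] cedges_rotate[of 4 "rev ?c"] cyc_rev[of E ?c] cedges_rev[of ?c]
        by (simp_all add: eval_nat_numeral)
      then have "ych f r2 + ych f r1 + ych f r6 + ych f r5 \<le> 4 / 3"
        using gap22[OF f(1) _ _ T(2) T(4)] v(2) that by blast
      then show ?thesis unfolding S using half[of p] half[of q] half[of r3] half[of r4] by simp
    qed
    moreover have ?thesis if "v = r1"
    proof -
      have "cyc E [r1, r2, r3, r4, r5, r6, p, q]" "f = cedges [r1, r2, r3, r4, r5, r6, p, q]"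
        using c fc cyc_rotate[of E 2 ?c] cedges_rotate[of 2 ?c] by (simp_all add: numeral_2_eq_2)
      then have "ych f r1 + ych f r2 + ych f r5 + ych f r6 \<le> 4 / 3"
        using gap22[OF f(1) _ _ T(3) T(1)] v(2) that by blast
      then show ?thesis unfolding S using half[of p] half[of q] half[of r3] half[of r4] by simp
    qed
    moreover have ?thesis if "v = r5"
    proof -
      have "cyc E [r5, r6, p, q, r1, r2, r3, r4]" "f = cedges [r5, r6, p, q, r1, r2, r3, r4]"
        using c fc cyc_rotate[of E 6 ?c] cedges_rotate[of 6 ?c] by (simp_all add: eval_nat_numeral)
      then have "ych f r5 + ych f r6 + ych f r1 + ych f r2 \<le> 4 / 3"
        using gap22[OF f(1) _ _ T(1) T(3)] v(2) that by blast
      then show ?thesis unfolding S using half[of p] half[of q] half[of r3] half[of r4] by simp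
    qed
    moreover have ?thesis if "v = r6"
    proof -
      have "cyc E [r6, r5, r4, r3, r2, r1, q, p]" "f = cedges [r6, r5, r4, r3, r2, r1, q, p]"
        using c fc cyc_rev[of E ?c] cedges_rev[of ?c] by simp_all
      then have "ych f r6 + ych f r5 + ych f r2 + ych f r1 \<le> 4 / 3"
        using gap22[OF f(1) _ _ T(4) T(2)] v(2) that by blast
      then show ?thesis unfolding S using half[of p] half[of q] half[of r3] half[of r4] by simp
    qed
    ultimately show ?thesis by blast
  qed
qed

lemma hv_one_heavy:
  assumes "tri T" "e \<in> T" "hv e < 2" "v \<in> \<Union> T" "u \<in> \<Union> T" "\<not> light v" "\<not> light u"
  shows "u = v"
proof (rule ccontr)
  assume "u \<noteq> v"
  have fin: "finite (\<Union> T)" using finite_face_vertices tri_in_Fs assms by blast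
  have "sum \<eta> {u, v} \<le> sum \<eta> (\<Union> T)" using assms fin by (intro sum_mono2) (auto simp: \<eta>_def)
  then show False using assms(3,6,7) \<open>u \<noteq> v\<close> the_tri[OF assms(1,2)] by (simp add: hv_def \<eta>_def)
qed

text \<open>Eight halves and 1/3 for the triangle exceed the budget 4 by 1/3. This is saved by a
  vertex that is not light and takes at most 1/6, or by a triangle with two such vertices, whose
  \<open>\<kappa>\<close> is at most -1/3. What remains is a 4-vertex that is the only vertex not
  light both on the face and on its triangle, and \<open>heavy_triangle_reduction\<close> excludes
  it.\<close>

lemma face8_one_T0:
  assumes f: "f \<in> Fs" "card f = 8" and e0: "e0 \<in> f" "T0 e0" and one: "\<And>e. e \<in> f \<Longrightarrow> T0 e \<Longrightarrow> e = e0"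
  shows "sum (ych f) (\<Union> f) + sum \<kappa> f \<le> 4"
proof -
  have f8: "8 \<le> card f" using f by simp
  have fin: "finite (\<Union> f)" and card8: "card (\<Union> f) = 8"
    using finite_face_vertices face_card_vertices f by auto
  have half: "\<And>v. v \<in> \<Union> f \<Longrightarrow> ych f v \<le> 1 / 2" using ych_le_half[OF f(1) f8] .
  have Y: "sum (ych f) (\<Union> f) \<le> 4" using sum_le_half[of "\<Union> f" "ych f", OF fin half] card8 by simp
  have Y1: "sum (ych f) (\<Union> f) \<le> 11 / 3" if "v \<in> \<Union> f" "ych f v \<le> 1 / 6" for v
    using sum_le_half_except[of "\<Union> f" "ych f" v, OF fin half that(1)] that(2) card8 by simp
  have "{e \<in> f. T0 e} = {e0}" using one e0 by blast
  then have K: "sum \<kappa> f \<le> 1 / 3" using sum_\<kappa>_te[OF f(1)] by simp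
  obtain p q where pq: "e0 = {p, q}" using edge_vertex[OF f(1) e0(1)] by blast
  have lpq: "light p" "light q" using T0_light e0(2) pq by auto
  show ?thesis
  proof (cases "\<exists>v\<in>\<Union> f. \<not> light v \<and> (\<forall>e\<in>f. v \<in> e \<longrightarrow> \<not> te e)")
    case True
    then obtain v where v: "v \<in> \<Union> f" "\<not> light v" "\<And>e. e \<in> f \<Longrightarrow> v \<in> e \<Longrightarrow> \<not> te e" by blast
    have y: "ych f v = (if heavy4 v then req v f else - 1 / 6)" using ych_heavy(2)[OF f(1) f8 v(1,2)] v(3) by blast
    \<comment> \<open>A request of 1/3 puts both neighbours of \<open>v\<close> on all-light
      triangle edges of \<open>f\<close>. With only \<open>e0\<close> available they are its two
      ends, and \<open>v\<close> spans a second triangle with them.\<close>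
    have "req v f \<noteq> 1 / 3"
    proof
      assume r: "req v f = 1 / 3"
      obtain a b y y' where ab: "a \<noteq> b" "inc f v = {{v, a}, {v, b}}" "{a, y} \<in> f" "T0 {a, y}" "{b, y'} \<in> f" "T0 {b, y'}"
        "card f \<noteq> 8 \<or> (\<exists>u\<in>\<Union> f. u \<noteq> v \<and> \<not> light u)"
        by (rule req_large[OF f(1) f8 v(1) r])
      have "{a, y} = {b, y'}" using one ab by metis
      then have yb: "y = b" using ab(1) by (auto simp: doubleton_eq_iff)
      obtain T where T: "tri T" "{a, b} \<in> T" "\<forall>v\<in>\<Union> T. light v" using ab(4) yb by (auto simp: T0_def)
      obtain x where x: "triE E a b x" "T = {{a, b}, {b, x}, {a, x}}" "distinct [a, b, x]" "\<Union> T = {a, b, x}"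
        using tri_triangle[OF T(1,2)] .
      have "{v, a} \<in> f" "{v, b} \<in> f" using ab(2) by (auto simp: inc_def)
      then have tr: "triE E v a b" using x(1) face_sub[OF f(1)] by (auto simp: triE_def)
      have "v \<notin> {a, b, x}" using T(3) v(2) unfolding x(4)[symmetric] by (metis (no_types))
      then have "{v, a, b} \<noteq> {a, b, x}" by (metis insertI1)
      then show False by (rule two_tri_False[OF tr x(1), of a]) simp_all
    qed
    then have "ych f v \<le> 1 / 6" using y req_cases[of v f] by auto
    then show ?thesis using Y1[OF v(1)] K by simp
  next
    case False
    obtain v where v: "v \<in> \<Union> f" "\<not> light v" using all_light_no_T0[OF f(1) f8 e0] by blast
    then obtain e where e: "e \<in> f" "v \<in> e" "te e" using False by blast
    obtain T where T: "tri T" "e \<in> T" "T \<noteq> f" using te_tri[OF e(3,1) f(1) f8] .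
    have ne: "e \<noteq> e0" using e(2) v(2) lpq pq by auto
    show ?thesis
    proof (cases "2 \<le> hv e")
      case True
      have "sum \<kappa> f \<le> sum \<kappa> {e0, e}"
      proof (rule sum_\<kappa>[OF f(1)])
        show "{e0, e} \<subseteq> f" using e0 e by auto
        show "\<kappa> e' \<le> 0" if "e' \<in> f - {e0, e}" for e' using \<kappa>_bounds(2) one that by blast
      qed
      also have "\<dots> = \<kappa> e0 + \<kappa> e" using ne by simp
      also have "\<dots> \<le> 0" using \<kappa>_bounds(1)[of e0] \<kappa>_bounds(4)[OF e(3) True] by simp
      finally show ?thesis using Y by simp
    next
      case hv: False
      show ?thesis
      proof (cases "heavy4 v")
        case False
        then have "ych f v \<le> 1 / 6" using ych_heavy(1)[OF f(1) f8 v e] by simp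
        then show ?thesis using Y1[OF v(1)] K by simp
      next
        case h4: True
        obtain s where s: "e = {v, s}" using edge_vertex[OF f(1) e(1)] e(2) by (metis insert_commute insert_iff singletonD)
        obtain rr where rr: "cyc E (v # s # rr)" "f = cedges (v # s # rr)" using face_list[OF f(1)] e(1) s by metis
        have lr: "length rr = 6" using face_len[OF f(1) rr] f(2) by simp
        have fv: "\<Union> f = set (v # s # rr)" unfolding rr(2) by (rule cedges_Union) simp
        have dv: "distinct (v # s # rr)" using rr(1) by (simp add: cyc_def)
        obtain r where r: "triE E v s r" "T = {{v, s}, {s, r}, {v, r}}" "distinct [v, s, r]" "\<Union> T = {v, s, r}"
          using tri_triangle[OF T(1)] T(2) s by metis
        have only: "u = v" if u: "u \<in> \<Union> f" "\<not> light u" for u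
        proof -
          obtain e' where e': "e' \<in> f" "u \<in> e'" "te e'" using False u \<open>\<not> (\<exists>v\<in>\<Union> f. \<not> light v \<and> (\<forall>e\<in>f. v \<in> e \<longrightarrow> \<not> te e))\<close> by blast
          have ne': "e' \<noteq> e0" using e'(2) u(2) lpq pq by auto
          have "e' = e"
          proof (rule ccontr)
            assume "e' \<noteq> e"
            \<comment> \<open>By \<open>count_te\<close> an 8-face has at most two triangle
              edges.\<close>
            then have "card {e0, e, e'} = 3" using ne ne' by simp
            moreover have "{e0, e, e'} \<subseteq> {e \<in> f. te e}" using e0 e e' T0_te by auto
            ultimately have "3 \<le> card {e \<in> f. te e}" using card_mono[of "{e \<in> f. te e}" "{e0, e, e'}"] finite_face[OF f(1)] by simp
            then show False using count_te[OF f(1) f8] f(2) by simp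
          qed
          then have "u \<in> \<Union> T" "v \<in> \<Union> T" using e' e T(2) by auto
          then show ?thesis using hv_one_heavy[OF T(1,2) _ _ _ v(2) u(2)] hv by simp
        qed
        have lt: "light u" if "u \<in> set (s # rr)" for u
          using only[of u] that fv dv by auto
        have lr': "light r"
        proof (rule ccontr)
          assume "\<not> light r"
          then have "r = v" using hv_one_heavy[OF T(1,2) _ _ _ v(2), of r] hv r(4) by simp
          then show False using r(3) by simp
        qed
        have "e0 \<in> pedges (s # rr)"
        proof -
          have "e0 \<in> insert {last (v # s # rr), v} (insert {v, s} (pedges (s # rr)))"
            using e0(1) rr(2) by (simp add: cedges_def)
          moreover have "v \<notin> e0" using v(2) lpq pq by auto
          ultimately show ?thesis by auto
        qed
        then obtain us p' q' vs where up: "s # rr = us @ p' # q' # vs" "e0 = {p', q'}" using pedges_split by metis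
        obtain T2 where T2: "tri T2" "{p', q'} \<in> T2" "\<forall>v\<in>\<Union> T2. light v" using e0(2) up by (auto simp: T0_def)
        obtain x where x: "triE E p' q' x" "T2 = {{p', q'}, {q', x}, {p', x}}" "distinct [p', q', x]" "\<Union> T2 = {p', q', x}"
          using tri_triangle[OF T2(1,2)] .
        have "light x" using T2(3) x(4) by blast
        then have False
          using heavy_triangle_reduction[OF rr(1) lr h4 lt r(1) lr' up(1) x(1)] by blast
        then show ?thesis by blast
      qed
    qed
  qed
qed

text \<open>Nine halves leave 1/2 of the budget 5, so two all-light triangles lack 1/6 and three
  lack 1/2. Three triangle edges on a 9-cycle are equally spaced, any two of them around a single
  gap vertex; between two all-light ones it takes at most 1/3 and saves 1/6. With exactly two
  triangle edges, both all-light, a vertex that is not light saves 1/6.\<close>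

lemma face9:
  assumes f: "f \<in> Fs" "card f = 9"
  shows "sum (ych f) (\<Union> f) + sum \<kappa> f \<le> 5"
proof -
  have f8: "8 \<le> card f" using f by simp
  have fin: "finite (\<Union> f)" and card9: "card (\<Union> f) = 9"
    using finite_face_vertices face_card_vertices f by auto
  have half: "\<And>v. v \<in> \<Union> f \<Longrightarrow> ych f v \<le> 1 / 2" using ych_le_half[OF f(1) f8] .
  have Y: "sum (ych f) (\<Union> f) \<le> 9 / 2" using sum_le_half[of "\<Union> f" "ych f", OF fin half] card9 by simp
  have Y1: "sum (ych f) (\<Union> f) \<le> 13 / 3" if "v \<in> \<Union> f" "ych f v \<le> 1 / 3" for v
    using sum_le_half_except[of "\<Union> f" "ych f" v, OF fin half that(1)] that(2) card9 by simp
  let ?A = "{e \<in> f. T0 e}" and ?B = "{e \<in> f. te e}"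
  have K: "sum \<kappa> f \<le> card ?A / 3" using sum_\<kappa>_te[OF f(1)] .
  have AB: "card ?A \<le> card ?B" "card ?B \<le> 3" using T0_card_le[OF f(1)] count_te[OF f(1) f8] f(2) by auto
  have finB: "finite ?B" using finite_face[OF f(1)] by simp
  consider "card ?A \<le> 1" | "card ?A = 2" "card ?B = 2" | "2 \<le> card ?A" "card ?B = 3" using AB by linarith
  then show ?thesis
  proof cases
    case 1 then show ?thesis using Y K by simp
  next
    case 2
    have "?A = ?B" using card_subset_eq[OF finB, of ?A] 2 T0_te by auto
    then have TT: "T0 e" if "e \<in> f" "te e" for e using that by blast
    have "?A \<noteq> {}" using 2 by (metis card.empty zero_neq_numeral)
    then obtain e0 where e0: "e0 \<in> f" "T0 e0" by blast
    obtain v where v: "v \<in> \<Union> f" "\<not> light v" using all_light_no_T0[OF f(1) f8 e0] by blast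
    have "\<not> te e" if "e \<in> f" "v \<in> e" for e
    proof
      assume "te e"
      then have "T0 e" using TT that by blast
      then show False using that(2) v(2) unfolding T0_def by blast
    qed
    then have "ych f v \<le> 1 / 3" using ych_nontri_heavy[OF f(1) f8 v] by blast
    then show ?thesis using Y1[OF v(1)] K 2 by simp
  next
    case 3
    have "?A \<noteq> {}" using 3 by (metis card.empty not_numeral_le_zero)
    then obtain e0 where e0: "e0 \<in> f" "T0 e0" by blast
    obtain p q where pq: "e0 = {p, q}" using edge_vertex[OF f(1) e0(1)] by blast
    obtain r where r: "cyc E (p # q # r)" "f = cedges (p # q # r)" using face_list[OF f(1)] e0(1) pq by metis
    have "length r = 7" using face_len[OF f(1) r] f(2) by simp
    then obtain r1 r2 r3 r4 r5 r6 r7 where rr: "r = [r1, r2, r3, r4, r5, r6, r7]"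
      by (auto simp: length_Suc_conv eval_nat_numeral)
    let ?c = "[p, q, r1, r2, r3, r4, r5, r6, r7]"
    have c: "cyc E ?c" and fc: "f = cedges ?c" using r rr by auto
    have ds: "distinct ?c" using c by (simp add: cyc_def)
    have fv: "\<Union> f = set ?c" unfolding fc by (rule cedges_Union) simp
    have ed: "{p, q} \<in> f" "{q, r1} \<in> f" "{r1, r2} \<in> f" "{r2, r3} \<in> f" "{r3, r4} \<in> f" "{r4, r5} \<in> f" "{r5, r6} \<in> f"
      "{r6, r7} \<in> f" "{r7, p} \<in> f" unfolding fc by (auto simp: cedges_def insert_commute)
    have ed': "{q, p} \<in> f" "{r1, q} \<in> f" "{r2, r1} \<in> f" "{r3, r2} \<in> f" "{r6, r5} \<in> f" "{r7, r6} \<in> f" "{p, r7} \<in> f"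
      using ed by (simp_all add: insert_commute)
    have t: "te {p, q}" "te {q, p}" using T0_te[OF e0(2)] pq by (simp_all add: insert_commute)
    have x1: "\<not> te {q, r1}" using te_path1[OF f(1) f8 ed(1,2) _ t(1)] ds by auto
    have x2: "\<not> te {r1, r2}" using te_path2[OF f(1) f8 ed(1,2,3) _ t(1)] ds by auto
    have x3: "\<not> te {r7, p}" using te_path1[OF f(1) f8 ed'(1,7) _ t(2)] ds by (auto simp: insert_commute)
    have x4: "\<not> te {r6, r7}" using te_path2[OF f(1) f8 ed'(1,7,6) _ t(2)] ds by (auto simp: insert_commute)
    have y1: "te {r2, r3} \<Longrightarrow> \<not> te {r3, r4}" using te_path1[OF f(1) f8 ed(4,5)] ds by auto
    have y2: "te {r2, r3} \<Longrightarrow> \<not> te {r4, r5}" using te_path2[OF f(1) f8 ed(4,5,6)] ds by auto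
    have y3: "te {r3, r4} \<Longrightarrow> \<not> te {r4, r5}" using te_path1[OF f(1) f8 ed(5,6)] ds by auto
    have y4: "te {r3, r4} \<Longrightarrow> \<not> te {r5, r6}" using te_path2[OF f(1) f8 ed(5,6,7)] ds by auto
    have y5: "te {r4, r5} \<Longrightarrow> \<not> te {r5, r6}" using te_path1[OF f(1) f8 ed(6,7)] ds by auto
    have Bsub: "?B \<subseteq> {{p, q}, {r2, r3}, {r3, r4}, {r4, r5}, {r5, r6}}"
    proof
      fix e assume "e \<in> ?B"
      then have "e \<in> f" "te e" by auto
      then have "e \<in> {{p, q}, {q, r1}, {r1, r2}, {r2, r3}, {r3, r4}, {r4, r5}, {r5, r6}, {r6, r7}, {r7, p}}"
        unfolding fc by (simp add: cedges_def insert_commute)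
      then show "e \<in> {{p, q}, {r2, r3}, {r3, r4}, {r4, r5}, {r5, r6}}" using x1 x2 x3 x4 \<open>te e\<close> by auto
    qed
    have both: "te {r2, r3} \<and> te {r5, r6}"
    proof (rule ccontr)
      assume n: "\<not> ?thesis"
      have "\<exists>e. ?B \<subseteq> {{p, q}, e}"
      proof -
        consider "te {r3, r4}" | "te {r4, r5}" | "te {r2, r3}" | "\<not> te {r3, r4}" "\<not> te {r4, r5}" "\<not> te {r2, r3}" by blast
        then show ?thesis
        proof cases
          case 1 then show ?thesis using Bsub y1 y3 y4 by (intro exI[of _ "{r3, r4}"]) auto
        next
          case 2 then show ?thesis using Bsub y2 y3 y5 by (intro exI[of _ "{r4, r5}"]) auto
        next
          case 3 then show ?thesis using Bsub y1 y2 n by (intro exI[of _ "{r2, r3}"]) auto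
        next
          case 4 then show ?thesis using Bsub by (intro exI[of _ "{r5, r6}"]) auto
        qed
      qed
      then obtain e where "?B \<subseteq> {{p, q}, e}" by blast
      then have "card ?B \<le> card {{p, q}, e}" by (intro card_mono) auto
      also have "\<dots> \<le> 2" by (simp add: card_insert_if)
      finally show False using 3 by simp
    qed
    have Asub: "?A \<subseteq> {{p, q}, {r2, r3}, {r5, r6}}"
      using Bsub T0_te y1 y2 y4 y5 both by blast
    have g1: "ych f r1 \<le> 1 / 3" if "T0 {r2, r3}"
    proof -
      have "T0 {r3, r2}" using that by (simp add: insert_commute)
      then have "\<not> se {r2, r1}" using T0_no_small[OF f(1) f8 ed'(4,3)] ds by auto
      moreover have "\<not> se {q, r1}" using T0_no_small[OF f(1) f8 ed(1,2)] e0(2) pq ds by auto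
      ultimately show ?thesis using gap_vertex[OF f(1) f8 ed'(2) ed(3)] ds by (auto simp: insert_commute)
    qed
    have g7: "ych f r7 \<le> 1 / 3" if "T0 {r5, r6}"
    proof -
      have "\<not> se {r6, r7}" using T0_no_small[OF f(1) f8 ed(7,8) _ that] ds by auto
      moreover have "T0 {q, p}" using e0(2) pq by (simp add: insert_commute)
      then have "\<not> se {p, r7}" using T0_no_small[OF f(1) f8 ed'(1,7)] ds by auto
      ultimately show ?thesis using gap_vertex[OF f(1) f8 ed'(6) ed(9)] ds by (auto simp: insert_commute)
    qed
    have g4: "ych f r4 \<le> 1 / 3" if "T0 {r2, r3}" "T0 {r5, r6}"
    proof -
      have "\<not> se {r3, r4}" using T0_no_small[OF f(1) f8 ed(4,5) _ that(1)] ds by auto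
      moreover have "T0 {r6, r5}" using that(2) by (simp add: insert_commute)
      moreover have e54: "{r5, r4} \<in> f" "{r4, r3} \<in> f" using ed by (simp_all add: insert_commute)
      ultimately have "\<not> se {r4, r3}" "\<not> se {r4, r5}"
        using T0_no_small[OF f(1) f8 ed'(5) e54(1)] ds by (auto simp: insert_commute)
      then show ?thesis using gap_vertex[OF f(1) f8 e54(2) ed(6)] ds by auto
    qed
    have mem: "r1 \<in> \<Union> f" "r4 \<in> \<Union> f" "r7 \<in> \<Union> f" unfolding fv by auto
    show ?thesis
    proof (cases "T0 {r2, r3} \<and> T0 {r5, r6}")
      case True
      have "sum (ych f) (\<Union> f) = ych f p + ych f q + ych f r1 + ych f r2 + ych f r3 + ych f r4 + ych f r5 + ych f r6 + ych f r7"
        unfolding fv using ds by simp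
      then have "sum (ych f) (\<Union> f) \<le> 4"
        using g1 g4 g7 True half[of p] half[of q] half[of r2] half[of r3] half[of r5] half[of r6] fv by simp
      moreover have "real (card ?A) \<le> 3" using AB by simp
      ultimately show ?thesis using K by simp
    next
      case False
      have sub: "?A \<subseteq> {{p, q}, if T0 {r2, r3} then {r2, r3} else {r5, r6}}" using Asub False by auto
      have "card ?A \<le> card {{p, q}, if T0 {r2, r3} then {r2, r3} else {r5, r6}}"
        by (rule card_mono[OF _ sub]) simp
      also have "\<dots> \<le> 2" by (simp add: card_insert_if)
      finally have A2: "card ?A = 2" using 3 by simp
      have "T0 {r2, r3} \<or> T0 {r5, r6}"
      proof (rule ccontr)
        assume "\<not> ?thesis"
        then have "?A \<subseteq> {{p, q}}" using Asub by auto
        then have "card ?A \<le> 1" using card_mono[of "{{p, q}}" ?A] by simp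
        then show False using A2 by simp
      qed
      then have "sum (ych f) (\<Union> f) \<le> 13 / 3" using Y1[OF mem(1) g1] Y1[OF mem(3) g7] by blast
      then show ?thesis using K A2 by simp
    qed
  qed
qed

lemma face_bound:
  assumes f: "f \<in> Fs" "8 \<le> card f"
  shows "sum (ych f) (\<Union> f) + sum \<kappa> f \<le> real (card f) - 4"
proof -
  have fin: "finite (\<Union> f)" and cv: "card (\<Union> f) = card f"
    using finite_face_vertices face_card_vertices f by auto
  have Y: "sum (ych f) (\<Union> f) \<le> card f / 2" using sum_le_half[of "\<Union> f" "ych f", OF fin ych_le_half[OF f]] cv by simp
  have K: "sum \<kappa> f \<le> card {e \<in> f. T0 e} / 3" using sum_\<kappa>_te[OF f(1)] .
  have t: "card {e \<in> f. T0 e} \<le> card {e \<in> f. te e}" "3 * card {e \<in> f. te e} \<le> card f"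
    using T0_card_le[OF f(1)] count_te[OF f] by auto
  consider "10 \<le> card f" | "card f = 9" | "card f = 8" using f(2) by linarith
  then show ?thesis
  proof cases
    case 1
    define k t' where "k = card f" "t' = card {e \<in> f. T0 e}"
    have "10 \<le> k" "3 * t' \<le> k" using 1 t unfolding k_t'_def by linarith+
    \<comment> \<open>Integrality matters: for \<open>k = 10\<close> there are at most three such
      edges, and with three the bound is attained.\<close>
    then have "2 * t' + 24 \<le> 3 * k" by presburger
    then have "2 * real t' + 24 \<le> 3 * real k" by linarith
    then show ?thesis using Y K unfolding k_t'_def by simp
  next
    case 2 then show ?thesis using face9[OF f(1)] by simp
  next
    case 3
    consider "{e \<in> f. T0 e} = {}" | e0 where "{e \<in> f. T0 e} = {e0}" | e0 e1 where "e0 \<in> f" "T0 e0" "e1 \<in> f" "T0 e1" "e0 \<noteq> e1"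
      by blast
    then show ?thesis
    proof cases
      case 1 show ?thesis using Y K 3 unfolding 1 by simp
    next
      case 2
      then have one: "e0 \<in> f" "T0 e0" "\<And>e. e \<in> f \<Longrightarrow> T0 e \<Longrightarrow> e = e0" by auto
      show ?thesis using face8_one_T0[OF f(1) 3 one] 3 by simp
    next
      case c: 3
      have "sum (ych f) (\<Union> f) \<le> 10 / 3" using face8_two_T0[OF f(1) 3 c(1,3,2,4,5)] .
      moreover have "card {e \<in> f. T0 e} \<le> 2" using t 3 by linarith
      then have "sum \<kappa> f \<le> 2 / 3" using K by simp
      ultimately show ?thesis using 3 by simp
    qed
  qed
qed

end

lemma sum_Union_weighted:
  fixes g :: "'a \<Rightarrow> real"
  assumes "finite B" "finite E" "\<And>f. f \<in> B \<Longrightarrow> f \<subseteq> E"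
  shows "(\<Sum>f\<in>B. sum g f) = (\<Sum>e\<in>E. real (card {f \<in> B. e \<in> f}) * g e)"
proof -
  have "(\<Sum>f\<in>B. sum g f) = (\<Sum>f\<in>B. \<Sum>e\<in>{e \<in> E. e \<in> f}. g e)"
    using assms(3) by (intro sum.cong refl arg_cong2[where f = sum]) auto
  also have "\<dots> = (\<Sum>e\<in>E. \<Sum>f\<in>{f \<in> B. e \<in> f}. g e)" using assms by (intro sum.swap_restrict)
  finally show ?thesis by simp
qed

section \<open>Summing the charges\<close>

context critical_faces
begin

definition bigs :: "'a set set set" where
  "bigs = {f \<in> Fs. 8 \<le> card f}"

definition out :: "'a \<Rightarrow> real" where
  "out v = (\<Sum>f\<in>{f \<in> bigs. v \<in> \<Union> f}. xch f v)"

lemma finite_bigs: "finite bigs" using finite_Fs by (simp add: bigs_def)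

text \<open>Exchanging the order of summation turns the vertex part of \<open>\<tau>\<close>, a sum
  over edges, into the part that \<open>ych\<close> adds to \<open>xch\<close>.\<close>

lemma face_charge:
  assumes "f \<in> bigs"
  shows "(\<Sum>v\<in>\<Union> f. xch f v) + sum \<tau> f \<le> real (card f) - 4"
proof -
  have f: "f \<in> Fs" "8 \<le> card f" using assms by (auto simp: bigs_def)
  have fin: "finite f" "finite (\<Union> f)" using finite_face finite_face_vertices f by auto
  have "(\<Sum>v\<in>\<Union> f. \<eta> v / 2 * card {e \<in> f. v \<in> e \<and> te e}) = (\<Sum>v\<in>\<Union> f. \<Sum>e\<in>{e \<in> f. v \<in> e \<and> te e}. \<eta> v / 2)"
    by (simp add: mult.commute)
  also have "\<dots> = (\<Sum>e\<in>f. \<Sum>v\<in>{v \<in> \<Union> f. v \<in> e \<and> te e}. \<eta> v / 2)"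
    using fin by (rule sum.swap_restrict[rotated])
  also have "\<dots> = (\<Sum>e\<in>f. if te e then (\<Sum>v\<in>e. \<eta> v) / 2 else 0)"
  proof (rule sum.cong[OF refl])
    fix e assume "e \<in> f"
    then have "te e \<Longrightarrow> {v \<in> \<Union> f. v \<in> e \<and> te e} = e" by blast
    then show "(\<Sum>v\<in>{v \<in> \<Union> f. v \<in> e \<and> te e}. \<eta> v / 2) = (if te e then (\<Sum>v\<in>e. \<eta> v) / 2 else 0)"
      by (simp add: sum_divide_distrib)
  qed
  finally have swap: "(\<Sum>v\<in>\<Union> f. \<eta> v / 2 * card {e \<in> f. v \<in> e \<and> te e}) = (\<Sum>e\<in>f. if te e then (\<Sum>v\<in>e. \<eta> v) / 2 else 0)" .
  have "\<tau> e = (if te e then (\<Sum>v\<in>e. \<eta> v) / 2 else 0) + \<kappa> e" for e by (simp add: \<tau>_def \<kappa>_bounds(3))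
  then have "sum \<tau> f = (\<Sum>e\<in>f. if te e then (\<Sum>v\<in>e. \<eta> v) / 2 else 0) + sum \<kappa> f"
    by (simp add: sum.distrib)
  moreover have "sum (ych f) (\<Union> f) = (\<Sum>v\<in>\<Union> f. xch f v) + (\<Sum>v\<in>\<Union> f. \<eta> v / 2 * card {e \<in> f. v \<in> e \<and> te e})"
    unfolding ych_def by (rule sum.distrib)
  ultimately show ?thesis using face_bound[OF f] swap by linarith
qed

lemma sum_\<tau>_tri: assumes "tri T" shows "sum \<tau> T = 1"
proof -
  have "T \<in> Fs" "T \<noteq> {}" using assms by (auto simp: tri_def)
  then obtain a b where ab: "{a, b} \<in> T" using edge_vertex by blast
  obtain x where x: "triE E a b x" "T = {{a, b}, {b, x}, {a, x}}" "distinct [a, b, x]" "\<Union> T = {a, b, x}"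
    using tri_triangle[OF assms ab] .
  have t: "te e" "hv e = \<eta> a + \<eta> b + \<eta> x" if "e \<in> T" for e
    using that assms the_tri[OF assms that] x(3,4) by (auto simp: te_def hv_def)
  have tau: "\<tau> e = (\<Sum>v\<in>e. \<eta> v) / 2 + (1 - (\<eta> a + \<eta> b + \<eta> x)) / 3" if "e \<in> T" for e
    using t[OF that] by (simp add: \<tau>_def \<kappa>_def)
  have "{a, b} \<noteq> {b, x}" "{a, b} \<noteq> {a, x}" "{b, x} \<noteq> {a, x}" using x(3) by (auto simp: doubleton_eq_iff)
  then have "sum \<tau> T = \<tau> {a, b} + \<tau> {b, x} + \<tau> {a, x}" unfolding x(2) by simp
  moreover have "{a, b} \<in> T" "{b, x} \<in> T" "{a, x} \<in> T" using x(2) by auto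
  ultimately show ?thesis using x(3) by (simp add: tau field_simps)
qed

lemma te_faces:
  assumes "te e" shows "card {T \<in> Fs. tri T \<and> e \<in> T} = 1" "card {f \<in> bigs. e \<in> f} = 1"
proof -
  obtain T where T: "tri T" "e \<in> T" using assms by (auto simp: te_def)
  then have TF: "T \<in> Fs" "card T = 3" by (auto simp: tri_def)
  have "{T \<in> Fs. tri T \<and> e \<in> T} = {T}" using T TF the_tri by blast
  then show "card {T \<in> Fs. tri T \<and> e \<in> T} = 1" by simp
  obtain g where g: "g \<in> Fs" "g \<noteq> T" "e \<in> g" using other_face[OF TF(1) T(2)] by metis
  have "h = T \<or> h = g" if "h \<in> Fs" "e \<in> h" for h
    using third_face[OF TF(1) g(1) that(1) T(2) g(3) that(2)] g(2) by blast
  moreover have "8 \<le> card g" using tri_adjacent_big[OF T(1) g(1,2) T(2) g(3)] .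
  ultimately have "{f \<in> bigs. e \<in> f} = {g}" using g TF by (fastforce simp: bigs_def)
  then show "card {f \<in> bigs. e \<in> f} = 1" by simp
qed

text \<open>A triangle edge has one triangle and one big face beside it, so summing over big faces
  amounts to summing over triangles, each of which receives 1.\<close>

lemma sum_\<tau>_bigs: "(\<Sum>f\<in>bigs. sum \<tau> f) = card {T \<in> Fs. tri T}"
proof -
  have nt: "\<not> te e \<Longrightarrow> \<tau> e = 0" for e by (simp add: \<tau>_def)
  have "(\<Sum>f\<in>bigs. sum \<tau> f) = (\<Sum>e\<in>E. real (card {f \<in> bigs. e \<in> f}) * \<tau> e)"
    using face_sub by (intro sum_Union_weighted finite_bigs finite_E) (auto simp: bigs_def)
  also have "\<dots> = (\<Sum>e\<in>E. real (card {T \<in> {T \<in> Fs. tri T}. e \<in> T}) * \<tau> e)"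
  proof (rule sum.cong[OF refl])
    fix e show "real (card {f \<in> bigs. e \<in> f}) * \<tau> e = real (card {T \<in> {T \<in> Fs. tri T}. e \<in> T}) * \<tau> e"
      using te_faces[of e] nt[of e] by (cases "te e") (simp_all add: conj_assoc)
  qed
  also have "\<dots> = (\<Sum>T\<in>{T \<in> Fs. tri T}. sum \<tau> T)"
    using face_sub finite_Fs by (intro sum_Union_weighted[symmetric] finite_E) auto
  also have "\<dots> = card {T \<in> Fs. tri T}" using sum_\<tau>_tri by simp
  finally show ?thesis .
qed

lemma sum_out: "(\<Sum>f\<in>bigs. \<Sum>v\<in>\<Union> f. xch f v) = sum out V"
proof -
  have "(\<Sum>f\<in>bigs. \<Sum>v\<in>\<Union> f. xch f v) = (\<Sum>f\<in>bigs. \<Sum>v\<in>{v \<in> V. v \<in> \<Union> f}. xch f v)"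
    using face_vertices by (intro sum.cong refl arg_cong2[where f = sum]) (auto simp: bigs_def)
  also have "\<dots> = (\<Sum>v\<in>V. \<Sum>f\<in>{f \<in> bigs. v \<in> \<Union> f}. xch f v)"
    by (rule sum.swap_restrict[OF finite_bigs finite_V])
  finally show ?thesis by (simp add: out_def)
qed

lemma bigs_at: "{f \<in> bigs. v \<in> \<Union> f} = {f \<in> faces_at v. 8 \<le> card f}"
  by (auto simp: bigs_def faces_at_def)

lemma finite_faces_at: "finite (faces_at v)"
  using finite_Fs by (simp add: faces_at_def)

text \<open>Three big faces give 1/3 each. A small face at \<open>v\<close> is the only one and
  shares an edge at \<open>v\<close> with each of the two others, which therefore give 1/2
  each.\<close>

lemma out_light: assumes "light v" shows "1 \<le> out v"
proof -
  have c3: "card (faces_at v) = 3" using card_faces_at light_neq(5)[OF assms] by simp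
  have x: "xch f v = (if smallat f v then 1 / 2 else 1 / 3)" for f using assms by (simp add: xch_def)
  show ?thesis
  proof (cases "\<exists>Q\<in>faces_at v. card Q \<le> 4")
    case False
    then have "{f \<in> faces_at v. 8 \<le> card f} = faces_at v" using face_card by (fastforce simp: faces_at_def)
    then have "out v = (\<Sum>f\<in>faces_at v. xch f v)" unfolding out_def bigs_at by simp
    also have "\<dots> \<ge> of_nat (card (faces_at v)) * (1 / 3)" by (rule sum_bounded_below) (simp add: x)
    finally show ?thesis using c3 by simp
  next
    case True
    then obtain Q where Q: "Q \<in> faces_at v" "card Q \<le> 4" by blast
    then have QF: "Q \<in> Fs" "v \<in> \<Union> Q" by (auto simp: faces_at_def)
    have eq: "{f \<in> faces_at v. 8 \<le> card f} = faces_at v - {Q}"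
    proof -
      have "8 \<le> card f" if "f \<in> faces_at v" "f \<noteq> Q" for f
        using light_one_small[OF assms _ QF(1) _ QF(2) _ Q(2), of f] that face_card[of f] by (fastforce simp: faces_at_def)
      then show ?thesis using Q(2) by auto
    qed
    have s: "smallat f v" if "f \<in> faces_at v" for f
    proof -
      have "f \<in> Fs" "v \<in> \<Union> f" using that by (auto simp: faces_at_def)
      then obtain z where z: "{v, z} \<in> f" "{v, z} \<in> Q" using light_share[OF assms _ QF(1) _ QF(2)] by metis
      then have "se {v, z}" using QF(1) Q(2) by (auto simp: se_def)
      then show ?thesis using z(1) unfolding smallat_def by blast
    qed
    have "out v = (\<Sum>f\<in>faces_at v - {Q}. 1 / 2)" unfolding out_def bigs_at eq
      using s by (intro sum.cong) (simp_all add: x)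
    also have "\<dots> = 1" using c3 Q(1) by (simp add: card_Diff_singleton)
    finally show ?thesis by simp
  qed
qed

text \<open>If there is a needy face, the faces around \<open>v\<close> are known from
  \<open>needy_structure\<close>: one needy face is balanced by \<open>B\<close>, two by
  \<open>h\<close>.\<close>

lemma out_heavy4: assumes "heavy4 v" shows "0 \<le> out v"
proof (cases "N v = {}")
  case True
  then have "xch f v = 0" for f using N_empty_req assms heavy4_not_light by (simp add: xch_def)
  then show ?thesis by (simp add: out_def)
next
  case False
  then obtain g where g: "needy g v" by (auto simp: N_def)
  obtain c1 c2 c3 c4 c5 c6 c7 z u Q B h where
    gl: "g = cedges [v, c1, c2, c3, c4, c5, c6, c7]" and gc: "cyc E [v, c1, c2, c3, c4, c5, c6, c7]" and
    lt: "\<forall>v\<in>{c1, c2, c3, c4, c5, c6, c7}. light v" and T23: "T0 {c2, c3}" and T67: "T0 {c6, c7}" and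
    ds: "distinct [c1, c7, z, u]" and nw: "nbrs E v = {c1, c7, z, u}" and
    F: "Q \<in> Fs" "B \<in> Fs" "h \<in> Fs" and dF: "distinct [g, Q, B, h]" and
    S: "faces_at v = {g, Q, B, h}" and ig: "inc g v = {{v, c1}, {v, c7}}" and iQ: "inc Q v = {{v, c1}, {v, z}}" and
    iB: "inc B v = {{v, z}, {v, u}}" and ih: "inc h v = {{v, u}, {v, c7}}" and Q4: "card Q \<le> 4" and
    B8: "8 \<le> card B" and h8: "8 \<le> card h" and se: "se {v, z}" "\<not> se {v, u}" "\<not> se {v, c7}"
    by (rule needy_structure[OF g])
  have g8: "card g = 8" using needy_card[OF g] .
  have "{f \<in> faces_at v. 8 \<le> card f} = {g, B, h}" unfolding S using g8 B8 h8 Q4 by auto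
  then have "out v = xch g v + xch B v + xch h v" using dF unfolding out_def bigs_at by simp
  moreover have "xch f v = req v f" for f using assms heavy4_not_light by (simp add: xch_def)
  ultimately have o: "out v = req v g + req v B + req v h" by simp
  have sB: "smallat B v" using se(1) by (simp add: smallat_inc iB)
  have sh: "\<not> smallat h v" using se(2,3) by (simp add: smallat_inc ih)
  then have nh: "\<not> needy h v" using needy_smallat by blast
  have N: "N v = {g} \<or> N v = {g, B}" using needy_N[of g v Q B h u c7, OF g S Q4 ih se(2,3)] .
  have gB: "g \<noteq> B" using dF by simp
  show ?thesis
  proof (cases "needy B v")
    case True
    then have "B \<in> N v" by (simp add: N_def)
    then have "N v \<noteq> {g}" using gB by (metis singletonD)
    then have "N v = {g, B}" using N by metis
    then have "card (N v) = 2" using gB by simp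
    then show ?thesis using o g True nh sh by (simp add: req_def)
  next
    case False
    then have "B \<notin> N v" by (simp add: N_def)
    then have "N v = {g}" using N by (metis insertI1 insert_commute)
    then have "card (N v) = 1" by simp
    then show ?thesis using o g False nh sh sB by (simp add: req_def)
  qed
qed

text \<open>There are at most as many big faces at \<open>v\<close> as its degree. A triangle at
  \<open>v\<close> uses up one of the faces but has up to two charged edges at \<open>v\<close>,
  each counted in one big face, so the sixths number at most one more than the degree. For a
  5-vertex this is its whole charge 1.\<close>

lemma out_other:
  assumes "\<not> light v" "\<not> heavy4 v"
  shows "- (real (card (nbrs E v)) + 1) \<le> 6 * out v"
proof -
  define B where "B = {f \<in> bigs. v \<in> \<Union> f}"
  let ?S = "{e \<in> inc E v. te e}"
  define t where "t = (\<Sum>f\<in>B. card {e \<in> f. v \<in> e \<and> te e})"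
  have finB: "finite B" using finite_bigs by (simp add: B_def)
  have xe: "6 * xch f v = - (1 + real (card {e \<in> f. v \<in> e \<and> te e}))" for f
    using assms by (simp add: xch_def)
  have "6 * out v = (\<Sum>f\<in>B. 6 * xch f v)" by (simp add: out_def B_def sum_distrib_left)
  also have "\<dots> = - (\<Sum>f\<in>B. 1 + real (card {e \<in> f. v \<in> e \<and> te e}))" unfolding xe by (rule sum_negf)
  also have "(\<Sum>f\<in>B. 1 + real (card {e \<in> f. v \<in> e \<and> te e})) = real (card B) + real t" by (simp add: sum.distrib t_def)
  finally have o: "6 * out v = - (real (card B) + real t)" .
  have "t = (\<Sum>f\<in>B. card {e \<in> ?S. e \<in> f})"
    unfolding t_def using face_sub by (intro sum.cong arg_cong[where f = card]) (auto simp: inc_def bigs_def B_def)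
  also have "\<dots> = (\<Sum>e\<in>?S. card {f \<in> B. e \<in> f})" by (rule double_count[OF finB]) simp
  also have "\<dots> = (\<Sum>e\<in>?S. 1)"
  proof (rule sum.cong[OF refl])
    fix e assume e: "e \<in> ?S"
    then have "{f \<in> B. e \<in> f} = {f \<in> bigs. e \<in> f}" by (auto simp: inc_def B_def)
    then show "card {f \<in> B. e \<in> f} = 1" using te_faces(2)[of e] e by simp
  qed
  finally have tS: "t = card ?S" by simp
  have "card B + t \<le> card (nbrs E v) + 1"
  proof (cases "?S = {}")
    case True
    have "card B \<le> card (faces_at v)" unfolding B_def bigs_at using finite_faces_at by (intro card_mono) auto
    then show ?thesis using card_faces_at[of v] tS True by simp
  next
    case False
    then obtain e where e: "e \<in> inc E v" "te e" by blast
    then obtain T where T: "tri T" "e \<in> T" by (auto simp: te_def)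
    have TF: "T \<in> Fs" "card T = 3" using T by (auto simp: tri_def)
    have vT: "v \<in> \<Union> T" using e(1) T(2) by (auto simp: inc_def)
    have sub: "?S \<subseteq> inc T v"
    proof
      fix e' assume "e' \<in> ?S"
      then have e': "v \<in> e'" "te e'" by (auto simp: inc_def)
      then obtain T' where T': "tri T'" "e' \<in> T'" by (auto simp: te_def)
      then have "v \<in> \<Union> T'" using e'(1) by blast
      then have "T = T'" using tri_unique[OF T(1) T'(1) vT] by blast
      then show "e' \<in> inc T v" using T'(2) e'(1) by (simp add: inc_def)
    qed
    have "finite (inc T v)" using finite_face[OF TF(1)] by (simp add: inc_def)
    then have "card ?S \<le> card (inc T v)" using sub by (rule card_mono)
    then have t2: "t \<le> 2" using tS face_inc(1)[OF TF(1) vT] by simp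
    have "B \<subseteq> faces_at v - {T}" unfolding B_def bigs_at using TF(2) by auto
    then have "card B \<le> card (faces_at v - {T})" using finite_faces_at by (intro card_mono) auto
    moreover have Tv: "T \<in> faces_at v" using TF(1) vT by (simp add: faces_at_def)
    then have "card (faces_at v - {T}) = card (faces_at v) - 1" by (rule card_Diff_singleton)
    moreover have "0 < card (faces_at v)" using Tv finite_faces_at card_gt_0_iff by blast
    ultimately show ?thesis using card_faces_at[of v] t2 by linarith
  qed
  then have "real (card B) + real t \<le> real (card (nbrs E v)) + 1" by linarith
  then show ?thesis using o by linarith
qed

text \<open>For degree \<open>d\<close> the second bound is \<open>d - 4 - (d + 1) / 6\<close>,
  which is nonnegative from \<open>d = 5\<close> on.\<close>

lemma vertex_charge:
  assumes "v \<in> V"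
  shows "v \<notin> X \<Longrightarrow> 0 \<le> real (card (nbrs E v)) - 4 + out v"
    and "v \<in> X \<Longrightarrow> (5 * real (card (nbrs E v)) - 25) / 6 \<le> real (card (nbrs E v)) - 4 + out v"
proof -
  show "(5 * real (card (nbrs E v)) - 25) / 6 \<le> real (card (nbrs E v)) - 4 + out v" if "v \<in> X"
  proof -
    have "\<not> light v" "\<not> heavy4 v" using that by (auto simp: light_def heavy4_def)
    then show ?thesis using out_other[of v] by simp
  qed
  show "0 \<le> real (card (nbrs E v)) - 4 + out v" if X: "v \<notin> X"
  proof -
    have "v \<noteq> v0" using X by (auto simp: X_def)
    then have d3: "3 \<le> card (nbrs E v)" using deg3 assms by blast
    consider "light v" | "heavy4 v" | "\<not> light v" "\<not> heavy4 v" by blast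
    then show ?thesis
    proof cases
      case 1 then show ?thesis using out_light light_neq(5) by fastforce
    next
      case 2 then show ?thesis using out_heavy4 light_neq(6) by fastforce
    next
      case 3
      then have "card (nbrs E v) \<noteq> 3" "card (nbrs E v) \<noteq> 4" using X assms by (auto simp: light_def heavy4_def)
      then have "5 \<le> card (nbrs E v)" using d3 by linarith
      then show ?thesis using out_other[OF 3] by simp
    qed
  qed
qed

text \<open>In the extreme case \<open>v0\<close> has degree 2 and contributes -15/6, and its two
  neighbours have degree 3 and contribute -10/6 each.\<close>

lemma total_vertex_charge: "- (35 / 6) \<le> (\<Sum>v\<in>V. real (card (nbrs E v)) - 4 + out v)"
proof -
  have XV: "X \<subseteq> V" using v0 nbrs_sub by (auto simp: X_def)
  have finX: "finite X" using XV finite_V finite_subset by blast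
  let ?g = "\<lambda>v. (5 * real (card (nbrs E v)) - 25) / 6"
  have d3: "- (10 / 6) \<le> ?g v" if "v \<in> V" "v \<noteq> v0" for v using deg3[OF that] by simp
  have "- (35 / 6) \<le> sum ?g X"
  proof (cases "card (nbrs E v0) = 2")
    case False
    then have "X = {v0}" by (simp add: X_def)
    then show ?thesis using deg2 by simp
  next
    case True
    then have X: "X = insert v0 (nbrs E v0)" by (simp add: X_def)
    have n: "v0 \<notin> nbrs E v0" using edge_neq by (auto simp: nbrs_def)
    have "of_nat (card (nbrs E v0)) * (- (10 / 6)) \<le> sum ?g (nbrs E v0)"
      using d3 nbrs_sub n by (intro sum_bounded_below) blast
    then show ?thesis unfolding X using n True by simp
  qed
  also have "\<dots> \<le> (\<Sum>v\<in>X. real (card (nbrs E v)) - 4 + out v)"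
    using vertex_charge(2) XV by (intro sum_mono) blast
  also have "\<dots> \<le> (\<Sum>v\<in>V. real (card (nbrs E v)) - 4 + out v)"
    using vertex_charge(1) by (intro sum_mono2[OF finite_V XV]) blast
  finally show ?thesis .
qed

text \<open>The triangular faces that receive nothing contain \<open>v0\<close>, and two of them
  would be distinct triangles with a common vertex.\<close>

lemma three_faces_tri: "card {f \<in> Fs. card f = 3} \<le> card {T \<in> Fs. tri T} + 1"
proof -
  let ?A = "{f \<in> Fs. card f = 3 \<and> v0 \<in> \<Union> f}"
  have "{f \<in> Fs. card f = 3} = {T \<in> Fs. tri T} \<union> ?A" by (auto simp: tri_def)
  then have "card {f \<in> Fs. card f = 3} = card ({T \<in> Fs. tri T} \<union> ?A)" by (rule arg_cong)
  also have "\<dots> \<le> card {T \<in> Fs. tri T} + card ?A" by (rule card_Un_le)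
  finally have "card {f \<in> Fs. card f = 3} \<le> card {T \<in> Fs. tri T} + card ?A" .
  moreover have "card ?A \<le> Suc 0"
  proof -
    have "f = g" if "f \<in> ?A" "g \<in> ?A" for f g using three_face_unique[of f g v0 v0] that by simp
    then have "\<forall>f\<in>?A. \<forall>g\<in>?A. f = g" by (intro ballI)
    moreover have "finite ?A" using finite_Fs by simp
    ultimately show ?thesis by (simp only: card_le_Suc0_iff_eq)
  qed
  ultimately show ?thesis by simp
qed

lemma handshake: "(\<Sum>v\<in>V. card (nbrs E v)) = 2 * card E" "(\<Sum>f\<in>Fs. card f) = 2 * card E"
proof -
  have "(\<Sum>v\<in>V. card (nbrs E v)) = (\<Sum>v\<in>V. card {e \<in> E. v \<in> e})" using card_inc by (simp add: inc_def)
  also have "\<dots> = (\<Sum>e\<in>E. card {v \<in> V. v \<in> e})" by (rule double_count[OF finite_V finite_E])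
  also have "\<dots> = (\<Sum>e\<in>E. 2)"
  proof (rule sum.cong[OF refl])
    fix e assume e: "e \<in> E"
    then obtain a b where ab: "e = {a, b}" using two_setsE[OF two_sets_E] by blast
    then have "a \<noteq> b" using e edge_neq by blast
    moreover have "{v \<in> V. v \<in> e} = e" using e E_sub by blast
    ultimately show "card {v \<in> V. v \<in> e} = 2" using ab by simp
  qed
  finally show "(\<Sum>v\<in>V. card (nbrs E v)) = 2 * card E" by simp
  have "(\<Sum>f\<in>Fs. card f) = (\<Sum>f\<in>Fs. card {e \<in> E. e \<in> f})"
    using face_sub by (intro sum.cong arg_cong[where f = card]) auto
  also have "\<dots> = (\<Sum>e\<in>E. card {f \<in> Fs. e \<in> f})" by (rule double_count[OF finite_Fs finite_E])
  also have "\<dots> = (\<Sum>e\<in>E. 2)" using two_faces by (intro sum.cong) auto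
  finally show "(\<Sum>f\<in>Fs. card f) = 2 * card E" by simp
qed

text \<open>The vertices end with at least -35/6 in total, the big faces and the paid triangles with
  at least 0, the 4-faces with 0 and at most one triangle with -1, whereas Euler's formula makes the
  total -8.\<close>

theorem critical_faces_False: False
proof -
  have "(\<Sum>v\<in>V. real (card (nbrs E v))) = 2 * real (card E)"
    using arg_cong[OF handshake(1), of real] by simp
  then have v: "(\<Sum>v\<in>V. real (card (nbrs E v)) - 4 + out v) = 2 * real (card E) - 4 * real (card V) + sum out V"
    by (simp add: sum.distrib sum_subtractf)
  have "(\<Sum>f\<in>Fs. real (card f)) = 2 * real (card E)"
    using arg_cong[OF handshake(2), of real] by simp
  then have f: "(\<Sum>f\<in>Fs. real (card f) - 4) = 2 * real (card E) - 4 * real (card Fs)"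
    by (simp add: sum_subtractf)
  have "(\<Sum>f\<in>Fs. real (card f) - 4) = (\<Sum>f\<in>bigs. real (card f) - 4) + (\<Sum>f\<in>Fs - bigs. real (card f) - 4)"
    by (subst sum.subset_diff[of bigs]) (auto simp: bigs_def finite_Fs)
  moreover have "(\<Sum>f\<in>Fs - bigs. real (card f) - 4) = (\<Sum>f\<in>Fs - bigs. if card f = 3 then - 1 else 0)"
    using face_card by (intro sum.cong) (fastforce simp: bigs_def)+
  moreover have "{f \<in> Fs - bigs. card f = 3} = {f \<in> Fs. card f = 3}" by (auto simp: bigs_def)
  then have "(\<Sum>f\<in>Fs - bigs. if card f = 3 then - 1 else 0 :: real) = - real (card {f \<in> Fs. card f = 3})"
    using finite_Fs by (simp add: sum.If_cases Int_def)
  moreover have "sum out V + real (card {T \<in> Fs. tri T}) \<le> (\<Sum>f\<in>bigs. real (card f) - 4)"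
  proof -
    have "(\<Sum>f\<in>bigs. (\<Sum>v\<in>\<Union> f. xch f v) + sum \<tau> f) \<le> (\<Sum>f\<in>bigs. real (card f) - 4)"
      using face_charge by (rule sum_mono)
    then show ?thesis unfolding sum.distrib sum_out sum_\<tau>_bigs .
  qed
  moreover have "real (card {f \<in> Fs. card f = 3}) \<le> real (card {T \<in> Fs. tri T}) + 1" using three_faces_tri by linarith
  moreover have "real (card V) + real (card Fs) = real (card E) + 2" using euler by linarith
  ultimately show False using total_vertex_charge v f by linarith
qed

end

section \<open>Minimal counterexamples\<close>

lemma IF_part_induced: "B \<subseteq> W \<Longrightarrow> IF_part {e \<in> E. e \<subseteq> W} B F \<longleftrightarrow> IF_part E B F"
proof -
  assume B: "B \<subseteq> W"
  have "cyc {e \<in> E. e \<subseteq> W} c \<longleftrightarrow> cyc E c" if "set c \<subseteq> W" for c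
  proof (cases "c = []")
    case False
    then have "e \<subseteq> W" if "e \<in> cedges c" for e using cedges_Union[OF False] \<open>set c \<subseteq> W\<close> that by blast
    then show ?thesis by (auto simp: cyc_def)
  qed (simp add: cyc_def)
  then have "acyclic_on {e \<in> E. e \<subseteq> W} F \<longleftrightarrow> acyclic_on E F" if "F \<subseteq> B"
    using that B unfolding acyclic_on_def by (meson order_trans)
  then show ?thesis using B unfolding IF_part_def by blast
qed

lemma path_one_side:
  "pedges p \<subseteq> E \<Longrightarrow> set p \<subseteq> S \<union> T \<Longrightarrow> (\<And>x y. x \<in> S \<Longrightarrow> y \<in> T \<Longrightarrow> {x, y} \<notin> E) \<Longrightarrow> set p \<subseteq> S \<or> set p \<subseteq> T"
proof (induction p rule: pedges.induct)
  case (1 x y xs)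
  then have IH: "set (y # xs) \<subseteq> S \<or> set (y # xs) \<subseteq> T" and e: "{x, y} \<in> E" "{y, x} \<in> E" and x: "x \<in> S \<union> T"
    by (auto simp: insert_commute)
  have "x \<in> S \<Longrightarrow> y \<notin> T" "y \<in> S \<Longrightarrow> x \<notin> T" using 1(4) e by blast+
  then show ?case using IH x by auto
qed auto

text \<open>A cycle through the cut vertex \<open>u\<close> is, apart from \<open>u\<close>, a path
  that cannot cross between the two sides.\<close>

lemma cycle_one_side:
  assumes c: "cyc E c" "set c \<subseteq> A \<union> B" and AB: "A \<inter> B \<subseteq> {u}"
    and sep: "\<And>x y. x \<in> A - B \<Longrightarrow> y \<in> B - A \<Longrightarrow> {x, y} \<notin> E"
  shows "set c \<subseteq> A \<or> set c \<subseteq> B"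
proof (cases "u \<in> set c \<and> u \<in> A \<inter> B")
  case True
  then obtain n p where np: "rotate n c = u # p" using rotate_to_front by metis
  then have cp: "cyc E (u # p)" and sc: "set c = insert u (set p)" using c(1) by (metis cyc_rotate, metis set_rotate list.simps(15))
  have p: "p \<noteq> []" "u \<notin> set p" using cp by (auto simp: cyc_def)
  have "pedges p \<subseteq> E" using cp p by (auto simp: cyc_def cedges_Cons)
  moreover have "set p \<subseteq> (A - B) \<union> (B - A)" using c(2) sc p(2) AB by blast
  ultimately have "set p \<subseteq> A - B \<or> set p \<subseteq> B - A" using sep by (rule path_one_side)
  then show ?thesis using True sc by auto
next
  case False
  then have "set c \<subseteq> (A - B) \<union> (B - A)" using c(2) AB by blast
  moreover have "pedges c \<subseteq> E" using c(1) by (auto simp: cyc_def cedges_def)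
  ultimately have "set c \<subseteq> A - B \<or> set c \<subseteq> B - A" using path_one_side[of c E "A - B" "B - A"] sep by blast
  then show ?thesis by auto
qed

lemma IF_part_glue:
  assumes F1: "IF_part E A F1" and F2: "IF_part E B F2" and AB: "A \<inter> B \<subseteq> {u}" "F1 \<inter> B = F2 \<inter> A"
    and sep: "\<And>x y. x \<in> A - B \<Longrightarrow> y \<in> B - A \<Longrightarrow> {x, y} \<notin> E"
  shows "IF_part E (A \<union> B) (F1 \<union> F2)"
proof -
  have sub: "F1 \<subseteq> A" "F2 \<subseteq> B" using F1 F2 by (auto simp: IF_part_def)
  have eq: "(F1 \<union> F2) \<inter> A = F1" "(F1 \<union> F2) \<inter> B = F2" using sub AB(2) by blast+
  have "\<not> (cyc E c \<and> set c \<subseteq> F1 \<union> F2)" for c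
  proof
    assume c: "cyc E c \<and> set c \<subseteq> F1 \<union> F2"
    then have "set c \<subseteq> A \<or> set c \<subseteq> B" using cycle_one_side[of E c A B u] AB(1) sep sub by blast
    then have "set c \<subseteq> F1 \<or> set c \<subseteq> F2" using c eq by blast
    then show False using c F1 F2 by (auto simp: IF_part_def acyclic_on_def)
  qed
  moreover have "{x, y} \<notin> E" if xy: "x \<in> A \<union> B - (F1 \<union> F2)" "y \<in> A \<union> B - (F1 \<union> F2)" for x y
  proof
    assume e: "{x, y} \<in> E"
    then have e': "{y, x} \<in> E" by (simp add: insert_commute)
    have "(x \<in> A \<and> y \<in> A) \<or> (x \<in> B \<and> y \<in> B)" using xy sep[of x y] sep[of y x] e e' by blast
    then show False using e xy F1 F2 by (auto simp: IF_part_def)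
  qed
  ultimately show ?thesis using sub unfolding IF_part_def acyclic_on_def by blast
qed

lemma connected_on_conn:
  assumes "connected_on E S" "a \<in> S" "b \<in> S" shows "conn E S a b"
proof (rule ccontr)
  assume n: "\<not> conn E S a b"
  let ?A = "{x \<in> S. conn E S a x}"
  have "a \<in> ?A" "b \<notin> ?A" using assms n by auto
  then obtain x y where xy: "x \<in> ?A" "y \<in> S - ?A" "{x, y} \<in> E"
    using assms(1)[unfolded connected_on_def, rule_format, of ?A] assms(3) by blast
  then have "conn E S a y" using conn_edge[of x S y E] conn_trans[of E S a x y] by simp
  then show False using xy(2) by simp
qed

locale sparse_drawing = plane_drawing +
  assumes no567: "\<And>c. cyc E c \<Longrightarrow> length c \<notin> {5, 6, 7}"
    and tri_far: "\<And>x y z x' y' z' u v. triE E x y z \<Longrightarrow> triE E x' y' z' \<Longrightarrow> {x, y, z} \<noteq> {x', y', z'} \<Longrightarrow>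
      u \<in> {x, y, z} \<Longrightarrow> v \<in> {x', y', z'} \<Longrightarrow> u \<noteq> v \<and> {u, v} \<notin> E"
begin

text \<open>The induction hypothesis covers every vertex and both sides. Gluing needs this: the part
  with \<open>v0\<close> is coloured first, and the side that the cut vertex gets there is
  prescribed for the other part.\<close>

lemma precolouring:
  assumes "W \<subseteq> V" "v0 \<in> W" shows "\<exists>F. IF_part E W F \<and> (v0 \<in> F) = col"
  using assms
proof (induction "card W" arbitrary: W v0 col rule: less_induct)
  case less
  have finW: "finite W" using less.prems(1) finite_V finite_subset by blast
  have IH: "\<exists>F. IF_part E W' F \<and> (v \<in> F) = c" if "W' \<subset> W" "v \<in> W'" for W' v c
    using less.hyps[of W' v c] psubset_card_mono[OF finW that(1)] that less.prems(1) by blast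
  show ?case
  proof (rule ccontr)
    assume "\<not> ?case"
    then have no: "\<And>F. IF_part E W F \<Longrightarrow> (v0 \<in> F) \<noteq> col" by blast
    define H where "H = {e \<in> E. e \<subseteq> W}"
    have HE: "H \<subseteq> E" by (auto simp: H_def)
    have two: "two_sets H" using two_sets_E HE by (auto simp: two_sets_def)
    have HW: "\<Union> H \<subseteq> W" by (auto simp: H_def)
    have HI: "{x, y} \<in> H \<longleftrightarrow> {x, y} \<in> E \<and> x \<in> W \<and> y \<in> W" for x y by (auto simp: H_def)
    have no_sep: False if AB: "A \<subset> W" "B \<subset> W" "A \<union> B = W" "A \<inter> B \<subseteq> {u}" "v0 \<in> A"
      and sep: "\<And>x y. x \<in> A - B \<Longrightarrow> y \<in> B - A \<Longrightarrow> {x, y} \<notin> E" for A B u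
    proof -
      obtain F1 where F1: "IF_part E A F1" "(v0 \<in> F1) = col" using IH[OF AB(1,5)] by blast
      have "\<exists>F2. IF_part E B F2 \<and> F1 \<inter> B = F2 \<inter> A"
      proof (cases "u \<in> A \<inter> B")
        case True
        then obtain F2 where F2: "IF_part E B F2" "(u \<in> F2) = (u \<in> F1)" using IH[OF AB(2)] by blast
        moreover have "F1 \<subseteq> A" "F2 \<subseteq> B" using F1 F2 by (auto simp: IF_part_def)
        ultimately show ?thesis using AB(4) True by (intro exI[of _ F2]) blast
      next
        case False
        obtain b where "b \<in> B" using AB(1,3) by blast
        then obtain F2 where F2: "IF_part E B F2" using IH[OF AB(2)] by blast
        moreover have "F1 \<subseteq> A" "F2 \<subseteq> B" using F1 F2 by (auto simp: IF_part_def)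
        ultimately show ?thesis using AB(4) False by (intro exI[of _ F2]) blast
      qed
      then obtain F2 where F2: "IF_part E B F2" "F1 \<inter> B = F2 \<inter> A" by blast
      have "IF_part E W (F1 \<union> F2)" using IF_part_glue[OF F1(1) F2(1) AB(4) F2(2) sep] AB(3) by simp
      moreover have "(v0 \<in> F1 \<union> F2) = col" using F1 F2 AB(5) by (auto simp: IF_part_def)
      ultimately show False using no by blast
    qed
    have no_sep': False if AB: "A \<subset> W" "B \<subset> W" "A \<union> B = W" "A \<inter> B \<subseteq> {u}"
      and sep: "\<And>x y. x \<in> A - B \<Longrightarrow> y \<in> B - A \<Longrightarrow> {x, y} \<notin> E" for A B u
    proof (cases "v0 \<in> A")
      case True then show False using no_sep[OF AB _ sep] by blast
    next
      case False
      then have "v0 \<in> B" using AB(3) less.prems(2) by blast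
      moreover have "{x, y} \<notin> E" if "x \<in> B - A" "y \<in> A - B" for x y using sep[OF that(2,1)] by (simp add: insert_commute)
      ultimately show False using no_sep[OF AB(2,1), of u] AB(3,4) by (metis Int_commute Un_commute)
    qed
    have con1: "connected_on H W"
    proof (rule ccontr)
      assume "\<not> connected_on H W"
      then obtain A where A: "A \<subseteq> W" "A \<noteq> {}" "A \<noteq> W" "\<And>a b. a \<in> A \<Longrightarrow> b \<in> W - A \<Longrightarrow> {a, b} \<notin> H"
        unfolding connected_on_def by blast
      show False
      \<comment> \<open>The parts are disjoint, so there is no cut vertex and the value of
        \<open>u\<close> is arbitrary.\<close>
      proof (rule no_sep'[of A "W - A" undefined])
        fix x y assume "x \<in> A - (W - A)" "y \<in> W - A - A"
        then have "x \<in> A" "x \<in> W" "y \<in> W" "y \<notin> A" using A(1) by auto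
        then show "{x, y} \<notin> E" using A(4)[of x y] HI[of x y] by simp
      qed (use A in auto)
    qed
    have con2: "connected_on H (W - {u})" if u: "u \<in> W" for u
    proof (rule ccontr)
      assume "\<not> connected_on H (W - {u})"
      then obtain A where A: "A \<subseteq> W - {u}" "A \<noteq> {}" "A \<noteq> W - {u}" "\<And>a b. a \<in> A \<Longrightarrow> b \<in> W - {u} - A \<Longrightarrow> {a, b} \<notin> H"
        unfolding connected_on_def by blast
      show False
      proof (rule no_sep'[of "insert u A" "W - A" u])
        fix x y assume "x \<in> insert u A - (W - A)" "y \<in> W - A - insert u A"
        then have "x \<in> A" "x \<in> W" "y \<in> W" "y \<notin> A" "y \<noteq> u" using A(1) u by auto
        then show "{x, y} \<notin> E" using A(4)[of x y] HI[of x y] by simp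
      qed (use A u in auto)
    qed
    have fin_nbrs: "finite (nbrs E v)" for v
      by (rule finite_subset[OF _ finite_V]) (use E_sub in \<open>auto simp: nbrs_def\<close>)
    have fin_nbrsH: "finite (nbrs H v)" for v
      by (rule finite_subset[OF _ finW]) (use HW in \<open>auto simp: nbrs_def\<close>)
    have deg3: "3 \<le> card (nbrs H v)" if v: "v \<in> W" "v \<noteq> v0" for v
    proof (rule ccontr)
      assume d: "\<not> ?thesis"
      have "nbrs E v \<inter> (W - {v}) \<subseteq> nbrs H v" using v(1) by (auto simp: nbrs_def H_def)
      from card_mono[OF fin_nbrsH this] have d: "card (nbrs E v \<inter> (W - {v})) \<le> 2" using d by linarith
      obtain F where F: "IF_part E (W - {v}) F" "(v0 \<in> F) = col"
        using IH[of "W - {v}" v0 col] v less.prems(2) by blast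
      obtain F' where "extends E (W - {v}) F (insert v (W - {v})) F'"
        using greedy_step[OF two_sets_E F(1) _ fin_nbrs d] by blast
      then have F': "IF_part E W F'" "F' \<inter> (W - {v}) = F" using v(1) by (auto simp: extends_def insert_absorb)
      then have "(v0 \<in> F') = col" using F(2) v less.prems(2) by blast
      then show False using no[OF F'(1)] by simp
    qed
    have "W \<noteq> {v0}"
    proof
      assume W: "W = {v0}"
      have "{v0} \<notin> E" using two_sets_irrefl[OF two_sets_E, of v0 v0] by auto
      moreover have "acyclic_on E F" if "F \<subseteq> {v0}" for F
      proof -
        have "\<not> (cyc E c \<and> set c \<subseteq> F)" for c
        proof
          assume c: "cyc E c \<and> set c \<subseteq> F"
          then have "length c \<le> 1" using that distinct_card[of c] card_mono[of "{v0}" "set c"] by (auto simp: cyc_def)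
          then show False using c by (simp add: cyc_def)
        qed
        then show ?thesis by (simp add: acyclic_on_def)
      qed
      ultimately have "IF_part E W (if col then {v0} else {})" using W by (auto simp: IF_part_def)
      then show False using no by (metis emptyE insertI1)
    qed
    then obtain w where w: "w \<in> W" "w \<noteq> v0" using less.prems(2) by blast
    have nbrsW: "nbrs H v \<subseteq> W - {v}" for v using HW two_sets_irrefl[OF two, of v v] by (auto simp: nbrs_def)
    have "3 \<le> card (W - {w})" using deg3[OF w] card_mono[OF _ nbrsW[of w]] finW by (meson finite_Diff order_trans)
    then have W4: "4 \<le> card W" using w(1) finW by (simp add: card_Diff_singleton)
    have deg2: "2 \<le> card (nbrs H v0)"
    proof (rule ccontr)
      assume d: "\<not> ?thesis"
      \<comment> \<open>If \<open>v0\<close> had at most one neighbour, deleting some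
        \<open>u\<close> would leave it isolated; without any neighbour the vertex \<open>w\<close>
        serves as \<open>u\<close>.\<close>
      obtain u where u: "nbrs H v0 \<subseteq> {u}" "u \<in> W" "u \<noteq> v0"
      proof (cases "nbrs H v0 = {}")
        case True then show ?thesis using that[of w] w by simp
      next
        case False
        then have "0 < card (nbrs H v0)" using fin_nbrsH by (simp add: card_gt_0_iff)
        then have "card (nbrs H v0) = 1" using d by linarith
        then obtain u where "nbrs H v0 = {u}" by (auto simp: card_1_singleton_iff)
        then show ?thesis using that[of u] nbrsW[of v0] by auto
      qed
      have "W - {u} \<noteq> {v0}"
      proof
        assume "W - {u} = {v0}"
        then have "card (W - {u}) = 1" by simp
        then show False using W4 u(2) finW by (simp add: card_Diff_singleton)
      qed
      then obtain b where "b \<in> W - {u} - {v0}" "{v0, b} \<in> H"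
        using con2[OF u(2), unfolded connected_on_def, rule_format, of "{v0}"] u(2,3) less.prems(2) by auto
      then show False using u(1) by (auto simp: nbrs_def)
    qed
    \<comment> \<open>The ear decomposition has to start at a cycle: two neighbours of
      \<open>w\<close> are joined by a path that avoids \<open>w\<close>.\<close>
    obtain c where c: "cyc H c"
    proof -
      obtain a b where ab: "a \<in> nbrs H w" "b \<in> nbrs H w" "a \<noteq> b"
      proof -
        have "\<not> card (nbrs H w) \<le> Suc 0" using deg3[OF w] by simp
        then show ?thesis using that by (auto simp: card_le_Suc0_iff_eq[OF fin_nbrsH])
      qed
      have abW: "a \<in> W - {w}" "b \<in> W - {w}" using ab nbrsW[of w] by auto
      obtain p where p: "p \<noteq> []" "distinct p" "hd p = a" "last p = b" "set p \<subseteq> W - {w}" "pedges p \<subseteq> H"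
        by (rule conn_obtain_path[OF connected_on_conn[OF con2[OF w(1)] abW] abW(1)])
      have len: "2 \<le> length p"
      proof -
        have "tl p \<noteq> []"
        proof
          assume "tl p = []"
          then have "hd p = last p" using p(1) by (cases p) auto
          then show False using p ab by simp
        qed
        then show ?thesis by (cases p; cases "tl p") auto
      qed
      have "{w, a} \<in> H" "{b, w} \<in> H" using ab by (auto simp: nbrs_def insert_commute)
      then have "cedges (w # p) \<subseteq> H" unfolding cedges_Cons[OF p(1)] p(3,4) using p(6) by simp
      moreover have "w \<notin> set p" using p(5) by blast
      ultimately have "cyc H (w # p)" using p(2) len by (simp add: cyc_def)
      then show ?thesis using that by blast
    qed
    have UH: "\<Union> H = W"
    proof (rule antisym[OF HW])
      show "W \<subseteq> \<Union> H"
      proof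
        fix v assume "v \<in> W"
        then have "nbrs H v \<noteq> {}" using deg2 deg3[of v] by (cases "v = v0") auto
        then obtain x where "x \<in> nbrs H v" by blast
        then show "v \<in> \<Union> H" by (auto simp: nbrs_def)
      qed
    qed
    interpret D: plane_drawing W H \<phi> \<gamma>
    proof
      show "inj_on \<phi> W" using inj less.prems(1) inj_on_subset by blast
      fix e assume e: "e \<in> H"
      then have eE: "e \<in> E" using HE by blast
      show "Path_Connected.arc (\<gamma> e)" "{pathstart (\<gamma> e), pathfinish (\<gamma> e)} = \<phi> ` e" using arc_edge ends eE by auto
      show "(path_image (\<gamma> e) - {pathstart (\<gamma> e), pathfinish (\<gamma> e)}) \<inter> \<phi> ` W = {}"
        using no_vertex[OF eE] less.prems(1) by blast
      show "(path_image (\<gamma> e) - {pathstart (\<gamma> e), pathfinish (\<gamma> e)}) \<inter> path_image (\<gamma> f) = {}"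
        if "f \<in> H" "f \<noteq> e" for f using no_crossing[OF eE _ that(2)] that(1) HE by blast
    qed (use finW two HW in auto)
    obtain \<Sigma> where S: "D.face_system H \<Sigma>" using D.face_system_exists[OF con1 con2 c] by blast
    have S1: "finite \<Sigma>" "\<And>x. x \<in> \<Sigma> \<Longrightarrow> \<exists>c. cyc H c \<and> fst x = cedges c"
      "\<And>e. e \<in> H \<Longrightarrow> card {x \<in> \<Sigma>. e \<in> fst x} = 2" "card \<Sigma> + card W = card H + 2"
      using S UH unfolding D.face_system_def by fastforce+
    have S2: "\<exists>x\<in>\<Sigma>. fst x \<inter> T \<noteq> {} \<and> fst x \<inter> ({e \<in> H. v \<in> e} - T) \<noteq> {}"
      if "T \<subseteq> {e \<in> H. v \<in> e}" "T \<noteq> {}" "T \<noteq> {e \<in> H. v \<in> e}" for v T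
      using S that unfolding D.face_system_def by blast
    interpret G: critical_graph W H v0 col
    proof
      show "2 \<le> card (nbrs H v0)" by (rule deg2)
      show "length c \<notin> {5, 6, 7}" if "cyc H c" for c using no567[of c] that HE by (auto simp: cyc_def)
      show "u \<noteq> v \<and> {u, v} \<notin> H" if "triE H x y z" "triE H x' y' z'" "{x, y, z} \<noteq> {x', y', z'}"
        "u \<in> {x, y, z}" "v \<in> {x', y', z'}" for x y z x' y' z' u v
        using tri_far[OF _ _ that(3-5)] that(1,2) HE by (auto simp: triE_def)
      show "(v0 \<in> F) \<noteq> col" if "IF_part H W F" for F using no[of F] that IF_part_induced[of W W E F] by (simp add: H_def)
      show "\<exists>F. IF_part H W' F \<and> (v0 \<in> F) = col" if "W' \<subset> W" "v0 \<in> W'" for W'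
        using IH[OF that] IF_part_induced[of W' W E] that(1) by (auto simp: H_def)
    qed (use finW two HW less.prems(2) deg3 con1 in auto)
    have inj: "inj_on fst \<Sigma>"
    proof (rule inj_onI, rule ccontr)
      fix x y assume xy: "x \<in> \<Sigma>" "y \<in> \<Sigma>" "fst x = fst y" "x \<noteq> y"
      obtain c where c: "cyc H c" "fst x = cedges c" using S1(2)[OF xy(1)] by blast
      obtain a b r where cab: "c = a # b # r" using c(1) by (cases c; cases "tl c") (auto simp: cyc_def)
      then have "a \<noteq> b" using c(1) by (simp add: cyc_def)
      then obtain v where v: "v \<in> set c" "v \<noteq> v0" using cab by (metis list.set_intros)
      have cH: "cedges c \<subseteq> H" using c(1) by (simp add: cyc_def)
      have "\<Union> (cedges c) = set c" by (rule cedges_Union) (simp add: cab)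
      then have vW: "v \<in> W" using v(1) HW cH by blast
      let ?T = "{e \<in> cedges c. v \<in> e}"
      have cT: "card ?T = 2" using card_cedges_at[of c v] c(1) v(1) by (simp add: cyc_def)
      moreover have "card {e \<in> H. v \<in> e} \<noteq> 2" using deg3[OF vW v(2)] card_edges_at[OF two, of v] by simp
      ultimately have T: "?T \<noteq> {}" "?T \<noteq> {e \<in> H. v \<in> e}" by (metis card.empty zero_neq_numeral, metis)
      obtain z where z: "z \<in> \<Sigma>" "fst z \<inter> ?T \<noteq> {}" "fst z \<inter> ({e \<in> H. v \<in> e} - ?T) \<noteq> {}"
        using S2[of ?T v] T cH by blast
      then obtain e where e: "e \<in> fst z" "e \<in> cedges c" by blast
      then have "card {x \<in> \<Sigma>. e \<in> fst x} = 2" using S1(3) cH by blast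
      moreover have "{x, y} \<subseteq> {x \<in> \<Sigma>. e \<in> fst x}" using xy c(2) e(2) by auto
      moreover have "card {x, y} = 2" using xy(4) by simp
      moreover have "finite {x \<in> \<Sigma>. e \<in> fst x}" using S1(1) by simp
      ultimately have "{x, y} = {x \<in> \<Sigma>. e \<in> fst x}" by (metis card_subset_eq)
      then have "z = x \<or> z = y" using z(1) e(1) by blast
      then have "fst z = cedges c" using c(2) xy(3) by auto
      then show False using z(3) by blast
    qed
    interpret Fc: critical_faces W H v0 col "fst ` \<Sigma>"
    proof
      show "card {f \<in> fst ` \<Sigma>. e \<in> f} = 2" if "e \<in> H" for e
      proof -
        have "{f \<in> fst ` \<Sigma>. e \<in> f} = fst ` {x \<in> \<Sigma>. e \<in> fst x}" by auto
        moreover have "inj_on fst {x \<in> \<Sigma>. e \<in> fst x}" using inj by (rule inj_on_subset) auto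
        ultimately show ?thesis using S1(3)[OF that] by (simp add: card_image)
      qed
      show "card W + card (fst ` \<Sigma>) = card H + 2" using S1(4) card_image[OF inj] by simp
      show "\<exists>f\<in>fst ` \<Sigma>. f \<inter> T \<noteq> {} \<and> f \<inter> ({e \<in> H. v \<in> e} - T) \<noteq> {}"
        if "T \<subseteq> {e \<in> H. v \<in> e}" "T \<noteq> {}" "T \<noteq> {e \<in> H. v \<in> e}" for v T
        using S2[OF that] by blast
    qed (use S1 in auto)
    show False by (rule Fc.critical_faces_False)
  qed
qed

end

section \<open>Graphs as symmetric digraphs\<close>

lemma (in pre_digraph) cas_pedges:
  "cas u p v \<Longrightarrow> set p \<subseteq> arcs G \<Longrightarrow> pedges (awalk_verts u p) \<subseteq> undirected_edges G"
proof (induction u p v rule: cas.induct)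
  case (2 u e es v)
  then have IH: "pedges (awalk_verts (head G e) es) \<subseteq> undirected_edges G" by simp
  have h: "awalk_verts (head G e) es \<noteq> []" "hd (awalk_verts (head G e) es) = head G e"
    using 2(2) by (cases es; simp)+
  have "{tail G e, head G e} \<in> undirected_edges G" using 2(3) by (auto simp: undirected_edges_def)
  then show ?case using IH h pedges_Cons[OF h(1)] by simp
qed simp

lemma (in pre_digraph) cas_last: "cas u p v \<Longrightarrow> p \<noteq> [] \<Longrightarrow> last (map (head G) p) = v"
  by (induction u p v rule: cas.induct) auto

text \<open>The heads of the arcs form the vertex list. The start of the closed walk reappears as
  the last head, so the first arc provides the closing edge.\<close>

lemma (in pre_digraph) cycle_cyc:
  assumes "cycle p" "3 \<le> length p"
  shows "\<exists>c. cyc (undirected_edges G) c \<and> set c \<subseteq> head G ` arcs G \<and> length c = length p"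
proof -
  obtain u where u: "awalk u p u" "distinct (tl (awalk_verts u p))" "p \<noteq> []" using assms(1) by (auto simp: cycle_def)
  then have w: "cas u p u" "set p \<subseteq> arcs G" by (auto simp: awalk_def)
  let ?c = "map (head G) p"
  have vs: "awalk_verts u p = u # ?c"
    using awalk_verts_conv'[OF w(1)] u(3) w(1) by (cases p) auto
  have "last ?c = u" using cas_last[OF w(1) u(3)] .
  then have "cedges ?c = pedges (u # ?c)" using u(3) pedges_Cons[of ?c u] by (simp add: cedges_def)
  also have "\<dots> \<subseteq> undirected_edges G" using cas_pedges[OF w] vs by simp
  finally have "cyc (undirected_edges G) ?c" using u(2) vs assms(2) by (simp add: cyc_def)
  then show ?thesis using w(2) by (intro exI[of _ ?c]) auto
qed

context graph
begin

lemma undirected_arc: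
  assumes "{u, v} \<in> undirected_edges G" obtains e where "e \<in> arcs G" "tail G e = u" "head G e = v"
proof -
  obtain e where e: "e \<in> arcs G" "{u, v} = {tail G e, head G e}" using assms by (auto simp: undirected_edges_def)
  obtain e' where e': "e' \<in> arcs G" "tail G e = head G e'" "head G e = tail G e'"
    using sym_arcs e(1) unfolding symmetric_conv by blast
  show ?thesis
  proof (cases "tail G e = u")
    case True then show ?thesis using that[of e] e by (auto simp: doubleton_eq_iff)
  next
    case False then show ?thesis using that[of e'] e e' by (auto simp: doubleton_eq_iff)
  qed
qed

lemma walk_of_path:
  "pedges vs \<subseteq> undirected_edges G \<Longrightarrow> vs \<noteq> [] \<Longrightarrow>
    \<exists>p. set p \<subseteq> arcs G \<and> cas (hd vs) p (last vs) \<and> awalk_verts (hd vs) p = vs"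
proof (induction vs rule: pedges.induct)
  case (1 x y xs)
  then obtain p where p: "set p \<subseteq> arcs G" "cas y p (last (y # xs))" "awalk_verts y p = y # xs" by auto
  obtain e where "e \<in> arcs G" "tail G e = x" "head G e = y" using undirected_arc 1(2) by auto
  then show ?case using p by (intro exI[of _ "e # p"]) auto
qed (auto intro: exI[of _ "[]"])

lemma cyc_cycle:
  assumes "cyc (undirected_edges G) c"
  shows "\<exists>p. cycle p \<and> length p = length c \<and> tail G ` set p = set c"
proof -
  have c: "c \<noteq> []" "distinct c" "cedges c \<subseteq> undirected_edges G" using assms by (auto simp: cyc_def)
  have "pedges (c @ [hd c]) = cedges c" using c(1) by (simp add: pedges_snoc cedges_def)
  then obtain p where p: "set p \<subseteq> arcs G" "cas (hd c) p (hd c)" "awalk_verts (hd c) p = c @ [hd c]"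
    using walk_of_path[of "c @ [hd c]"] c by auto
  have pn: "p \<noteq> []" using p(3) c(1) by auto
  then have t: "map (tail G) p = c" using p(3) awalk_verts_conv[of "hd c" p] by simp
  have "hd c = tail G (hd p)" using t pn by (cases p) auto
  then have "hd c \<in> verts G" using p(1) pn by (cases p) auto
  then have "awalk (hd c) p (hd c)" using p by (simp add: awalk_def)
  moreover have "distinct (tl (awalk_verts (hd c) p))" using c(1,2) p(3) by (cases c) auto
  ultimately have "cycle p" using pn by (auto simp: cycle_def)
  moreover have "length p = length c" "tail G ` set p = set c" using t by (metis length_map, metis set_map)
  ultimately show ?thesis by blast
qed

lemma two_sets_undirected: "two_sets (undirected_edges G)"
  using no_loops by (auto simp: two_sets_def undirected_edges_def)

lemma undirected_verts: "\<Union> (undirected_edges G) \<subseteq> verts G"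
  by (auto simp: undirected_edges_def)

lemma triE_triangle: assumes "triE (undirected_edges G) x y z" shows "{x, y, z} \<in> triangles G"
proof -
  have "x \<noteq> y" "y \<noteq> z" "x \<noteq> z" using assms two_sets_irrefl[OF two_sets_undirected] unfolding triE_def by metis+
  then have "cyc (undirected_edges G) [x, y, z]" using assms by (auto simp: triE_def cyc_def cedges_def insert_commute)
  then obtain p where "cycle p" "length p = 3" "tail G ` set p = {x, y, z}" using cyc_cycle by fastforce
  then show ?thesis unfolding triangles_def by blast
qed

text \<open>Equality of \<open>u\<close> and \<open>v\<close> or an edge between them would give a
  walk of length 0 or 1, and so a distance below 2.\<close>

lemma triangles_far:
  assumes "2 \<le> triangle_dist G" "triE (undirected_edges G) x y z" "triE (undirected_edges G) x' y' z'"
    "{x, y, z} \<noteq> {x', y', z'}" "u \<in> {x, y, z}" "v \<in> {x', y', z'}"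
  shows "u \<noteq> v \<and> {u, v} \<notin> undirected_edges G"
proof -
  have "triangle_dist G \<le> graph_dist G u v"
    unfolding triangle_dist_def using triE_triangle[OF assms(2)] triE_triangle[OF assms(3)] assms(4-6)
    by (intro Inf_lower) blast
  then have d: "2 \<le> \<mu> (\<lambda>_. 1) u v" using assms(1) by (simp add: graph_dist_def)
  have short: False if "awalk u p v" "length p \<le> 1" for p
  proof -
    have "2 \<le> ereal (awalk_cost (\<lambda>_. 1) p)" using d min_cost_le_walk_cost[OF that(1), of "\<lambda>_. 1"] by (rule order_trans)
    moreover have "awalk_cost (\<lambda>_. 1) p \<le> 1" using that(2) by (cases p; cases "tl p") (auto simp: awalk_cost_def)
    ultimately have "2 \<le> ereal 1" by (meson ereal_less_eq(3) order_trans)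
    then show False by simp
  qed
  have uv: "u \<in> verts G" using assms(2,5) undirected_verts by (auto simp: triE_def)
  have "u \<noteq> v" using short[of "[]"] uv by (auto simp: awalk_def)
  moreover have "{u, v} \<notin> undirected_edges G"
  proof
    assume "{u, v} \<in> undirected_edges G"
    then obtain e where "e \<in> arcs G" "tail G e = u" "head G e = v" by (rule undirected_arc)
    then show False using short[of "[e]"] uv by (auto simp: awalk_def)
  qed
  ultimately show ?thesis by blast
qed

lemma IF_part_partitionable:
  assumes "IF_part (undirected_edges G) (verts G) F" shows "IF_partitionable G"
  unfolding IF_partitionable_def
proof (intro exI conjI)
  have F: "F \<subseteq> verts G" using assms by (simp add: IF_part_def)
  then show "(verts G - F) \<union> F = verts G" "(verts G - F) \<inter> F = {}" by auto
  have "\<not> (tail G e \<in> verts G - F \<and> head G e \<in> verts G - F)" if "e \<in> arcs G" for e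
    using assms that unfolding IF_part_def undirected_edges_def by blast
  then show "arcs (G \<restriction> (verts G - F)) = {}" by auto
  show "undirected_forest (G \<restriction> F)"
    unfolding undirected_forest_def
  proof
    assume "\<exists>k. has_cycle_of_length (G \<restriction> F) k"
    then obtain p where p: "pre_digraph.cycle (G \<restriction> F) p" "3 \<le> length p" by (auto simp: has_cycle_of_length_def)
    obtain c where c: "cyc (undirected_edges (G \<restriction> F)) c" "set c \<subseteq> head (G \<restriction> F) ` arcs (G \<restriction> F)"
      using pre_digraph.cycle_cyc[OF p] by blast
    have "undirected_edges (G \<restriction> F) \<subseteq> undirected_edges G" by (auto simp: undirected_edges_def)
    then have "cyc (undirected_edges G) c" using c(1) by (auto simp: cyc_def)
    moreover have "set c \<subseteq> F" using c(2) by auto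
    ultimately show False using assms by (auto simp: IF_part_def acyclic_on_def)
  qed
qed

end

theorem theorem1p4:
  fixes G :: "('a, 'b) pre_digraph"
  assumes "graph G"
    and "planar G"
    and "triangle_dist G \<ge> 2"
    and "\<not> has_cycle_of_length G 5"
    and "\<not> has_cycle_of_length G 6"
    and "\<not> has_cycle_of_length G 7"
  shows "IF_partitionable G"
proof -
  interpret graph G by (rule assms(1))
  obtain \<phi> \<gamma> where pe: "plane_embedding G \<phi> \<gamma>" using assms(2) by (auto simp: planar_def)
  let ?E = "undirected_edges G"
  have "sparse_drawing (verts G) ?E \<phi> \<gamma>"
  proof
    show "length c \<notin> {5, 6, 7}" if c: "cyc ?E c" for c
    proof -
      obtain p where "cycle p" "length p = length c" using cyc_cycle[OF c] by blast
      then have "has_cycle_of_length G (length c)" using c by (auto simp: has_cycle_of_length_def cyc_def)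
      then show ?thesis using assms(4-6) by auto
    qed
    show "u \<noteq> v \<and> {u, v} \<notin> ?E" if "triE ?E x y z" "triE ?E x' y' z'" "{x, y, z} \<noteq> {x', y', z'}"
      "u \<in> {x, y, z}" "v \<in> {x', y', z'}" for x y z x' y' z' u v
      by (rule triangles_far[OF assms(3) that])
    show "finite (verts G)" "two_sets ?E" "\<Union> ?E \<subseteq> verts G"
      using two_sets_undirected undirected_verts by simp_all
    show "inj_on \<phi> (verts G)" using pe by (simp add: plane_embedding_def)
    fix e assume e: "e \<in> ?E"
    note D = pe[unfolded plane_embedding_def arc_interior_def, THEN conjunct2, THEN bspec, OF e]
    show "Path_Connected.arc (\<gamma> e)" "{pathstart (\<gamma> e), pathfinish (\<gamma> e)} = \<phi> ` e"
      "(path_image (\<gamma> e) - {pathstart (\<gamma> e), pathfinish (\<gamma> e)}) \<inter> \<phi> ` verts G = {}"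
      using D[THEN conjunct1] D[THEN conjunct2, THEN conjunct1] D[THEN conjunct2, THEN conjunct2, THEN conjunct1] by this+
    show "(path_image (\<gamma> e) - {pathstart (\<gamma> e), pathfinish (\<gamma> e)}) \<inter> path_image (\<gamma> f) = {}"
      if "f \<in> ?E" "f \<noteq> e" for f
      using D[THEN conjunct2, THEN conjunct2, THEN conjunct2, THEN bspec, OF that(1)] that(2) by (rule mp)
  qed
  then interpret S: sparse_drawing "verts G" ?E \<phi> \<gamma> .
  have "\<exists>F. IF_part ?E (verts G) F"
  \<comment> \<open>\<open>precolouring\<close> needs a vertex whose side is prescribed, so the
    empty graph is treated apart.\<close>
  proof (cases "verts G = {}")
    case True
    then have "IF_part ?E (verts G) {}" by (auto simp: IF_part_def acyclic_on_def cyc_def)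
    then show ?thesis by blast
  next
    case False
    then obtain v where "v \<in> verts G" by blast
    then show ?thesis using S.precolouring[of "verts G" v True] by blast
  qed
  then show ?thesis using IF_part_partitionable by blast
qed

end
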